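(* Let $\mathsf C$ be a category with pullbacks. A colimit in $\mathsf C$ (a colimit cocone $\eta:D\to\Delta c$ of a small diagram $D:\mathsf I\to\mathsf C$) is van Kampen in the standard sense if and only if it is a van Kampen colimit in the double category $\mathbb S\mathsf{pan}(\mathsf C)$, i.e. if and only if its companion loose cocone $\eta^{>}:D^{>}\to\Delta c$ is a loose colimit cocone in $\mathbb S\mathsf{pan}(\mathsf C)$.
   Context: **Standard van Kampen colimits.** A colimit cocone $\eta:D\to\Delta c$ of $D:\mathsf I\to\mathsf C$ is van Kampen if for every functor $E:\mathsf I\to\mathsf C$, every cartesian natural transformation $\alpha:E\to D$ (all naturality squares are pullbacks), every cocone $\lambda:E\to\Delta e$ and every $h:e\to c$ with $h\lambda_i=\eta_i\alpha_i$ for all $i$: $\lambda$ is a colimit cocone if and only if each of the squares $h\lambda_i=\eta_i\alpha_i$ is a pullback. **The double category of spans.** $\mathbb S\mathsf{pan}(\mathsf C)$ is the pseudo double category whose tight category is $\mathsf C$, whose loose arrows are spans in $\mathsf C$ composed by pullback, and whose cells are morphisms of spans. Every tight arrow $f:x\to y$ has a companion, the span $x\xleftarrow{1}x\xrightarrow{f}y$. **Loose colimits.** For a pseudo double functor $X:\mathbb I\to\mathbb D$ of double categories, $\mathbb L\mathsf{ax}(\mathbb I,\mathbb D)$ is the double category of double functors, strict tight transformations, pseudo loose transformations (also called protransformations) and modifications, and $\Delta:\mathbb D\to\mathbb L\mathsf{ax}(\mathbb I,\mathbb D)$ is the diagonal. A loose cocone is a pseudo loose transformation $\epsilon:X\to\Delta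 c$. Composing and whiskering with $\epsilon$ gives a map $t$ taking loose arrows $m:c\to d$ of $\mathbb D$ to pseudo loose transformations $tm:X\to\Delta d$, and cells to modifications. The cocone $\epsilon$ is a *loose colimit cocone* if the resulting map of loose bimodules $\mathbb D(c,-)\to\mathbb L\mathsf{ax}(\mathbb I,\mathbb D)(X,\Delta-)$ is an equivalence, i.e. equivalently: (1) every pseudo loose transformation $X\to\Delta d$ is isomorphic, via a globular modification, to some $tm$; (2) for all loose arrows $m:c\to d$, $m':c\to d'$ and tight $f:d\to d'$, $t$ induces a bijection between cells from $m$ to $m'$ with left boundary $1_c$ and right boundary $f$, and modifications from $tm$ to $tm'$ with left boundary $1_X$ and right boundary $\Delta f$. **Van Kampen colimits in a double category.** Given a tightly colimiting cocone $\eta:D\to\Delta c$ of a diagram $D:\mathbb I\to\mathbb D$ having a pseudo loose transformation companion $\eta^{>}:D^{>}\to\Delta c$, one calls $\eta$ a van Kampen colimit of $D$ if $\eta^{>}$ is a loose colimit cocone of $D^{>}:\mathbb I_\ell\to\mathbb D$, where $\mathbb I_\ell$ is the bicategory indexing the diagram $D^{>}$ obtained from $D$ by covariantly transposing every tight arrow and cell. Here a category $\mathsf I$ is regarded as a double category in the tight direction, so $D:\mathsf I\to\mathsf C$ is a diagram of tight arrows of $\mathbb S\mathsf{pan}(\mathsf C)$; $\mathsf I_\ell$ is $\mathsf I$ regarded as a double category in the loose direction (only identity tight arrows); $D^{>}$ sends each arrow $u$ of $\mathsf I$ to the companion of $D(u)$; and $\eta^{>}$ has as components the companions of the $\eta_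i$.
   Formalization: The stated equivalence fails for some categories with pullbacks; what is proved is that the colimit is van Kampen and every diagram E with a cartesian natural transformation E → D has a colimit if and only if the companion loose cocone is a loose colimit cocone in Span(C). *)

theory Defs
  imports Main "HOL-Library.FuncSet"
begin

section \<open>Categories, colimits, van Kampen colimits\<close>

record ('o, 'a) cat =
  Obj :: "'o set"
  Arr :: "'a set"
  Dom :: "'a \<Rightarrow> 'o"
  Cod :: "'a \<Rightarrow> 'o"
  Idt :: "'o \<Rightarrow> 'a"
  Comp :: "'a \<Rightarrow> 'a \<Rightarrow> 'a"  (infixr "\<bullet>\<index>" 70)

definition hom :: "('o, 'a) cat \<Rightarrow> 'o \<Rightarrow> 'o \<Rightarrow> 'a set" where
  "hom C x y = {f \<in> Arr C. Dom C f = x \<and> Cod C f = y}"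

locale category =
  fixes C :: "('o, 'a) cat"  (structure)
  assumes Dom_Obj: "f \<in> Arr C \<Longrightarrow> Dom C f \<in> Obj C"
    and Cod_Obj: "f \<in> Arr C \<Longrightarrow> Cod C f \<in> Obj C"
    and Idt_hom: "x \<in> Obj C \<Longrightarrow> Idt C x \<in> hom C x x"
    and Comp_hom: "\<lbrakk>f \<in> hom C x y; g \<in> hom C y z\<rbrakk> \<Longrightarrow> g \<bullet> f \<in> hom C x z"
    and Comp_Idt: "f \<in> Arr C \<Longrightarrow> f \<bullet> Idt C (Dom C f) = f"
    and Idt_Comp: "f \<in> Arr C \<Longrightarrow> Idt C (Cod C f) \<bullet> f = f"
    and Comp_assoc: "\<lbrakk>f \<in> hom C w x; g \<in> hom C x y; h \<in> hom C y z\<rbrakk>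
      \<Longrightarrow> (h \<bullet> g) \<bullet> f = h \<bullet> (g \<bullet> f)"

definition inverse_arrows :: "('o, 'a) cat \<Rightarrow> 'a \<Rightarrow> 'a \<Rightarrow> bool" where
  "inverse_arrows C f g \<longleftrightarrow> f \<in> Arr C \<and> g \<in> hom C (Cod C f) (Dom C f) \<and>
     g \<bullet>\<^bsub>C\<^esub> f = Idt C (Dom C f) \<and> f \<bullet>\<^bsub>C\<^esub> g = Idt C (Cod C f)"

definition iso :: "('o, 'a) cat \<Rightarrow> 'a \<Rightarrow> bool" where
  "iso C f \<longleftrightarrow> (\<exists>g. inverse_arrows C f g)"

definition inverse_arr :: "('o, 'a) cat \<Rightarrow> 'a \<Rightarrow> 'a" where
  "inverse_arr C f = (THE g. inverse_arrows C f g)"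

record ('i, 'j, 'o, 'a) ftor =
  fob :: "'i \<Rightarrow> 'o"
  far :: "'j \<Rightarrow> 'a"

definition is_functor :: "('i, 'j) cat \<Rightarrow> ('o, 'a) cat \<Rightarrow> ('i, 'j, 'o, 'a) ftor \<Rightarrow> bool" where
  "is_functor I C F \<longleftrightarrow>
     (\<forall>i\<in>Obj I. fob F i \<in> Obj C) \<and>
     (\<forall>u\<in>Arr I. far F u \<in> hom C (fob F (Dom I u)) (fob F (Cod I u))) \<and>
     (\<forall>i\<in>Obj I. far F (Idt I i) = Idt C (fob F i)) \<and>
     (\<forall>u\<in>Arr I. \<forall>v\<in>Arr I. Cod I u = Dom I v \<longrightarrow> far F (v \<bullet>\<^bsub>I\<^esub> u) = far F v \<bullet>\<^bsub>C\<^esub> far F u)"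

definition commuting_square :: "('o, 'a) cat \<Rightarrow> 'a \<Rightarrow> 'a \<Rightarrow> 'a \<Rightarrow> 'a \<Rightarrow> bool" where
  "commuting_square C f g p q \<longleftrightarrow>
     {f, g, p, q} \<subseteq> Arr C \<and> Cod C f = Cod C g \<and> Dom C p = Dom C q \<and>
     Cod C p = Dom C f \<and> Cod C q = Dom C g \<and> f \<bullet>\<^bsub>C\<^esub> p = g \<bullet>\<^bsub>C\<^esub> q"

definition is_pullback :: "('o, 'a) cat \<Rightarrow> 'a \<Rightarrow> 'a \<Rightarrow> 'a \<Rightarrow> 'a \<Rightarrow> bool" where
  "is_pullback C f g p q \<longleftrightarrow> commuting_square C f g p q \<and>
     (\<forall>a b. commuting_square C f g a b \<longrightarrow>
        (\<exists>!u. u \<in> hom C (Dom C a) (Dom C p) \<and> p \<bullet>\<^bsub>C\<^esub> u = a \<and> q \<bullet>\<^bsub>C\<^esub> u = b))"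

definition has_pullbacks :: "('o, 'a) cat \<Rightarrow> bool" where
  "has_pullbacks C \<longleftrightarrow>
     (\<forall>f\<in>Arr C. \<forall>g\<in>Arr C. Cod C f = Cod C g \<longrightarrow> (\<exists>p q. is_pullback C f g p q))"

definition is_cocone ::
  "('i, 'j) cat \<Rightarrow> ('o, 'a) cat \<Rightarrow> ('i, 'j, 'o, 'a) ftor \<Rightarrow> 'o \<Rightarrow> ('i \<Rightarrow> 'a) \<Rightarrow> bool" where
  "is_cocone I C D c \<eta> \<longleftrightarrow> c \<in> Obj C \<and> (\<forall>i\<in>Obj I. \<eta> i \<in> hom C (fob D i) c) \<and>
     (\<forall>u\<in>Arr I. \<eta> (Cod I u) \<bullet>\<^bsub>C\<^esub> far D u = \<eta> (Dom I u))"

definition colimit_cocone ::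
  "('i, 'j) cat \<Rightarrow> ('o, 'a) cat \<Rightarrow> ('i, 'j, 'o, 'a) ftor \<Rightarrow> 'o \<Rightarrow> ('i \<Rightarrow> 'a) \<Rightarrow> bool" where
  "colimit_cocone I C D c \<eta> \<longleftrightarrow> is_cocone I C D c \<eta> \<and>
     (\<forall>d \<mu>. is_cocone I C D d \<mu> \<longrightarrow> (\<exists>!h. h \<in> hom C c d \<and> (\<forall>i\<in>Obj I. h \<bullet>\<^bsub>C\<^esub> \<eta> i = \<mu> i)))"

definition cartesian_transformation ::
  "('i, 'j) cat \<Rightarrow> ('o, 'a) cat \<Rightarrow> ('i, 'j, 'o, 'a) ftor \<Rightarrow> ('i, 'j, 'o, 'a) ftor
     \<Rightarrow> ('i \<Rightarrow> 'a) \<Rightarrow> bool" where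
  "cartesian_transformation I C E D \<alpha> \<longleftrightarrow>
     (\<forall>i\<in>Obj I. \<alpha> i \<in> hom C (fob E i) (fob D i)) \<and>
     (\<forall>u\<in>Arr I. is_pullback C (far D u) (\<alpha> (Cod I u)) (\<alpha> (Dom I u)) (far E u))"

definition van_kampen ::
  "('i, 'j) cat \<Rightarrow> ('o, 'a) cat \<Rightarrow> ('i, 'j, 'o, 'a) ftor \<Rightarrow> 'o \<Rightarrow> ('i \<Rightarrow> 'a) \<Rightarrow> bool" where
  "van_kampen I C D c \<eta> \<longleftrightarrow>
     (\<forall>E \<alpha> e l h. is_functor I C E \<and> cartesian_transformation I C E D \<alpha> \<and>
        is_cocone I C E e l \<and> h \<in> hom C e c \<and> (\<forall>i\<in>Obj I. h \<bullet>\<^bsub>C\<^esub> l i = \<eta> i \<bullet>\<^bsub>C\<^esub> \<alpha> i)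
      \<longrightarrow> (colimit_cocone I C E e l \<longleftrightarrow> (\<forall>i\<in>Obj I. is_pullback C h (\<eta> i) (l i) (\<alpha> i))))"

text \<open>The van Kampen condition says nothing about a diagram \<open>E\<close> over \<open>D\<close> that has neither a
  colimit nor a cocone of pullback squares, whereas a loose colimit produces a colimit of every
  diagram \<open>E\<close> with a cartesian transformation \<open>E \<Rightarrow> D\<close>.\<close>

definition cartesian_colimits ::
  "('i, 'j) cat \<Rightarrow> ('o, 'a) cat \<Rightarrow> ('i, 'j, 'o, 'a) ftor \<Rightarrow> bool" where
  "cartesian_colimits I C D \<longleftrightarrow>
     (\<forall>E \<alpha>. is_functor I C E \<and> cartesian_transformation I C E D \<alpha>
        \<longrightarrow> (\<exists>e l. colimit_cocone I C E e l))"


section \<open>Pseudo double categories\<close>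

text \<open>A category of objects and tight arrows, a category of loose arrows and cells (whose
  composition is the composition of cells in the tight direction), and the loose structure.
  Loose composition is written in diagrammatic order.  The associator has components
  \<open>(m \<odot> n) \<odot> p \<rightarrow> m \<odot> (n \<odot> p)\<close> and the unitors \<open>U x \<odot> m \<rightarrow> m\<close> and \<open>m \<odot> U y \<rightarrow> m\<close>.\<close>

record ('o, 't, 'm, 's) dblcat =
  tightcat :: "('o, 't) cat"
  cellcat :: "('m, 's) cat"
  lsrc :: "'m \<Rightarrow> 'o"
  ltgt :: "'m \<Rightarrow> 'o"
  lft :: "'s \<Rightarrow> 't"
  rgt :: "'s \<Rightarrow> 't"
  unit :: "'o \<Rightarrow> 'm"
  unitcell :: "'t \<Rightarrow> 's"
  lcomp :: "'m \<Rightarrow> 'm \<Rightarrow> 'm"  (infixr "\<odot>\<index>" 75)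
  hcomp :: "'s \<Rightarrow> 's \<Rightarrow> 's"  (infixr "\<star>\<index>" 75)
  assoc :: "'m \<Rightarrow> 'm \<Rightarrow> 'm \<Rightarrow> 's"
  lunit :: "'m \<Rightarrow> 's"
  runit :: "'m \<Rightarrow> 's"

abbreviation vcomp :: "('o, 't, 'm, 's) dblcat \<Rightarrow> 's \<Rightarrow> 's \<Rightarrow> 's"  (infixr "\<cdot>\<index>" 70)
  where "t \<cdot>\<^bsub>D\<^esub> s \<equiv> Comp (cellcat D) t s"

abbreviation idcell :: "('o, 't, 'm, 's) dblcat \<Rightarrow> 'm \<Rightarrow> 's"
  where "idcell D \<equiv> Idt (cellcat D)"

definition lhom :: "('o, 't, 'm, 's) dblcat \<Rightarrow> 'o \<Rightarrow> 'o \<Rightarrow> 'm set" where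
  "lhom D x y = {m \<in> Obj (cellcat D). lsrc D m = x \<and> ltgt D m = y}"

definition cells :: "('o, 't, 'm, 's) dblcat \<Rightarrow> 'm \<Rightarrow> 'm \<Rightarrow> 't \<Rightarrow> 't \<Rightarrow> 's set" where
  "cells D m n f g = {s \<in> hom (cellcat D) m n. lft D s = f \<and> rgt D s = g}"

definition globular_iso :: "('o, 't, 'm, 's) dblcat \<Rightarrow> 'm \<Rightarrow> 'm \<Rightarrow> 's \<Rightarrow> bool" where
  "globular_iso D m n s \<longleftrightarrow>
     s \<in> cells D m n (Idt (tightcat D) (lsrc D m)) (Idt (tightcat D) (ltgt D m)) \<and>
     iso (cellcat D) s"

locale pseudo_double_category =
  fixes D :: "('o, 't, 'm, 's) dblcat"  (structure)
  assumes tight_category: "category (tightcat D)"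
    and cell_category: "category (cellcat D)"
    and src_functor: "is_functor (cellcat D) (tightcat D) \<lparr>fob = lsrc D, far = lft D\<rparr>"
    and tgt_functor: "is_functor (cellcat D) (tightcat D) \<lparr>fob = ltgt D, far = rgt D\<rparr>"
    and unit_functor: "is_functor (tightcat D) (cellcat D) \<lparr>fob = unit D, far = unitcell D\<rparr>"
    and unit_lhom: "x \<in> Obj (tightcat D) \<Longrightarrow> unit D x \<in> lhom D x x"
    and unitcell_boundary: "f \<in> Arr (tightcat D) \<Longrightarrow>
      lft D (unitcell D f) = f \<and> rgt D (unitcell D f) = f"
    and lcomp_lhom: "\<lbrakk>m \<in> lhom D x y; n \<in> lhom D y z\<rbrakk> \<Longrightarrow> m \<odot> n \<in> lhom D x z"
    and hcomp_cells: "\<lbrakk>s \<in> cells D m m' f g; t \<in> cells D n n' g h; ltgt D m = lsrc D n;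
      ltgt D m' = lsrc D n'\<rbrakk> \<Longrightarrow> s \<star> t \<in> cells D (m \<odot> n) (m' \<odot> n') f h"
    and hcomp_idcell: "\<lbrakk>m \<in> lhom D x y; n \<in> lhom D y z\<rbrakk>
      \<Longrightarrow> idcell D m \<star> idcell D n = idcell D (m \<odot> n)"
    and interchange: "\<lbrakk>s \<in> cells D m m' f g; t \<in> cells D n n' g h; ltgt D m = lsrc D n;
        s' \<in> cells D m' m'' f' g'; t' \<in> cells D n' n'' g' h'; ltgt D m' = lsrc D n';
        ltgt D m'' = lsrc D n''\<rbrakk>
      \<Longrightarrow> (s' \<cdot> s) \<star> (t' \<cdot> t) = (s' \<star> t') \<cdot> (s \<star> t)"
    and assoc_iso: "\<lbrakk>m \<in> lhom D w x; n \<in> lhom D x y; p \<in> lhom D y z\<rbrakk>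
      \<Longrightarrow> globular_iso D ((m \<odot> n) \<odot> p) (m \<odot> (n \<odot> p)) (assoc D m n p)"
    and lunit_iso: "m \<in> lhom D x y \<Longrightarrow> globular_iso D (unit D x \<odot> m) m (lunit D m)"
    and runit_iso: "m \<in> lhom D x y \<Longrightarrow> globular_iso D (m \<odot> unit D y) m (runit D m)"
    and assoc_natural: "\<lbrakk>s \<in> cells D m m' f g; t \<in> cells D n n' g h; r \<in> cells D p p' h k;
        ltgt D m = lsrc D n; ltgt D n = lsrc D p; ltgt D m' = lsrc D n'; ltgt D n' = lsrc D p'\<rbrakk>
      \<Longrightarrow> assoc D m' n' p' \<cdot> ((s \<star> t) \<star> r) = (s \<star> (t \<star> r)) \<cdot> assoc D m n p"
    and lunit_natural: "s \<in> cells D m m' f g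
      \<Longrightarrow> lunit D m' \<cdot> (unitcell D f \<star> s) = s \<cdot> lunit D m"
    and runit_natural: "s \<in> cells D m m' f g
      \<Longrightarrow> runit D m' \<cdot> (s \<star> unitcell D g) = s \<cdot> runit D m"
    and pentagon: "\<lbrakk>m \<in> lhom D v w; n \<in> lhom D w x; p \<in> lhom D x y; q \<in> lhom D y z\<rbrakk>
      \<Longrightarrow> assoc D m n (p \<odot> q) \<cdot> assoc D (m \<odot> n) p q =
          (idcell D m \<star> assoc D n p q) \<cdot> assoc D m (n \<odot> p) q \<cdot> (assoc D m n p \<star> idcell D q)"
    and triangle: "\<lbrakk>m \<in> lhom D x y; n \<in> lhom D y z\<rbrakk>
      \<Longrightarrow> (idcell D m \<star> lunit D n) \<cdot> assoc D m (unit D y) n = runit D m \<star> idcell D n"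


section \<open>Double functors, pseudo loose transformations, modifications\<close>

text \<open>The comparison cells of a double functor \<open>X\<close> have the directions
  \<open>dcomp X u v : X u \<odot> X v \<rightarrow> X (u \<odot> v)\<close> and \<open>dunit X i : U (X i) \<rightarrow> X (U i)\<close>.\<close>

record ('i, 'k, 'u, 'w, 'o, 't, 'm, 's) dftor =
  dob :: "'i \<Rightarrow> 'o"
  dtight :: "'k \<Rightarrow> 't"
  dloose :: "'u \<Rightarrow> 'm"
  dcell :: "'w \<Rightarrow> 's"
  dcomp :: "'u \<Rightarrow> 'u \<Rightarrow> 's"
  dunit :: "'i \<Rightarrow> 's"

locale pseudo_double_functor =
  fixes J :: "('i, 'k, 'u, 'w) dblcat" and D :: "('o, 't, 'm, 's) dblcat"
    and X :: "('i, 'k, 'u, 'w, 'o, 't, 'm, 's) dftor"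
  assumes tight_functor: "is_functor (tightcat J) (tightcat D) \<lparr>fob = dob X, far = dtight X\<rparr>"
    and cell_functor: "is_functor (cellcat J) (cellcat D) \<lparr>fob = dloose X, far = dcell X\<rparr>"
    and loose_boundary: "u \<in> lhom J i j \<Longrightarrow> dloose X u \<in> lhom D (dob X i) (dob X j)"
    and cell_boundary: "w \<in> Arr (cellcat J) \<Longrightarrow>
      lft D (dcell X w) = dtight X (lft J w) \<and> rgt D (dcell X w) = dtight X (rgt J w)"
    and dcomp_iso: "\<lbrakk>u \<in> lhom J i j; v \<in> lhom J j k\<rbrakk>
      \<Longrightarrow> globular_iso D (dloose X u \<odot>\<^bsub>D\<^esub> dloose X v) (dloose X (u \<odot>\<^bsub>J\<^esub> v)) (dcomp X u v)"
    and dunit_iso: "i \<in> Obj (tightcat J)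
      \<Longrightarrow> globular_iso D (unit D (dob X i)) (dloose X (unit J i)) (dunit X i)"
    and dcomp_natural: "\<lbrakk>s \<in> cells J u u' f g; t \<in> cells J v v' g h; ltgt J u = lsrc J v;
        ltgt J u' = lsrc J v'\<rbrakk>
      \<Longrightarrow> dcomp X u' v' \<cdot>\<^bsub>D\<^esub> (dcell X s \<star>\<^bsub>D\<^esub> dcell X t)
          = dcell X (s \<star>\<^bsub>J\<^esub> t) \<cdot>\<^bsub>D\<^esub> dcomp X u v"
    and dunit_natural: "f \<in> hom (tightcat J) i i'
      \<Longrightarrow> dunit X i' \<cdot>\<^bsub>D\<^esub> unitcell D (dtight X f) = dcell X (unitcell J f) \<cdot>\<^bsub>D\<^esub> dunit X i"
    and dcomp_assoc: "\<lbrakk>u \<in> lhom J i j; v \<in> lhom J j k; z \<in> lhom J k l\<rbrakk>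
      \<Longrightarrow> dcell X (assoc J u v z) \<cdot>\<^bsub>D\<^esub> dcomp X (u \<odot>\<^bsub>J\<^esub> v) z
            \<cdot>\<^bsub>D\<^esub> (dcomp X u v \<star>\<^bsub>D\<^esub> idcell D (dloose X z))
          = dcomp X u (v \<odot>\<^bsub>J\<^esub> z) \<cdot>\<^bsub>D\<^esub> (idcell D (dloose X u) \<star>\<^bsub>D\<^esub> dcomp X v z)
            \<cdot>\<^bsub>D\<^esub> assoc D (dloose X u) (dloose X v) (dloose X z)"
    and dcomp_lunit: "u \<in> lhom J i j
      \<Longrightarrow> dcell X (lunit J u) \<cdot>\<^bsub>D\<^esub> dcomp X (unit J i) u
            \<cdot>\<^bsub>D\<^esub> (dunit X i \<star>\<^bsub>D\<^esub> idcell D (dloose X u)) = lunit D (dloose X u)"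
    and dcomp_runit: "u \<in> lhom J i j
      \<Longrightarrow> dcell X (runit J u) \<cdot>\<^bsub>D\<^esub> dcomp X u (unit J j)
            \<cdot>\<^bsub>D\<^esub> (idcell D (dloose X u) \<star>\<^bsub>D\<^esub> dunit X j) = runit D (dloose X u)"

text \<open>A loose transformation \<open>\<epsilon> : X \<Rightarrow> Y\<close> has components \<open>lob \<epsilon> i : X i -|-> Y i\<close>, a cell
  \<open>ltight \<epsilon> f : lob \<epsilon> i \<rightarrow> lob \<epsilon> i'\<close> for each tight \<open>f : i \<rightarrow> i'\<close>, and a globular cell
  \<open>lloose \<epsilon> u : X u \<odot> lob \<epsilon> j \<rightarrow> lob \<epsilon> i \<odot> Y u\<close> for each loose \<open>u : i -|-> j\<close>.\<close>

record ('i, 'k, 'u, 'm, 's) ltrans =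
  lob :: "'i \<Rightarrow> 'm"
  ltight :: "'k \<Rightarrow> 's"
  lloose :: "'u \<Rightarrow> 's"

locale pseudo_loose_transformation =
  fixes J :: "('i, 'k, 'u, 'w) dblcat" and D :: "('o, 't, 'm, 's) dblcat"
    and X Y :: "('i, 'k, 'u, 'w, 'o, 't, 'm, 's) dftor"
    and \<epsilon> :: "('i, 'k, 'u, 'm, 's) ltrans"
  assumes lob_lhom: "i \<in> Obj (tightcat J) \<Longrightarrow> lob \<epsilon> i \<in> lhom D (dob X i) (dob Y i)"
    and ltight_functor: "is_functor (tightcat J) (cellcat D) \<lparr>fob = lob \<epsilon>, far = ltight \<epsilon>\<rparr>"
    and ltight_boundary: "f \<in> Arr (tightcat J) \<Longrightarrow>
      lft D (ltight \<epsilon> f) = dtight X f \<and> rgt D (ltight \<epsilon> f) = dtight Y f"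
    and lloose_iso: "u \<in> lhom J i j \<Longrightarrow>
      globular_iso D (dloose X u \<odot>\<^bsub>D\<^esub> lob \<epsilon> j) (lob \<epsilon> i \<odot>\<^bsub>D\<^esub> dloose Y u) (lloose \<epsilon> u)"
    and lloose_natural: "w \<in> cells J u u' f g \<Longrightarrow>
      lloose \<epsilon> u' \<cdot>\<^bsub>D\<^esub> (dcell X w \<star>\<^bsub>D\<^esub> ltight \<epsilon> g) = (ltight \<epsilon> f \<star>\<^bsub>D\<^esub> dcell Y w) \<cdot>\<^bsub>D\<^esub> lloose \<epsilon> u"
    and lloose_unit: "i \<in> Obj (tightcat J) \<Longrightarrow>
      lloose \<epsilon> (unit J i) \<cdot>\<^bsub>D\<^esub> (dunit X i \<star>\<^bsub>D\<^esub> idcell D (lob \<epsilon> i))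
      = (idcell D (lob \<epsilon> i) \<star>\<^bsub>D\<^esub> dunit Y i)
        \<cdot>\<^bsub>D\<^esub> inverse_arr (cellcat D) (runit D (lob \<epsilon> i)) \<cdot>\<^bsub>D\<^esub> lunit D (lob \<epsilon> i)"
    and lloose_comp: "\<lbrakk>u \<in> lhom J i j; v \<in> lhom J j k\<rbrakk> \<Longrightarrow>
      lloose \<epsilon> (u \<odot>\<^bsub>J\<^esub> v) \<cdot>\<^bsub>D\<^esub> (dcomp X u v \<star>\<^bsub>D\<^esub> idcell D (lob \<epsilon> k))
      = (idcell D (lob \<epsilon> i) \<star>\<^bsub>D\<^esub> dcomp Y u v)
        \<cdot>\<^bsub>D\<^esub> assoc D (lob \<epsilon> i) (dloose Y u) (dloose Y v)
        \<cdot>\<^bsub>D\<^esub> (lloose \<epsilon> u \<star>\<^bsub>D\<^esub> idcell D (dloose Y v))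
        \<cdot>\<^bsub>D\<^esub> inverse_arr (cellcat D) (assoc D (dloose X u) (lob \<epsilon> j) (dloose Y v))
        \<cdot>\<^bsub>D\<^esub> (idcell D (dloose X u) \<star>\<^bsub>D\<^esub> lloose \<epsilon> v)
        \<cdot>\<^bsub>D\<^esub> assoc D (dloose X u) (dloose X v) (lob \<epsilon> k)"

definition ltrans_comp ::
  "('o, 't, 'm, 's) dblcat \<Rightarrow> ('i, 'k, 'u, 'w) dblcat
   \<Rightarrow> ('i, 'k, 'u, 'w, 'o, 't, 'm, 's) dftor \<Rightarrow> ('i, 'k, 'u, 'w, 'o, 't, 'm, 's) dftor
   \<Rightarrow> ('i, 'k, 'u, 'w, 'o, 't, 'm, 's) dftor
   \<Rightarrow> ('i, 'k, 'u, 'm, 's) ltrans \<Rightarrow> ('i, 'k, 'u, 'm, 's) ltrans \<Rightarrow> ('i, 'k, 'u, 'm, 's) ltrans"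
  where
  "ltrans_comp D J X Y Z \<epsilon> \<theta> =
     \<lparr>lob = (\<lambda>i. lob \<epsilon> i \<odot>\<^bsub>D\<^esub> lob \<theta> i),
      ltight = (\<lambda>f. ltight \<epsilon> f \<star>\<^bsub>D\<^esub> ltight \<theta> f),
      lloose = (\<lambda>u. let i = lsrc J u; j = ltgt J u in
        inverse_arr (cellcat D) (assoc D (lob \<epsilon> i) (lob \<theta> i) (dloose Z u))
        \<cdot>\<^bsub>D\<^esub> (idcell D (lob \<epsilon> i) \<star>\<^bsub>D\<^esub> lloose \<theta> u)
        \<cdot>\<^bsub>D\<^esub> assoc D (lob \<epsilon> i) (dloose Y u) (lob \<theta> j)
        \<cdot>\<^bsub>D\<^esub> (lloose \<epsilon> u \<star>\<^bsub>D\<^esub> idcell D (lob \<theta> j))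
        \<cdot>\<^bsub>D\<^esub> inverse_arr (cellcat D) (assoc D (dloose X u) (lob \<epsilon> j) (lob \<theta> j)))\<rparr>"

record ('i, 'u, 't, 's) ttrans =
  tob :: "'i \<Rightarrow> 't"
  tloose :: "'u \<Rightarrow> 's"

definition ttrans_id ::
  "('o, 't, 'm, 's) dblcat \<Rightarrow> ('i, 'k, 'u, 'w, 'o, 't, 'm, 's) dftor \<Rightarrow> ('i, 'u, 't, 's) ttrans"
  where
  "ttrans_id D X = \<lparr>tob = (\<lambda>i. Idt (tightcat D) (dob X i)),
     tloose = (\<lambda>u. idcell D (dloose X u))\<rparr>"

text \<open>The modifications \<open>\<epsilon> \<rightarrow> \<epsilon>'\<close> whose left and right boundaries are the strict tight
  transformations \<open>\<sigma>\<close> and \<open>\<tau>\<close>.  Extensionality makes modifications that agree on all objects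
  of \<open>J\<close> equal as functions.\<close>

definition modifications ::
  "('i, 'k, 'u, 'w) dblcat \<Rightarrow> ('o, 't, 'm, 's) dblcat
   \<Rightarrow> ('i, 'k, 'u, 'm, 's) ltrans \<Rightarrow> ('i, 'k, 'u, 'm, 's) ltrans
   \<Rightarrow> ('i, 'u, 't, 's) ttrans \<Rightarrow> ('i, 'u, 't, 's) ttrans \<Rightarrow> ('i \<Rightarrow> 's) set" where
  "modifications J D \<epsilon> \<epsilon>' \<sigma> \<tau> =
     {\<mu> \<in> extensional (Obj (tightcat J)).
        (\<forall>i\<in>Obj (tightcat J). \<mu> i \<in> cells D (lob \<epsilon> i) (lob \<epsilon>' i) (tob \<sigma> i) (tob \<tau> i)) \<and>
        (\<forall>f\<in>Arr (tightcat J).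
           \<mu> (Cod (tightcat J) f) \<cdot>\<^bsub>D\<^esub> ltight \<epsilon> f = ltight \<epsilon>' f \<cdot>\<^bsub>D\<^esub> \<mu> (Dom (tightcat J) f)) \<and>
        (\<forall>u\<in>Obj (cellcat J).
           lloose \<epsilon>' u \<cdot>\<^bsub>D\<^esub> (tloose \<sigma> u \<star>\<^bsub>D\<^esub> \<mu> (ltgt J u))
           = (\<mu> (lsrc J u) \<star>\<^bsub>D\<^esub> tloose \<tau> u) \<cdot>\<^bsub>D\<^esub> lloose \<epsilon> u)}"

text \<open>The left boundary \<open>ttrans_id D X\<close> and right boundary \<open>ttrans_id D Y\<close> make the
  modifications globular.\<close>

definition ltrans_isomorphic ::
  "('i, 'k, 'u, 'w) dblcat \<Rightarrow> ('o, 't, 'm, 's) dblcat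
   \<Rightarrow> ('i, 'k, 'u, 'w, 'o, 't, 'm, 's) dftor \<Rightarrow> ('i, 'k, 'u, 'w, 'o, 't, 'm, 's) dftor
   \<Rightarrow> ('i, 'k, 'u, 'm, 's) ltrans \<Rightarrow> ('i, 'k, 'u, 'm, 's) ltrans \<Rightarrow> bool" where
  "ltrans_isomorphic J D X Y \<epsilon> \<epsilon>' \<longleftrightarrow>
     (\<exists>\<mu> \<in> modifications J D \<epsilon> \<epsilon>' (ttrans_id D X) (ttrans_id D Y).
      \<exists>\<nu> \<in> modifications J D \<epsilon>' \<epsilon> (ttrans_id D X) (ttrans_id D Y).
        \<forall>i\<in>Obj (tightcat J). \<nu> i \<cdot>\<^bsub>D\<^esub> \<mu> i = idcell D (lob \<epsilon> i) \<and>
                              \<mu> i \<cdot>\<^bsub>D\<^esub> \<nu> i = idcell D (lob \<epsilon>' i))"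


section \<open>Loose colimits\<close>

definition diag :: "('o, 't, 'm, 's) dblcat \<Rightarrow> 'o \<Rightarrow> ('i, 'k, 'u, 'w, 'o, 't, 'm, 's) dftor" where
  "diag D c = \<lparr>dob = (\<lambda>_. c), dtight = (\<lambda>_. Idt (tightcat D) c), dloose = (\<lambda>_. unit D c),
     dcell = (\<lambda>_. idcell D (unit D c)), dcomp = (\<lambda>_ _. lunit D (unit D c)),
     dunit = (\<lambda>_. idcell D (unit D c))\<rparr>"

definition diag_loose :: "('o, 't, 'm, 's) dblcat \<Rightarrow> 'm \<Rightarrow> ('i, 'k, 'u, 'm, 's) ltrans" where
  "diag_loose D m = \<lparr>lob = (\<lambda>_. m), ltight = (\<lambda>_. idcell D m),
     lloose = (\<lambda>_. inverse_arr (cellcat D) (runit D m) \<cdot>\<^bsub>D\<^esub> lunit D m)\<rparr>"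

definition diag_tight :: "('o, 't, 'm, 's) dblcat \<Rightarrow> 't \<Rightarrow> ('i, 'u, 't, 's) ttrans" where
  "diag_tight D f = \<lparr>tob = (\<lambda>_. f), tloose = (\<lambda>_. unitcell D f)\<rparr>"

text \<open>The map \<open>t\<close> induced by a loose cocone \<open>\<epsilon> : X \<Rightarrow> \<Delta> c\<close>, on loose arrows
  \<open>m : c -|-> d\<close> and on cells.\<close>

definition cocone_map ::
  "('i, 'k, 'u, 'w) dblcat \<Rightarrow> ('o, 't, 'm, 's) dblcat
   \<Rightarrow> ('i, 'k, 'u, 'w, 'o, 't, 'm, 's) dftor \<Rightarrow> ('i, 'k, 'u, 'm, 's) ltrans
   \<Rightarrow> 'm \<Rightarrow> ('i, 'k, 'u, 'm, 's) ltrans" where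
  "cocone_map J D X \<epsilon> m =
     ltrans_comp D J X (diag D (lsrc D m)) (diag D (ltgt D m)) \<epsilon> (diag_loose D m)"

definition cocone_map_cell ::
  "('i, 'k, 'u, 'w) dblcat \<Rightarrow> ('o, 't, 'm, 's) dblcat \<Rightarrow> ('i, 'k, 'u, 'm, 's) ltrans
   \<Rightarrow> 's \<Rightarrow> 'i \<Rightarrow> 's" where
  "cocone_map_cell J D \<epsilon> s = (\<lambda>i\<in>Obj (tightcat J). idcell D (lob \<epsilon> i) \<star>\<^bsub>D\<^esub> s)"

definition loose_cocone ::
  "('i, 'k, 'u, 'w) dblcat \<Rightarrow> ('o, 't, 'm, 's) dblcat
   \<Rightarrow> ('i, 'k, 'u, 'w, 'o, 't, 'm, 's) dftor \<Rightarrow> 'o \<Rightarrow> ('i, 'k, 'u, 'm, 's) ltrans \<Rightarrow> bool" where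
  "loose_cocone J D X c \<epsilon> \<longleftrightarrow>
     c \<in> Obj (tightcat D) \<and> pseudo_loose_transformation J D X (diag D c) \<epsilon>"

definition loose_colimit_cocone ::
  "('i, 'k, 'u, 'w) dblcat \<Rightarrow> ('o, 't, 'm, 's) dblcat
   \<Rightarrow> ('i, 'k, 'u, 'w, 'o, 't, 'm, 's) dftor \<Rightarrow> 'o \<Rightarrow> ('i, 'k, 'u, 'm, 's) ltrans \<Rightarrow> bool" where
  "loose_colimit_cocone J D X c \<epsilon> \<longleftrightarrow> loose_cocone J D X c \<epsilon> \<and>
     (\<forall>d\<in>Obj (tightcat D). \<forall>\<theta>. pseudo_loose_transformation J D X (diag D d) \<theta> \<longrightarrow>
        (\<exists>m\<in>lhom D c d. ltrans_isomorphic J D X (diag D d) \<theta> (cocone_map J D X \<epsilon> m))) \<and>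
     (\<forall>d d' f m m'. f \<in> hom (tightcat D) d d' \<and> m \<in> lhom D c d \<and> m' \<in> lhom D c d' \<longrightarrow>
        bij_betw (cocone_map_cell J D \<epsilon>)
          (cells D m m' (Idt (tightcat D) c) f)
          (modifications J D (cocone_map J D X \<epsilon> m) (cocone_map J D X \<epsilon> m')
             (ttrans_id D X) (diag_tight D f)))"


section \<open>A category regarded as a double category in the loose direction\<close>

definition discrete :: "'x set \<Rightarrow> ('x, 'x) cat" where
  "discrete A = \<lparr>Obj = A, Arr = A, Dom = (\<lambda>x. x), Cod = (\<lambda>x. x), Idt = (\<lambda>x. x), Comp = (\<lambda>y x. x)\<rparr>"

definition loose_double :: "('i, 'j) cat \<Rightarrow> ('i, 'i, 'j, 'j) dblcat" where
  "loose_double I = \<lparr>tightcat = discrete (Obj I), cellcat = discrete (Arr I),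
     lsrc = Dom I, ltgt = Cod I, lft = Dom I, rgt = Cod I, unit = Idt I, unitcell = Idt I,
     lcomp = (\<lambda>u v. v \<bullet>\<^bsub>I\<^esub> u), hcomp = (\<lambda>u v. v \<bullet>\<^bsub>I\<^esub> u),
     assoc = (\<lambda>u v w. w \<bullet>\<^bsub>I\<^esub> v \<bullet>\<^bsub>I\<^esub> u), lunit = (\<lambda>u. u), runit = (\<lambda>u. u)\<rparr>"


section \<open>The double category of spans\<close>

definition pb :: "('o, 'a) cat \<Rightarrow> 'a \<Rightarrow> 'a \<Rightarrow> 'a \<times> 'a" where
  "pb C f g = (SOME (p, q). is_pullback C f g p q)"

definition pb1 :: "('o, 'a) cat \<Rightarrow> 'a \<Rightarrow> 'a \<Rightarrow> 'a" where "pb1 C f g = fst (pb C f g)"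
definition pb2 :: "('o, 'a) cat \<Rightarrow> 'a \<Rightarrow> 'a \<Rightarrow> 'a" where "pb2 C f g = snd (pb C f g)"

definition pbmed :: "('o, 'a) cat \<Rightarrow> 'a \<Rightarrow> 'a \<Rightarrow> 'a \<Rightarrow> 'a \<Rightarrow> 'a" where
  "pbmed C f g a b = (THE u. u \<in> hom C (Dom C a) (Dom C (pb1 C f g)) \<and>
     pb1 C f g \<bullet>\<^bsub>C\<^esub> u = a \<and> pb2 C f g \<bullet>\<^bsub>C\<^esub> u = b)"

record 'a span =
  lleg :: 'a
  rleg :: 'a

definition apex :: "('o, 'a) cat \<Rightarrow> 'a span \<Rightarrow> 'o" where "apex C m = Dom C (lleg m)"

definition spans :: "('o, 'a) cat \<Rightarrow> 'a span set" where
  "spans C = {m. lleg m \<in> Arr C \<and> rleg m \<in> Arr C \<and> Dom C (lleg m) = Dom C (rleg m)}"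

record 'a span_cell =
  csrc :: "'a span"
  ctgt :: "'a span"
  capx :: 'a
  clft :: 'a
  crgt :: 'a

definition span_cells :: "('o, 'a) cat \<Rightarrow> 'a span_cell set" where
  "span_cells C = {s. csrc s \<in> spans C \<and> ctgt s \<in> spans C \<and>
     capx s \<in> hom C (apex C (csrc s)) (apex C (ctgt s)) \<and>
     clft s \<in> hom C (Cod C (lleg (csrc s))) (Cod C (lleg (ctgt s))) \<and>
     crgt s \<in> hom C (Cod C (rleg (csrc s))) (Cod C (rleg (ctgt s))) \<and>
     lleg (ctgt s) \<bullet>\<^bsub>C\<^esub> capx s = clft s \<bullet>\<^bsub>C\<^esub> lleg (csrc s) \<and>
     rleg (ctgt s) \<bullet>\<^bsub>C\<^esub> capx s = crgt s \<bullet>\<^bsub>C\<^esub> rleg (csrc s)}"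

definition globular_span_cell :: "('o, 'a) cat \<Rightarrow> 'a span \<Rightarrow> 'a span \<Rightarrow> 'a \<Rightarrow> 'a span_cell" where
  "globular_span_cell C m n h = \<lparr>csrc = m, ctgt = n, capx = h,
     clft = Idt C (Cod C (lleg m)), crgt = Idt C (Cod C (rleg m))\<rparr>"

definition span_cellcat :: "('o, 'a) cat \<Rightarrow> ('a span, 'a span_cell) cat" where
  "span_cellcat C = \<lparr>Obj = spans C, Arr = span_cells C, Dom = csrc, Cod = ctgt,
     Idt = (\<lambda>m. globular_span_cell C m m (Idt C (apex C m))),
     Comp = (\<lambda>t s. \<lparr>csrc = csrc s, ctgt = ctgt t, capx = capx t \<bullet>\<^bsub>C\<^esub> capx s,
                     clft = clft t \<bullet>\<^bsub>C\<^esub> clft s, crgt = crgt t \<bullet>\<^bsub>C\<^esub> crgt s\<rparr>)\<rparr>"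

definition span_unit :: "('o, 'a) cat \<Rightarrow> 'o \<Rightarrow> 'a span" where
  "span_unit C x = \<lparr>lleg = Idt C x, rleg = Idt C x\<rparr>"

definition span_comp :: "('o, 'a) cat \<Rightarrow> 'a span \<Rightarrow> 'a span \<Rightarrow> 'a span" where
  "span_comp C m n = \<lparr>lleg = lleg m \<bullet>\<^bsub>C\<^esub> pb1 C (rleg m) (lleg n),
                      rleg = rleg n \<bullet>\<^bsub>C\<^esub> pb2 C (rleg m) (lleg n)\<rparr>"

definition span_double :: "('o, 'a) cat \<Rightarrow> ('o, 'a, 'a span, 'a span_cell) dblcat" where
  "span_double C = \<lparr>tightcat = C, cellcat = span_cellcat C,
     lsrc = (\<lambda>m. Cod C (lleg m)), ltgt = (\<lambda>m. Cod C (rleg m)), lft = clft, rgt = crgt,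
     unit = span_unit C,
     unitcell = (\<lambda>f. \<lparr>csrc = span_unit C (Dom C f), ctgt = span_unit C (Cod C f),
                       capx = f, clft = f, crgt = f\<rparr>),
     lcomp = span_comp C,
     hcomp = (\<lambda>s t. \<lparr>csrc = span_comp C (csrc s) (csrc t), ctgt = span_comp C (ctgt s) (ctgt t),
        capx = pbmed C (rleg (ctgt s)) (lleg (ctgt t))
          (capx s \<bullet>\<^bsub>C\<^esub> pb1 C (rleg (csrc s)) (lleg (csrc t)))
          (capx t \<bullet>\<^bsub>C\<^esub> pb2 C (rleg (csrc s)) (lleg (csrc t))),
        clft = clft s, crgt = crgt t\<rparr>),
     assoc = (\<lambda>m n p.
        let mn = span_comp C m n; np = span_comp C n p;
            p1 = pb1 C (rleg mn) (lleg p); p2 = pb2 C (rleg mn) (lleg p);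
            q1 = pb1 C (rleg m) (lleg n); q2 = pb2 C (rleg m) (lleg n)
        in globular_span_cell C (span_comp C mn p) (span_comp C m np)
             (pbmed C (rleg m) (lleg np) (q1 \<bullet>\<^bsub>C\<^esub> p1)
                (pbmed C (rleg n) (lleg p) (q2 \<bullet>\<^bsub>C\<^esub> p1) p2))),
     lunit = (\<lambda>m. let um = span_comp C (span_unit C (Cod C (lleg m))) m in
        globular_span_cell C um m (pb2 C (Idt C (Cod C (lleg m))) (lleg m))),
     runit = (\<lambda>m. let mu = span_comp C m (span_unit C (Cod C (rleg m))) in
        globular_span_cell C mu m (pb1 C (rleg m) (Idt C (Cod C (rleg m)))))\<rparr>"


section \<open>The companion of a cocone\<close>

definition companion :: "('o, 'a) cat \<Rightarrow> 'a \<Rightarrow> 'a span" where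
  "companion C f = \<lparr>lleg = Idt C (Dom C f), rleg = f\<rparr>"

text \<open>A globular cell into the companion of a tight arrow is determined by its boundary: its apex
  component is the left leg of its source.  This leaves no choice for the comparison cells of
  \<open>companion_diagram\<close> nor for the cells \<open>lloose\<close> of \<open>companion_cocone\<close>.\<close>

definition companion_diagram ::
  "('i, 'j) cat \<Rightarrow> ('o, 'a) cat \<Rightarrow> ('i, 'j, 'o, 'a) ftor
   \<Rightarrow> ('i, 'i, 'j, 'j, 'o, 'a, 'a span, 'a span_cell) dftor" where
  "companion_diagram I C F = \<lparr>dob = fob F, dtight = (\<lambda>i. Idt C (fob F i)),
     dloose = (\<lambda>u. companion C (far F u)),
     dcell = (\<lambda>u. idcell (span_double C) (companion C (far F u))),
     dcomp = (\<lambda>u v.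
       let m = span_comp C (companion C (far F u)) (companion C (far F v))
       in globular_span_cell C m (companion C (far F (v \<bullet>\<^bsub>I\<^esub> u))) (lleg m)),
     dunit = (\<lambda>i. globular_span_cell C (span_unit C (fob F i)) (companion C (far F (Idt I i)))
                    (lleg (span_unit C (fob F i))))\<rparr>"

definition companion_cocone ::
  "('i, 'j) cat \<Rightarrow> ('o, 'a) cat \<Rightarrow> ('i, 'j, 'o, 'a) ftor \<Rightarrow> 'o \<Rightarrow> ('i \<Rightarrow> 'a)
   \<Rightarrow> ('i, 'i, 'j, 'a span, 'a span_cell) ltrans" where
  "companion_cocone I C F c \<eta> = \<lparr>lob = (\<lambda>i. companion C (\<eta> i)),
     ltight = (\<lambda>i. idcell (span_double C) (companion C (\<eta> i))),
     lloose = (\<lambda>u.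
       let m = span_comp C (companion C (far F u)) (companion C (\<eta> (Cod I u)));
           n = span_comp C (companion C (\<eta> (Dom I u))) (span_unit C c)
       in globular_span_cell C m n (pbmed C (\<eta> (Dom I u)) (Idt C c) (lleg m) (rleg m)))\<rparr>"


section \<open>Spans form a pseudo double category, and companion cocones are loose cocones\<close>

context category
begin

lemma Comp_simps [simp]:
  assumes "f \<in> Arr C" "g \<in> Arr C" "Cod C f = Dom C g"
  shows "g \<bullet> f \<in> Arr C" "Dom C (g \<bullet> f) = Dom C f" "Cod C (g \<bullet> f) = Cod C g"
  using Comp_hom[of f "Dom C f" "Cod C f" g "Cod C g"] assms by (auto simp: hom_def)

lemma Idt_simps [simp]:
  assumes "x \<in> Obj C"
  shows "Idt C x \<in> Arr C" "Dom C (Idt C x) = x" "Cod C (Idt C x) = x"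
  using Idt_hom[OF assms] by (auto simp: hom_def)

lemma Obj_simps [simp]: "f \<in> Arr C \<Longrightarrow> Dom C f \<in> Obj C" "f \<in> Arr C \<Longrightarrow> Cod C f \<in> Obj C"
  by (simp_all add: Dom_Obj Cod_Obj)

lemma Comp_Idt_simps [simp]: "f \<in> Arr C \<Longrightarrow> f \<bullet> Idt C (Dom C f) = f"
  "f \<in> Arr C \<Longrightarrow> Idt C (Cod C f) \<bullet> f = f"
  by (simp_all add: Comp_Idt Idt_Comp)

lemma Comp_Idt' [simp]: "\<lbrakk>f \<in> Arr C; x = Dom C f\<rbrakk> \<Longrightarrow> f \<bullet> Idt C x = f"
  "\<lbrakk>f \<in> Arr C; x = Cod C f\<rbrakk> \<Longrightarrow> Idt C x \<bullet> f = f"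
  by simp_all

lemma assoc_simp [simp]:
  assumes "f \<in> Arr C" "g \<in> Arr C" "h \<in> Arr C" "Cod C f = Dom C g" "Cod C g = Dom C h"
  shows "(h \<bullet> g) \<bullet> f = h \<bullet> (g \<bullet> f)"
  using Comp_assoc[of f "Dom C f" "Dom C g" g "Dom C h" h "Cod C h"] assms by (auto simp: hom_def)

lemma reassoc:
  assumes "g \<bullet> f = k \<bullet> l" "f \<in> Arr C" "g \<in> Arr C" "k \<in> Arr C" "l \<in> Arr C"
    "Cod C f = Dom C g" "Cod C l = Dom C k" "a \<in> Arr C" "Cod C a = Dom C f" "Dom C f = Dom C l"
  shows "g \<bullet> f \<bullet> a = k \<bullet> l \<bullet> a"
proof -
  have "g \<bullet> f \<bullet> a = (g \<bullet> f) \<bullet> a" using assms(2-) by simp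
  also have "\<dots> = (k \<bullet> l) \<bullet> a" using assms(1) by (rule arg_cong)
  also have "\<dots> = k \<bullet> l \<bullet> a" using assms(2-) by simp
  finally show ?thesis .
qed

lemma reassoc1:
  assumes "g \<bullet> f = k" "f \<in> Arr C" "g \<in> Arr C"
    "Cod C f = Dom C g" "a \<in> Arr C" "Cod C a = Dom C f"
  shows "g \<bullet> f \<bullet> a = k \<bullet> a"
proof -
  have "g \<bullet> f \<bullet> a = (g \<bullet> f) \<bullet> a" using assms(2-) by simp
  also have "\<dots> = k \<bullet> a" using assms(1) by (rule arg_cong)
  finally show ?thesis .
qed

lemma inverse_unique:
  assumes "inverse_arrows C f g" "inverse_arrows C f h" shows "g = h"
proof -
  have [simp]: "f \<in> Arr C" "g \<in> Arr C" "h \<in> Arr C" "Dom C g = Cod C f" "Cod C g = Dom C f"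
    "Dom C h = Cod C f" "Cod C h = Dom C f"
    using assms by (auto simp: inverse_arrows_def hom_def)
  have "g = g \<bullet> (f \<bullet> h)" using assms by (simp add: inverse_arrows_def)
  also have "\<dots> = (g \<bullet> f) \<bullet> h" by simp
  also have "\<dots> = h" using assms by (simp add: inverse_arrows_def del: assoc_simp)
  finally show ?thesis .
qed

lemma inverse_arr_eq: "inverse_arrows C f g \<Longrightarrow> inverse_arr C f = g"
  unfolding inverse_arr_def by (rule the_equality) (auto intro: inverse_unique)

end

locale pullback_category = category +
  assumes pullbacks: "has_pullbacks C"
begin

lemma is_pullback_pb:
  assumes "f \<in> Arr C" "g \<in> Arr C" "Cod C f = Cod C g"
  shows "is_pullback C f g (pb1 C f g) (pb2 C f g)"
proof -
  have "\<exists>x. case x of (p, q) \<Rightarrow> is_pullback C f g p q"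
    using pullbacks assms by (auto simp: has_pullbacks_def)
  then have "case pb C f g of (p, q) \<Rightarrow> is_pullback C f g p q"
    unfolding pb_def by (rule someI_ex)
  then show ?thesis by (simp add: pb1_def pb2_def split_beta)
qed

lemma pb_simps [simp]:
  assumes "f \<in> Arr C" "g \<in> Arr C" "Cod C f = Cod C g"
  shows "pb1 C f g \<in> Arr C" "pb2 C f g \<in> Arr C" "Dom C (pb2 C f g) = Dom C (pb1 C f g)"
    "Cod C (pb1 C f g) = Dom C f" "Cod C (pb2 C f g) = Dom C g"
  using is_pullback_pb[OF assms] by (auto simp: is_pullback_def commuting_square_def)

lemma pb_square:
  assumes "f \<in> Arr C" "g \<in> Arr C" "Cod C f = Cod C g"
  shows "g \<bullet> pb2 C f g = f \<bullet> pb1 C f g"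
  using is_pullback_pb[OF assms] by (auto simp: is_pullback_def commuting_square_def)

lemma pb_square' :
  assumes "f \<in> Arr C" "g \<in> Arr C" "Cod C f = Cod C g"
    "a \<in> Arr C" "Cod C a = Dom C (pb1 C f g)"
  shows "g \<bullet> pb2 C f g \<bullet> a = f \<bullet> pb1 C f g \<bullet> a"
  using assms by (intro reassoc pb_square) auto

lemma pbmed_facts:
  assumes "commuting_square C f g a b"
  shows "pbmed C f g a b \<in> hom C (Dom C a) (Dom C (pb1 C f g)) \<and>
    pb1 C f g \<bullet> pbmed C f g a b = a \<and> pb2 C f g \<bullet> pbmed C f g a b = b"
proof -
  have "is_pullback C f g (pb1 C f g) (pb2 C f g)"
    using assms by (intro is_pullback_pb) (auto simp: commuting_square_def)
  then have "\<exists>!u. u \<in> hom C (Dom C a) (Dom C (pb1 C f g)) \<and> pb1 C f g \<bullet> u = a \<and> pb2 C f g \<bullet> u = b"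
    using assms by (simp add: is_pullback_def)
  from theI'[OF this] show ?thesis by (simp add: pbmed_def)
qed

lemma pbmed_simps [simp]:
  assumes "f \<in> Arr C" "g \<in> Arr C" "Cod C f = Cod C g" "a \<in> Arr C" "b \<in> Arr C"
    "Dom C a = Dom C b" "Cod C a = Dom C f" "Cod C b = Dom C g" "f \<bullet> a = g \<bullet> b"
  shows "pbmed C f g a b \<in> Arr C" "Dom C (pbmed C f g a b) = Dom C b"
    "Cod C (pbmed C f g a b) = Dom C (pb1 C f g)"
    "pb1 C f g \<bullet> pbmed C f g a b = a" "pb2 C f g \<bullet> pbmed C f g a b = b"
  using pbmed_facts[of f g a b] assms by (auto simp: commuting_square_def hom_def)

lemma pbmed_simps' [simp]:
  assumes "f \<in> Arr C" "g \<in> Arr C" "Cod C f = Cod C g" "a \<in> Arr C" "b \<in> Arr C"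
    "Dom C a = Dom C b" "Cod C a = Dom C f" "Cod C b = Dom C g" "f \<bullet> a = g \<bullet> b"
    "z \<in> Arr C" "Cod C z = Dom C b"
  shows "pb1 C f g \<bullet> pbmed C f g a b \<bullet> z = a \<bullet> z" "pb2 C f g \<bullet> pbmed C f g a b \<bullet> z = b \<bullet> z"
  using assms by (auto intro!: reassoc1)

lemma pb_joint_monic:
  assumes "f \<in> Arr C" "g \<in> Arr C" "Cod C f = Cod C g" "u \<in> Arr C" "v \<in> Arr C"
    "Dom C u = Dom C v" "Cod C u = Dom C (pb1 C f g)" "Cod C v = Dom C (pb1 C f g)"
    "pb1 C f g \<bullet> u = pb1 C f g \<bullet> v" "pb2 C f g \<bullet> u = pb2 C f g \<bullet> v"
  shows "u = v"
proof -
  have "commuting_square C f g (pb1 C f g \<bullet> u) (pb2 C f g \<bullet> u)"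
    using assms(1-8) by (simp add: commuting_square_def pb_square')
  with is_pullback_pb[OF assms(1-3)]
  have "\<exists>!w. w \<in> hom C (Dom C (pb1 C f g \<bullet> u)) (Dom C (pb1 C f g)) \<and>
      pb1 C f g \<bullet> w = pb1 C f g \<bullet> u \<and> pb2 C f g \<bullet> w = pb2 C f g \<bullet> u"
    unfolding is_pullback_def by blast
  moreover have "u \<in> hom C (Dom C (pb1 C f g \<bullet> u)) (Dom C (pb1 C f g))"
    "v \<in> hom C (Dom C (pb1 C f g \<bullet> u)) (Dom C (pb1 C f g))"
    using assms by (simp_all add: hom_def)
  ultimately show ?thesis using assms by metis
qed

end


lemma span_cell_eqI:
  "\<lbrakk>csrc s = csrc t; ctgt s = ctgt t; capx s = capx t; clft s = clft t; crgt s = crgt t\<rbrakk>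
    \<Longrightarrow> s = (t :: 'a span_cell)"
  by simp

context pullback_category
begin

lemma spans_simps [simp]:
  assumes "m \<in> spans C"
  shows "lleg m \<in> Arr C" "rleg m \<in> Arr C" "Dom C (rleg m) = Dom C (lleg m)" "apex C m = Dom C (lleg m)"
  using assms by (auto simp: spans_def apex_def)

lemma in_spansI: "\<lbrakk>lleg m \<in> Arr C; rleg m \<in> Arr C; Dom C (lleg m) = Dom C (rleg m)\<rbrakk> \<Longrightarrow> m \<in> spans C"
  unfolding spans_def by blast

lemma span_comp_spans [simp]:
  assumes "m \<in> spans C" "n \<in> spans C" "Cod C (rleg m) = Cod C (lleg n)"
  shows "span_comp C m n \<in> spans C"
    "Dom C (lleg (span_comp C m n)) = Dom C (pb1 C (rleg m) (lleg n))"
    "Cod C (lleg (span_comp C m n)) = Cod C (lleg m)"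
    "Cod C (rleg (span_comp C m n)) = Cod C (rleg n)"
    "lleg (span_comp C m n) = lleg m \<bullet> pb1 C (rleg m) (lleg n)"
    "rleg (span_comp C m n) = rleg n \<bullet> pb2 C (rleg m) (lleg n)"
  using assms by (simp_all add: span_comp_def in_spansI)

lemma span_unit_spans [simp]:
  assumes "x \<in> Obj C"
  shows "span_unit C x \<in> spans C"
    "lleg (span_unit C x) = Idt C x"
    "rleg (span_unit C x) = Idt C x"
  using assms by (simp_all add: span_unit_def in_spansI)

lemma span_cells_simps [simp]:
  assumes "s \<in> span_cells C"
  shows "csrc s \<in> spans C" "ctgt s \<in> spans C" "capx s \<in> Arr C"
    "Dom C (capx s) = Dom C (lleg (csrc s))" "Cod C (capx s) = Dom C (lleg (ctgt s))"
    "clft s \<in> Arr C" "Dom C (clft s) = Cod C (lleg (csrc s))" "Cod C (clft s) = Cod C (lleg (ctgt s))"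
    "crgt s \<in> Arr C" "Dom C (crgt s) = Cod C (rleg (csrc s))" "Cod C (crgt s) = Cod C (rleg (ctgt s))"
    "lleg (ctgt s) \<bullet> capx s = clft s \<bullet> lleg (csrc s)"
    "rleg (ctgt s) \<bullet> capx s = crgt s \<bullet> rleg (csrc s)"
  by (insert assms[unfolded span_cells_def hom_def apex_def mem_Collect_eq], (elim conjE, assumption)+)

lemma span_cells_simps' [simp]:
  assumes "s \<in> span_cells C" "z \<in> Arr C" "Cod C z = Dom C (lleg (csrc s))"
  shows "lleg (ctgt s) \<bullet> capx s \<bullet> z = clft s \<bullet> lleg (csrc s) \<bullet> z"
    "rleg (ctgt s) \<bullet> capx s \<bullet> z = crgt s \<bullet> rleg (csrc s) \<bullet> z"
  by (rule reassoc[OF span_cells_simps(12)], (simp add: assms)+) (rule reassoc[OF span_cells_simps(13)], (simp add: assms)+)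

lemma in_span_cellsI:
  assumes "csrc s \<in> spans C" "ctgt s \<in> spans C" "capx s \<in> Arr C"
    "Dom C (capx s) = Dom C (lleg (csrc s))" "Cod C (capx s) = Dom C (lleg (ctgt s))"
    "clft s \<in> Arr C" "Dom C (clft s) = Cod C (lleg (csrc s))" "Cod C (clft s) = Cod C (lleg (ctgt s))"
    "crgt s \<in> Arr C" "Dom C (crgt s) = Cod C (rleg (csrc s))" "Cod C (crgt s) = Cod C (rleg (ctgt s))"
    "lleg (ctgt s) \<bullet> capx s = clft s \<bullet> lleg (csrc s)"
    "rleg (ctgt s) \<bullet> capx s = crgt s \<bullet> rleg (csrc s)"
  shows "s \<in> span_cells C"
  unfolding span_cells_def hom_def apex_def mem_Collect_eq by (intro conjI assms)

lemma globular_span_cell_simps [simp]: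
  "csrc (globular_span_cell C m n h) = m" "ctgt (globular_span_cell C m n h) = n"
  "capx (globular_span_cell C m n h) = h"
  "clft (globular_span_cell C m n h) = Idt C (Cod C (lleg m))"
  "crgt (globular_span_cell C m n h) = Idt C (Cod C (rleg m))"
  by (simp_all add: globular_span_cell_def)

lemma globular_span_cell_in [simp]:
  assumes "m \<in> spans C" "n \<in> spans C" "h \<in> Arr C" "Dom C h = Dom C (lleg m)"
    "Cod C h = Dom C (lleg n)" "Cod C (lleg m) = Cod C (lleg n)" "Cod C (rleg m) = Cod C (rleg n)"
    "lleg n \<bullet> h = lleg m" "rleg n \<bullet> h = rleg m"
  shows "globular_span_cell C m n h \<in> span_cells C"
  using assms by (intro in_span_cellsI) auto

lemma span_cellcat_simps [simp]:
  "Obj (span_cellcat C) = spans C" "Arr (span_cellcat C) = span_cells C"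
  "Dom (span_cellcat C) = csrc" "Cod (span_cellcat C) = ctgt"
  "csrc (Comp (span_cellcat C) t s) = csrc s"
  "ctgt (Comp (span_cellcat C) t s) = ctgt t"
  "capx (Comp (span_cellcat C) t s) = capx t \<bullet> capx s"
  "clft (Comp (span_cellcat C) t s) = clft t \<bullet> clft s"
  "crgt (Comp (span_cellcat C) t s) = crgt t \<bullet> crgt s"
  "Idt (span_cellcat C) m = globular_span_cell C m m (Idt C (apex C m))"
  by (simp_all add: span_cellcat_def)

lemma vcomp_in [simp]:
  assumes "s \<in> span_cells C" "t \<in> span_cells C" "ctgt s = csrc t"
  shows "Comp (span_cellcat C) t s \<in> span_cells C"
  using assms span_cells_simps(12,13)[OF assms(1)] by (intro in_span_cellsI) auto

lemma span_cell_category: "category (span_cellcat C)"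
proof
  fix f g h w x y z
  assume "f \<in> hom (span_cellcat C) w x" "g \<in> hom (span_cellcat C) x y" "h \<in> hom (span_cellcat C) y z"
  then have A: "f \<in> span_cells C" "g \<in> span_cells C" "h \<in> span_cells C" "csrc f = w" "ctgt f = x" "csrc g = x"
    "ctgt g = y" "csrc h = y" "ctgt h = z"
    by (auto simp: hom_def)
  show "(h \<bullet>\<^bsub>span_cellcat C\<^esub> g) \<bullet>\<^bsub>span_cellcat C\<^esub> f = h \<bullet>\<^bsub>span_cellcat C\<^esub> (g \<bullet>\<^bsub>span_cellcat C\<^esub> f)"
    using A by (intro span_cell_eqI) simp_all
qed (auto simp: hom_def intro!: span_cell_eqI)

lemma globular_isoI:
  assumes "s \<in> span_cells C" "clft s = Idt C (Cod C (lleg (csrc s)))"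
    "crgt s = Idt C (Cod C (rleg (csrc s)))"
    "k \<in> Arr C" "Dom C k = Dom C (lleg (ctgt s))" "Cod C k = Dom C (lleg (csrc s))"
    "k \<bullet> capx s = Idt C (Dom C (lleg (csrc s)))" "capx s \<bullet> k = Idt C (Dom C (lleg (ctgt s)))"
  shows "inverse_arrows (span_cellcat C) s (globular_span_cell C (ctgt s) (csrc s) k)"
proof -
  let ?m = "csrc s" and ?n = "ctgt s" and ?h = "capx s"
  have m: "?m \<in> spans C" "?n \<in> spans C" using assms by auto
  have C: "Cod C (lleg ?m) = Cod C (lleg ?n)" "Cod C (rleg ?m) = Cod C (rleg ?n)"
    using span_cells_simps(8,11)[OF assms(1)] assms(2,3) m by auto
  have e: "lleg ?n \<bullet> ?h = lleg ?m" "rleg ?n \<bullet> ?h = rleg ?m"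
    using span_cells_simps(12,13)[OF assms(1)] assms(2,3) m by auto
  have l: "lleg ?m \<bullet> k = lleg ?n"
    using m assms reassoc1[OF e(1), of k] by simp
  have r: "rleg ?m \<bullet> k = rleg ?n"
    using m assms reassoc1[OF e(2), of k] by simp
  have "globular_span_cell C ?n ?m k \<in> span_cells C"
    using assms m l r C by (intro globular_span_cell_in) auto
  then show ?thesis
    using assms m l r C by (auto simp: inverse_arrows_def hom_def intro!: span_cell_eqI)
qed

lemma span_double_simps [simp]:
  "tightcat (span_double C) = C" "cellcat (span_double C) = span_cellcat C"
  "lsrc (span_double C) = (\<lambda>m. Cod C (lleg m))" "ltgt (span_double C) = (\<lambda>m. Cod C (rleg m))"
  "lft (span_double C) = clft" "rgt (span_double C) = crgt"
  "unit (span_double C) = span_unit C"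
  "lcomp (span_double C) = span_comp C"
  "csrc (unitcell (span_double C) f) = span_unit C (Dom C f)"
  "ctgt (unitcell (span_double C) f) = span_unit C (Cod C f)"
  "capx (unitcell (span_double C) f) = f"
  "clft (unitcell (span_double C) f) = f"
  "crgt (unitcell (span_double C) f) = f"
  "csrc (hcomp (span_double C) s t) = span_comp C (csrc s) (csrc t)"
  "ctgt (hcomp (span_double C) s t) = span_comp C (ctgt s) (ctgt t)"
  "capx (hcomp (span_double C) s t) = pbmed C (rleg (ctgt s)) (lleg (ctgt t))
          (capx s \<bullet>\<^bsub>C\<^esub> pb1 C (rleg (csrc s)) (lleg (csrc t)))
          (capx t \<bullet>\<^bsub>C\<^esub> pb2 C (rleg (csrc s)) (lleg (csrc t)))"
  "clft (hcomp (span_double C) s t) = clft s"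
  "crgt (hcomp (span_double C) s t) = crgt t"
  by (simp_all add: span_double_def)

lemma hcomp_capx_raw:
  "capx (hcomp (span_double C) s t) = pbmed C (rleg (ctgt s)) (lleg (ctgt t))
          (capx s \<bullet>\<^bsub>C\<^esub> pb1 C (rleg (csrc s)) (lleg (csrc t)))
          (capx t \<bullet>\<^bsub>C\<^esub> pb2 C (rleg (csrc s)) (lleg (csrc t)))"
  by simp

lemma lunit_simps [simp]:
  "lunit (span_double C) m = globular_span_cell C (span_comp C (span_unit C (Cod C (lleg m))) m) m
     (pb2 C (Idt C (Cod C (lleg m))) (lleg m))"
  "runit (span_double C) m = globular_span_cell C (span_comp C m (span_unit C (Cod C (rleg m)))) m
     (pb1 C (rleg m) (Idt C (Cod C (rleg m))))"
  by (simp_all add: span_double_def Let_def)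

lemma assoc_simps:
  assumes "m \<in> spans C" "n \<in> spans C" "p \<in> spans C" "Cod C (rleg m) = Cod C (lleg n)"
    "Cod C (rleg n) = Cod C (lleg p)"
  shows "assoc (span_double C) m n p =
    globular_span_cell C (span_comp C (span_comp C m n) p) (span_comp C m (span_comp C n p))
      (pbmed C (rleg m) (lleg n \<bullet> pb1 C (rleg n) (lleg p))
         (pb1 C (rleg m) (lleg n) \<bullet> pb1 C (rleg n \<bullet> pb2 C (rleg m) (lleg n)) (lleg p))
         (pbmed C (rleg n) (lleg p)
            (pb2 C (rleg m) (lleg n) \<bullet> pb1 C (rleg n \<bullet> pb2 C (rleg m) (lleg n)) (lleg p))
            (pb2 C (rleg n \<bullet> pb2 C (rleg m) (lleg n)) (lleg p))))"
  using assms by (simp add: span_double_def Let_def)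

lemma hcomp_pb_square:
  assumes "s \<in> span_cells C" "t \<in> span_cells C" "crgt s = clft t"
    "Cod C (rleg (csrc s)) = Cod C (lleg (csrc t))"
    "Cod C (rleg (ctgt s)) = Cod C (lleg (ctgt t))"
  shows "rleg (ctgt s) \<bullet> capx s \<bullet> pb1 C (rleg (csrc s)) (lleg (csrc t)) =
      lleg (ctgt t) \<bullet> capx t \<bullet> pb2 C (rleg (csrc s)) (lleg (csrc t))"
proof -
  have "lleg (ctgt t) \<bullet> capx t \<bullet> pb2 C (rleg (csrc s)) (lleg (csrc t)) =
     clft t \<bullet> lleg (csrc t) \<bullet> pb2 C (rleg (csrc s)) (lleg (csrc t))"
    using assms by simp
  also have "\<dots> = crgt s \<bullet> rleg (csrc s) \<bullet> pb1 C (rleg (csrc s)) (lleg (csrc t))"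
    using assms by (simp add: pb_square)
  finally show ?thesis using assms by simp
qed

lemma hcomp_capx [simp]:
  assumes "s \<in> span_cells C" "t \<in> span_cells C" "crgt s = clft t"
    "Cod C (rleg (csrc s)) = Cod C (lleg (csrc t))"
    "Cod C (rleg (ctgt s)) = Cod C (lleg (ctgt t))"
  defines "h \<equiv> pbmed C (rleg (ctgt s)) (lleg (ctgt t))
          (capx s \<bullet>\<^bsub>C\<^esub> pb1 C (rleg (csrc s)) (lleg (csrc t)))
          (capx t \<bullet>\<^bsub>C\<^esub> pb2 C (rleg (csrc s)) (lleg (csrc t)))"
  shows "h \<in> Arr C" "Dom C h = Dom C (pb1 C (rleg (csrc s)) (lleg (csrc t)))"
    "Cod C h = Dom C (pb1 C (rleg (ctgt s)) (lleg (ctgt t)))"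
    "pb1 C (rleg (ctgt s)) (lleg (ctgt t)) \<bullet> h = capx s \<bullet> pb1 C (rleg (csrc s)) (lleg (csrc t))"
    "pb2 C (rleg (ctgt s)) (lleg (ctgt t)) \<bullet> h = capx t \<bullet> pb2 C (rleg (csrc s)) (lleg (csrc t))"
    "\<lbrakk>z \<in> Arr C; Cod C z = Dom C (pb1 C (rleg (csrc s)) (lleg (csrc t)))\<rbrakk> \<Longrightarrow>
      pb1 C (rleg (ctgt s)) (lleg (ctgt t)) \<bullet> h \<bullet> z = capx s \<bullet> pb1 C (rleg (csrc s)) (lleg (csrc t)) \<bullet> z"
    "\<lbrakk>z \<in> Arr C; Cod C z = Dom C (pb1 C (rleg (csrc s)) (lleg (csrc t)))\<rbrakk> \<Longrightarrow>
      pb2 C (rleg (ctgt s)) (lleg (ctgt t)) \<bullet> h \<bullet> z = capx t \<bullet> pb2 C (rleg (csrc s)) (lleg (csrc t)) \<bullet> z"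
  using hcomp_pb_square[OF assms(1-5)] assms(1-5) unfolding h_def by simp_all

lemma hcomp_in [simp]:
  assumes "s \<in> span_cells C" "t \<in> span_cells C" "crgt s = clft t"
    "Cod C (rleg (csrc s)) = Cod C (lleg (csrc t))"
    "Cod C (rleg (ctgt s)) = Cod C (lleg (ctgt t))"
  shows "hcomp (span_double C) s t \<in> span_cells C"
  using assms by (intro in_span_cellsI) simp_all


lemma span_functors:
  "is_functor (span_cellcat C) C \<lparr>fob = \<lambda>m. Cod C (lleg m), far = clft\<rparr>"
  "is_functor (span_cellcat C) C \<lparr>fob = \<lambda>m. Cod C (rleg m), far = crgt\<rparr>"
  by (auto simp: is_functor_def hom_def)

lemma lhom_span [simp]: "m \<in> lhom (span_double C) x y \<longleftrightarrow>
    m \<in> spans C \<and> Cod C (lleg m) = x \<and> Cod C (rleg m) = y"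
  by (simp add: lhom_def)

lemma cells_span [simp]: "s \<in> cells (span_double C) m n f g \<longleftrightarrow>
    s \<in> span_cells C \<and> csrc s = m \<and> ctgt s = n \<and> clft s = f \<and> crgt s = g"
  by (auto simp add: cells_def hom_def)

lemma unitcell_in [simp]: "f \<in> Arr C \<Longrightarrow> unitcell (span_double C) f \<in> span_cells C"
  by (intro in_span_cellsI) simp_all

lemma span_globular_isoI:
  assumes "s \<in> span_cells C" "csrc s = m" "ctgt s = n" "clft s = Idt C (Cod C (lleg m))"
    "crgt s = Idt C (Cod C (rleg m))"
    "k \<in> Arr C" "Dom C k = Dom C (lleg n)" "Cod C k = Dom C (lleg m)"
    "k \<bullet> capx s = Idt C (Dom C (lleg m))" "capx s \<bullet> k = Idt C (Dom C (lleg n))"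
  shows "globular_iso (span_double C) m n s"
  using globular_isoI[of s k] assms unfolding globular_iso_def iso_def by auto

lemma assoc_squares:
  assumes "m \<in> spans C" "n \<in> spans C" "p \<in> spans C" "Cod C (rleg m) = Cod C (lleg n)"
    "Cod C (rleg n) = Cod C (lleg p)"
  defines "p1 \<equiv> pb1 C (rleg n \<bullet> pb2 C (rleg m) (lleg n)) (lleg p)"
    and "p2 \<equiv> pb2 C (rleg n \<bullet> pb2 C (rleg m) (lleg n)) (lleg p)"
    and "q1 \<equiv> pb1 C (rleg m) (lleg n)" and "q2 \<equiv> pb2 C (rleg m) (lleg n)"
  shows "p1 \<in> Arr C" "p2 \<in> Arr C" "Cod C p1 = Dom C q1" "Cod C p2 = Dom C (lleg p)" "Dom C p2 = Dom C p1"
    "q1 \<in> Arr C" "q2 \<in> Arr C" "Dom C q2 = Dom C q1" "Cod C q1 = Dom C (lleg m)" "Cod C q2 = Dom C (lleg n)"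
    "rleg n \<bullet> q2 \<bullet> p1 = lleg p \<bullet> p2"
    "rleg m \<bullet> q1 \<bullet> p1 = lleg n \<bullet> q2 \<bullet> p1"
    "rleg m \<bullet> q1 = lleg n \<bullet> q2"
proof -
  have "lleg p \<bullet> p2 = (rleg n \<bullet> q2) \<bullet> p1"
    using assms(1-5) unfolding p1_def p2_def q1_def q2_def by (intro pb_square) auto
  then show "rleg n \<bullet> q2 \<bullet> p1 = lleg p \<bullet> p2"
    using assms(1-5) unfolding p1_def p2_def q1_def q2_def by simp
qed (use assms(1-5) in \<open>simp_all add: p1_def p2_def q1_def q2_def pb_square pb_square'\<close>)

lemma assoc_capx:
  assumes "m \<in> spans C" "n \<in> spans C" "p \<in> spans C" "Cod C (rleg m) = Cod C (lleg n)"
    "Cod C (rleg n) = Cod C (lleg p)"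
  defines "p1 \<equiv> pb1 C (rleg n \<bullet> pb2 C (rleg m) (lleg n)) (lleg p)"
    and "p2 \<equiv> pb2 C (rleg n \<bullet> pb2 C (rleg m) (lleg n)) (lleg p)"
    and "q1 \<equiv> pb1 C (rleg m) (lleg n)" and "q2 \<equiv> pb2 C (rleg m) (lleg n)"
    and "r1 \<equiv> pb1 C (rleg m) (lleg n \<bullet> pb1 C (rleg n) (lleg p))"
    and "r2 \<equiv> pb2 C (rleg m) (lleg n \<bullet> pb1 C (rleg n) (lleg p))"
    and "s1 \<equiv> pb1 C (rleg n) (lleg p)" and "s2 \<equiv> pb2 C (rleg n) (lleg p)"
    and "a \<equiv> capx (assoc (span_double C) m n p)"
  shows "a \<in> Arr C" "Dom C a = Dom C p1" "Cod C a = Dom C r1"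
    "r1 \<bullet> a = q1 \<bullet> p1" "s1 \<bullet> r2 \<bullet> a = q2 \<bullet> p1" "s2 \<bullet> r2 \<bullet> a = p2"
    "\<And>z. \<lbrakk>z \<in> Arr C; Cod C z = Dom C p1\<rbrakk> \<Longrightarrow> r1 \<bullet> a \<bullet> z = q1 \<bullet> p1 \<bullet> z"
    "\<And>z. \<lbrakk>z \<in> Arr C; Cod C z = Dom C p1\<rbrakk> \<Longrightarrow> s1 \<bullet> r2 \<bullet> a \<bullet> z = q2 \<bullet> p1 \<bullet> z"
    "\<And>z. \<lbrakk>z \<in> Arr C; Cod C z = Dom C p1\<rbrakk> \<Longrightarrow> s2 \<bullet> r2 \<bullet> a \<bullet> z = p2 \<bullet> z"
    "assoc (span_double C) m n p \<in> span_cells C"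
    "csrc (assoc (span_double C) m n p) = span_comp C (span_comp C m n) p"
    "ctgt (assoc (span_double C) m n p) = span_comp C m (span_comp C n p)"
    "clft (assoc (span_double C) m n p) = Idt C (Cod C (lleg m))"
    "crgt (assoc (span_double C) m n p) = Idt C (Cod C (rleg p))"
proof -
  note A = assoc_squares[OF assms(1-5), folded p1_def p2_def q1_def q2_def]
  define b where "b = pbmed C (rleg n) (lleg p) (q2 \<bullet> p1) p2"
  have b: "b \<in> Arr C" "Dom C b = Dom C p1" "Cod C b = Dom C s1" "s1 \<bullet> b = q2 \<bullet> p1" "s2 \<bullet> b = p2"
    using A assms(1-5) by (simp_all add: b_def s1_def s2_def)
  have a': "a = pbmed C (rleg m) (lleg n \<bullet> s1) (q1 \<bullet> p1) b"
    using assms(1-5) by (simp add: assoc_simps a_def b_def s1_def s2_def p1_def p2_def q1_def q2_def)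
  have s: "s1 \<in> Arr C" "s2 \<in> Arr C" "Dom C s2 = Dom C s1" "Cod C s1 = Dom C (lleg n)" "Cod C s2 = Dom C (lleg p)"
    using assms(1-5) by (simp_all add: s1_def s2_def)
  have r: "r1 \<in> Arr C" "r2 \<in> Arr C" "Dom C r2 = Dom C r1" "Cod C r1 = Dom C (lleg m)" "Cod C r2 = Dom C s1"
    using assms(1-5) by (simp_all add: s1_def s2_def r1_def r2_def)
  have a: "a \<in> Arr C" "Dom C a = Dom C p1" "Cod C a = Dom C r1"
    "r1 \<bullet> a = q1 \<bullet> p1" "r2 \<bullet> a = b"
    unfolding a' r1_def r2_def s1_def[symmetric]
    using A b s assms(1-5) by (simp_all)
  show g: "a \<in> Arr C" "Dom C a = Dom C p1" "Cod C a = Dom C r1"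
    "r1 \<bullet> a = q1 \<bullet> p1" "s1 \<bullet> r2 \<bullet> a = q2 \<bullet> p1" "s2 \<bullet> r2 \<bullet> a = p2"
    using a b by simp_all
  show "r1 \<bullet> a \<bullet> z = q1 \<bullet> p1 \<bullet> z" "s1 \<bullet> r2 \<bullet> a \<bullet> z = q2 \<bullet> p1 \<bullet> z" "s2 \<bullet> r2 \<bullet> a \<bullet> z = p2 \<bullet> z"
    if "z \<in> Arr C" "Cod C z = Dom C p1" for z
  proof -
    have "s1 \<bullet> r2 \<bullet> a \<bullet> z = s1 \<bullet> (r2 \<bullet> a) \<bullet> z" "s2 \<bullet> r2 \<bullet> a \<bullet> z = s2 \<bullet> (r2 \<bullet> a) \<bullet> z"
      using that a(1-3) b s r by simp_all
    moreover have "s1 \<bullet> b \<bullet> z = q2 \<bullet> p1 \<bullet> z" "s2 \<bullet> b \<bullet> z = p2 \<bullet> z"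
      using that b s A by (auto intro!: reassoc1 reassoc)
    moreover have "r1 \<bullet> a \<bullet> z = q1 \<bullet> p1 \<bullet> z"
      using that a r A by (intro reassoc) auto
    ultimately show "r1 \<bullet> a \<bullet> z = q1 \<bullet> p1 \<bullet> z" "s1 \<bullet> r2 \<bullet> a \<bullet> z = q2 \<bullet> p1 \<bullet> z" "s2 \<bullet> r2 \<bullet> a \<bullet> z = p2 \<bullet> z"
      using a(5) by simp_all
  qed
  have e: "assoc (span_double C) m n p =
      globular_span_cell C (span_comp C (span_comp C m n) p) (span_comp C m (span_comp C n p)) a"
    using assms(1-5) by (simp add: assoc_simps a' b_def s1_def s2_def p1_def p2_def q1_def q2_def)
  have "(lleg m \<bullet> r1) \<bullet> a = (lleg m \<bullet> q1) \<bullet> p1" "(rleg p \<bullet> s2 \<bullet> r2) \<bullet> a = rleg p \<bullet> p2"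
    using g r s A assms(1-5) by simp_all
  then show "assoc (span_double C) m n p \<in> span_cells C"
    unfolding e using g(1-3) A s r assms(1-5)
    by (intro globular_span_cell_in) (simp_all add: p1_def p2_def q1_def q2_def r1_def r2_def s1_def s2_def)
  show "csrc (assoc (span_double C) m n p) = span_comp C (span_comp C m n) p"
    "ctgt (assoc (span_double C) m n p) = span_comp C m (span_comp C n p)"
    "clft (assoc (span_double C) m n p) = Idt C (Cod C (lleg m))"
    "crgt (assoc (span_double C) m n p) = Idt C (Cod C (rleg p))"
    unfolding e using assms(1-5) by simp_all
qed

end

context pullback_category
begin

lemma right_joint_monic:
  assumes "m \<in> spans C" "n \<in> spans C" "p \<in> spans C" "Cod C (rleg m) = Cod C (lleg n)"
    "Cod C (rleg n) = Cod C (lleg p)"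
  defines "s1 \<equiv> pb1 C (rleg n) (lleg p)" and "s2 \<equiv> pb2 C (rleg n) (lleg p)"
  defines "r1 \<equiv> pb1 C (rleg m) (lleg n \<bullet> s1)" and "r2 \<equiv> pb2 C (rleg m) (lleg n \<bullet> s1)"
  assumes "u \<in> Arr C" "v \<in> Arr C" "Dom C u = Dom C v" "Cod C u = Dom C r1" "Cod C v = Dom C r1"
    "r1 \<bullet> u = r1 \<bullet> v" "s1 \<bullet> r2 \<bullet> u = s1 \<bullet> r2 \<bullet> v" "s2 \<bullet> r2 \<bullet> u = s2 \<bullet> r2 \<bullet> v"
  shows "u = v"
proof -
  have s: "s1 \<in> Arr C" "s2 \<in> Arr C" "Dom C s2 = Dom C s1" "Cod C s1 = Dom C (lleg n)" "Cod C s2 = Dom C (lleg p)"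
    using assms(1-5) by (simp_all add: s1_def s2_def)
  have r: "r1 \<in> Arr C" "r2 \<in> Arr C" "Dom C r2 = Dom C r1" "Cod C r1 = Dom C (lleg m)" "Cod C r2 = Dom C s1"
    using assms(1-5) s by (simp_all add: r1_def r2_def)
  have "r2 \<bullet> u = r2 \<bullet> v"
    by (rule pb_joint_monic[of "rleg n" "lleg p", folded s1_def s2_def]) (use assms(1-5,10-17) s r in simp_all)
  then show ?thesis
    by (intro pb_joint_monic[of "rleg m" "lleg n \<bullet> s1" u v, folded r1_def r2_def])
       (use assms(1-5,10-17) s r in simp_all)
qed

lemma left_joint_monic:
  assumes "m \<in> spans C" "n \<in> spans C" "p \<in> spans C" "Cod C (rleg m) = Cod C (lleg n)"
    "Cod C (rleg n) = Cod C (lleg p)"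
  defines "q1 \<equiv> pb1 C (rleg m) (lleg n)" and "q2 \<equiv> pb2 C (rleg m) (lleg n)"
  defines "p1 \<equiv> pb1 C (rleg n \<bullet> q2) (lleg p)" and "p2 \<equiv> pb2 C (rleg n \<bullet> q2) (lleg p)"
  assumes "u \<in> Arr C" "v \<in> Arr C" "Dom C u = Dom C v" "Cod C u = Dom C p1" "Cod C v = Dom C p1"
    "q1 \<bullet> p1 \<bullet> u = q1 \<bullet> p1 \<bullet> v" "q2 \<bullet> p1 \<bullet> u = q2 \<bullet> p1 \<bullet> v" "p2 \<bullet> u = p2 \<bullet> v"
  shows "u = v"
proof -
  note A = assoc_squares[OF assms(1-5), folded q1_def q2_def, folded p1_def p2_def]
  have "p1 \<bullet> u = p1 \<bullet> v"
    by (rule pb_joint_monic[of "rleg m" "lleg n", folded q1_def q2_def]) (use assms(1-5,10-17) A in simp_all)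
  then show ?thesis
    by (intro pb_joint_monic[of "rleg n \<bullet> q2" "lleg p" u v, folded p1_def p2_def])
       (use assms(1-5,10-17) A in simp_all)
qed

lemma assoc_inverse:
  assumes "m \<in> spans C" "n \<in> spans C" "p \<in> spans C" "Cod C (rleg m) = Cod C (lleg n)"
    "Cod C (rleg n) = Cod C (lleg p)"
  defines "q1 \<equiv> pb1 C (rleg m) (lleg n)" and "q2 \<equiv> pb2 C (rleg m) (lleg n)"
  defines "p1 \<equiv> pb1 C (rleg n \<bullet> q2) (lleg p)" and "p2 \<equiv> pb2 C (rleg n \<bullet> q2) (lleg p)"
  defines "s1 \<equiv> pb1 C (rleg n) (lleg p)" and "s2 \<equiv> pb2 C (rleg n) (lleg p)"
  defines "r1 \<equiv> pb1 C (rleg m) (lleg n \<bullet> s1)" and "r2 \<equiv> pb2 C (rleg m) (lleg n \<bullet> s1)"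
  shows "\<exists>b. b \<in> Arr C \<and> Dom C b = Dom C r1 \<and> Cod C b = Dom C p1 \<and>
    q1 \<bullet> p1 \<bullet> b = r1 \<and> q2 \<bullet> p1 \<bullet> b = s1 \<bullet> r2 \<and> p2 \<bullet> b = s2 \<bullet> r2 \<and>
    inverse_arrows (span_cellcat C) (assoc (span_double C) m n p)
      (globular_span_cell C (span_comp C m (span_comp C n p)) (span_comp C (span_comp C m n) p) b)"
proof -
  note A = assoc_squares[OF assms(1-5), folded q1_def q2_def, folded p1_def p2_def]
  note G = assoc_capx[OF assms(1-5), folded q1_def q2_def s1_def s2_def, folded p1_def p2_def r1_def r2_def]
  have s: "s1 \<in> Arr C" "s2 \<in> Arr C" "Dom C s2 = Dom C s1" "Cod C s1 = Dom C (lleg n)" "Cod C s2 = Dom C (lleg p)"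
    "lleg p \<bullet> s2 = rleg n \<bullet> s1"
    using assms(1-5) by (simp_all add: s1_def s2_def pb_square)
  have r: "r1 \<in> Arr C" "r2 \<in> Arr C" "Dom C r2 = Dom C r1" "Cod C r1 = Dom C (lleg m)" "Cod C r2 = Dom C s1"
    using assms(1-5) s by (simp_all add: r1_def r2_def)
  have r': "rleg m \<bullet> r1 = lleg n \<bullet> s1 \<bullet> r2"
    using pb_square[of "rleg m" "lleg n \<bullet> s1", folded r1_def r2_def] assms(1-5) s r by simp
  have sr: "lleg p \<bullet> s2 \<bullet> r2 = rleg n \<bullet> s1 \<bullet> r2"
    by (rule reassoc) (use s r assms(1-5) in simp_all)
  define c where "c = pbmed C (rleg m) (lleg n) r1 (s1 \<bullet> r2)"
  have c: "c \<in> Arr C" "Dom C c = Dom C r1" "Cod C c = Dom C q1" "q1 \<bullet> c = r1" "q2 \<bullet> c = s1 \<bullet> r2"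
    using assms(1-5) r r' s by (simp_all add: c_def q1_def q2_def)
  define b where "b = pbmed C (rleg n \<bullet> q2) (lleg p) c (s2 \<bullet> r2)"
  have b: "b \<in> Arr C" "Dom C b = Dom C r1" "Cod C b = Dom C p1" "p1 \<bullet> b = c" "p2 \<bullet> b = s2 \<bullet> r2"
    unfolding b_def p1_def p2_def using assms(1-5) r r' s sr A c by (simp_all)
  have B: "q1 \<bullet> p1 \<bullet> b = r1" "q2 \<bullet> p1 \<bullet> b = s1 \<bullet> r2" using b c by simp_all
  let ?a = "assoc (span_double C) m n p"
  have B': "q1 \<bullet> p1 \<bullet> b \<bullet> z = r1 \<bullet> z" "q2 \<bullet> p1 \<bullet> b \<bullet> z = s1 \<bullet> r2 \<bullet> z" "p2 \<bullet> b \<bullet> z = s2 \<bullet> r2 \<bullet> z"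
    if z: "z \<in> Arr C" "Cod C z = Dom C r1" for z
  proof -
    have 1: "p1 \<bullet> b \<bullet> z = c \<bullet> z" using z b A by (intro reassoc1) auto
    show "q1 \<bullet> p1 \<bullet> b \<bullet> z = r1 \<bullet> z" unfolding 1 using z c A by (intro reassoc1) auto
    show "q2 \<bullet> p1 \<bullet> b \<bullet> z = s1 \<bullet> r2 \<bullet> z" unfolding 1 using z c A r s by (intro reassoc) auto
    show "p2 \<bullet> b \<bullet> z = s2 \<bullet> r2 \<bullet> z" using z c A r s b by (intro reassoc) auto
  qed
  have i1: "capx ?a \<bullet> b = Idt C (Dom C r1)"
    by (rule right_joint_monic[OF assms(1-5), folded s1_def s2_def, folded r1_def r2_def])
       (use b B r s in \<open>simp_all add: G(1-9)\<close>)
  have i2: "b \<bullet> capx ?a = Idt C (Dom C p1)"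
    by (rule left_joint_monic[OF assms(1-5), folded q1_def q2_def, folded p1_def p2_def])
       (use b B' A in \<open>simp_all add: G(1-9)\<close>)
  have d: "Dom C (lleg (span_comp C (span_comp C m n) p)) = Dom C p1"
    "Dom C (lleg (span_comp C m (span_comp C n p))) = Dom C r1"
    using assms(1-5) by (simp_all add: p1_def q2_def r1_def s1_def)
  have "inverse_arrows (span_cellcat C) ?a (globular_span_cell C (ctgt ?a) (csrc ?a) b)"
    using G(10-14) assms(1-5) b i1 i2 d by (intro globular_isoI) auto
  then show ?thesis using b B G(11-12) by auto
qed


lemma unit_sq [simp]:
  assumes "m \<in> spans C" "x = Cod C (lleg m)" "y = Cod C (rleg m)"
  shows "lleg m \<bullet> pb2 C (Idt C x) (lleg m) = pb1 C (Idt C x) (lleg m)"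
    "rleg m \<bullet> pb1 C (rleg m) (Idt C y) = pb2 C (rleg m) (Idt C y)"
proof -
  have m: "m \<in> spans C" by fact
  show "lleg m \<bullet> pb2 C (Idt C x) (lleg m) = pb1 C (Idt C x) (lleg m)"
    unfolding assms(2) using m pb_square[of "Idt C (Cod C (lleg m))" "lleg m"] by simp
  show "rleg m \<bullet> pb1 C (rleg m) (Idt C y) = pb2 C (rleg m) (Idt C y)"
    unfolding assms(3) using m pb_square[of "rleg m" "Idt C (Cod C (rleg m))"] by simp
qed

lemma lunit_in [simp]:
  assumes "m \<in> spans C"
  shows "lunit (span_double C) m \<in> span_cells C" "runit (span_double C) m \<in> span_cells C"
  using assms by (simp_all)

lemma lunit_inverse:
  assumes "m \<in> spans C"
  defines "u \<equiv> Idt C (Cod C (lleg m))"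
  shows "inverse_arrows (span_cellcat C) (lunit (span_double C) m)
      (globular_span_cell C m (span_comp C (span_unit C (Cod C (lleg m))) m)
         (pbmed C u (lleg m) (lleg m) (Idt C (Dom C (lleg m)))))"
proof -
  let ?k = "pbmed C u (lleg m) (lleg m) (Idt C (Dom C (lleg m)))"
  have k: "?k \<in> Arr C" "Dom C ?k = Dom C (lleg m)" "Cod C ?k = Dom C (pb1 C u (lleg m))"
    "pb1 C u (lleg m) \<bullet> ?k = lleg m" "pb2 C u (lleg m) \<bullet> ?k = Idt C (Dom C (lleg m))"
    using assms by simp_all
  have k': "?k \<bullet> pb2 C u (lleg m) = Idt C (Dom C (pb1 C u (lleg m)))"
    by (rule pb_joint_monic[of u "lleg m"]) (use assms in simp_all)
  show ?thesis
    using globular_isoI[of "lunit (span_double C) m" ?k] assms k k' by simp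
qed

lemma runit_inverse:
  assumes "m \<in> spans C"
  defines "u \<equiv> Idt C (Cod C (rleg m))"
  shows "inverse_arrows (span_cellcat C) (runit (span_double C) m)
      (globular_span_cell C m (span_comp C m (span_unit C (Cod C (rleg m))))
         (pbmed C (rleg m) u (Idt C (Dom C (lleg m))) (rleg m)))"
proof -
  let ?k = "pbmed C (rleg m) u (Idt C (Dom C (lleg m))) (rleg m)"
  have k: "?k \<in> Arr C" "Dom C ?k = Dom C (lleg m)" "Cod C ?k = Dom C (pb1 C (rleg m) u)"
    "pb2 C (rleg m) u \<bullet> ?k = rleg m" "pb1 C (rleg m) u \<bullet> ?k = Idt C (Dom C (lleg m))"
    using assms by simp_all
  have k': "?k \<bullet> pb1 C (rleg m) u = Idt C (Dom C (pb1 C (rleg m) u))"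
    by (rule pb_joint_monic[of "rleg m" u]) (use assms in simp_all)
  show ?thesis
    using globular_isoI[of "runit (span_double C) m" ?k] assms k k' by simp
qed

lemma hcomp_facts:
  assumes "s \<in> span_cells C" "t \<in> span_cells C" "crgt s = clft t"
    "Cod C (rleg (csrc s)) = Cod C (lleg (csrc t))"
    "Cod C (rleg (ctgt s)) = Cod C (lleg (ctgt t))"
  shows "capx (hcomp (span_double C) s t) \<in> Arr C"
    "Dom C (capx (hcomp (span_double C) s t)) = Dom C (pb1 C (rleg (csrc s)) (lleg (csrc t)))"
    "Cod C (capx (hcomp (span_double C) s t)) = Dom C (pb1 C (rleg (ctgt s)) (lleg (ctgt t)))"
    "\<lbrakk>a = rleg (ctgt s); b = lleg (ctgt t)\<rbrakk> \<Longrightarrow>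
      pb1 C a b \<bullet> capx (hcomp (span_double C) s t) = capx s \<bullet> pb1 C (rleg (csrc s)) (lleg (csrc t))"
    "\<lbrakk>a = rleg (ctgt s); b = lleg (ctgt t)\<rbrakk> \<Longrightarrow>
      pb2 C a b \<bullet> capx (hcomp (span_double C) s t) = capx t \<bullet> pb2 C (rleg (csrc s)) (lleg (csrc t))"
    "\<lbrakk>a = rleg (ctgt s); b = lleg (ctgt t); z \<in> Arr C; Cod C z = Dom C (pb1 C (rleg (csrc s)) (lleg (csrc t)))\<rbrakk> \<Longrightarrow>
      pb1 C a b \<bullet> capx (hcomp (span_double C) s t) \<bullet> z = capx s \<bullet> pb1 C (rleg (csrc s)) (lleg (csrc t)) \<bullet> z"
    "\<lbrakk>a = rleg (ctgt s); b = lleg (ctgt t); z \<in> Arr C; Cod C z = Dom C (pb1 C (rleg (csrc s)) (lleg (csrc t)))\<rbrakk> \<Longrightarrow>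
      pb2 C a b \<bullet> capx (hcomp (span_double C) s t) \<bullet> z = capx t \<bullet> pb2 C (rleg (csrc s)) (lleg (csrc t)) \<bullet> z"
  using hcomp_capx[OF assms, folded hcomp_capx_raw] by simp_all

declare span_double_simps(16) [simp del]

lemma interchange_aux:
  assumes "s \<in> span_cells C" "t \<in> span_cells C" "s' \<in> span_cells C" "t' \<in> span_cells C"
    "ctgt s = csrc s'" "ctgt t = csrc t'" "crgt s = clft t" "crgt s' = clft t'"
    "Cod C (rleg (csrc s)) = Cod C (lleg (csrc t))"
    "Cod C (rleg (csrc s')) = Cod C (lleg (csrc t'))"
    "Cod C (rleg (ctgt s')) = Cod C (lleg (ctgt t'))"
  shows "hcomp (span_double C) (Comp (span_cellcat C) s' s) (Comp (span_cellcat C) t' t) =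
    Comp (span_cellcat C) (hcomp (span_double C) s' t') (hcomp (span_double C) s t)"
    (is "?l = ?r")
proof -
  have l: "?l \<in> span_cells C" using assms by (intro hcomp_in) simp_all
  have h: "hcomp (span_double C) s t \<in> span_cells C" "hcomp (span_double C) s' t' \<in> span_cells C"
    using assms by (auto intro!: hcomp_in)
  have sc: "capx s \<in> Arr C" "capx t \<in> Arr C" "Cod C (capx s) = Dom C (capx s')" "Cod C (capx t) = Dom C (capx t')"
    using assms by simp_all
  have "capx ?l = capx ?r"
    unfolding span_cellcat_simps
    by (rule pb_joint_monic[of "rleg (ctgt s')" "lleg (ctgt t')"])
       (use assms in \<open>simp_all add: hcomp_facts\<close>)
  then show ?thesis using assms by (intro span_cell_eqI) simp_all
qed

lemma assoc_natural_aux: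
  assumes "s \<in> span_cells C" "t \<in> span_cells C" "r \<in> span_cells C"
    "crgt s = clft t" "crgt t = clft r"
    "Cod C (rleg (csrc s)) = Cod C (lleg (csrc t))" "Cod C (rleg (csrc t)) = Cod C (lleg (csrc r))"
    "Cod C (rleg (ctgt s)) = Cod C (lleg (ctgt t))" "Cod C (rleg (ctgt t)) = Cod C (lleg (ctgt r))"
  shows "Comp (span_cellcat C) (assoc (span_double C) (ctgt s) (ctgt t) (ctgt r))
      (hcomp (span_double C) (hcomp (span_double C) s t) r) =
    Comp (span_cellcat C) (hcomp (span_double C) s (hcomp (span_double C) t r))
      (assoc (span_double C) (csrc s) (csrc t) (csrc r))"
    (is "?l = ?r")
proof -
  let ?st = "hcomp (span_double C) s t" and ?tr = "hcomp (span_double C) t r"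
  let ?st_r = "hcomp (span_double C) ?st r" and ?s_tr = "hcomp (span_double C) s ?tr"
  have h: "?st \<in> span_cells C" "?tr \<in> span_cells C" using assms by (auto intro!: hcomp_in)
  then have h': "?st_r \<in> span_cells C" "?s_tr \<in> span_cells C" using assms by (auto intro!: hcomp_in)
  have sp: "csrc s \<in> spans C" "csrc t \<in> spans C" "csrc r \<in> spans C"
    "ctgt s \<in> spans C" "ctgt t \<in> spans C" "ctgt r \<in> spans C" using assms by simp_all
  note A = assoc_capx[OF sp(1-3) assms(6,7)]
  note B = assoc_capx[OF sp(4-6) assms(8,9)]
  note sq1 = assoc_squares[OF sp(1-3) assms(6,7)]
  note sq2 = assoc_squares[OF sp(4-6) assms(8,9)]
  have "capx ?l = capx ?r"
    unfolding span_cellcat_simps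
    by (rule right_joint_monic[OF sp(4-6) assms(8,9)])
       (use assms h in \<open>simp_all add: hcomp_facts A(1-9) B(1-9)\<close>)
  then show ?thesis using assms A(10-14) B(10-14) by (intro span_cell_eqI) simp_all
qed


end

context pullback_category
begin

lemma four_joint_monic:
  assumes "m \<in> spans C" "n \<in> spans C" "p \<in> spans C" "q \<in> spans C"
    "Cod C (rleg m) = Cod C (lleg n)"
    "Cod C (rleg n) = Cod C (lleg p)" "Cod C (rleg p) = Cod C (lleg q)"
  defines "t1 \<equiv> pb1 C (rleg p) (lleg q)" and "t2 \<equiv> pb2 C (rleg p) (lleg q)"
  defines "s1 \<equiv> pb1 C (rleg n) (lleg p \<bullet> t1)" and "s2 \<equiv> pb2 C (rleg n) (lleg p \<bullet> t1)"
  defines "r1 \<equiv> pb1 C (rleg m) (lleg n \<bullet> s1)" and "r2 \<equiv> pb2 C (rleg m) (lleg n \<bullet> s1)"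
  assumes "u \<in> Arr C" "v \<in> Arr C" "Dom C u = Dom C v" "Cod C u = Dom C r1" "Cod C v = Dom C r1"
    "r1 \<bullet> u = r1 \<bullet> v" "s1 \<bullet> r2 \<bullet> u = s1 \<bullet> r2 \<bullet> v"
    "t1 \<bullet> s2 \<bullet> r2 \<bullet> u = t1 \<bullet> s2 \<bullet> r2 \<bullet> v" "t2 \<bullet> s2 \<bullet> r2 \<bullet> u = t2 \<bullet> s2 \<bullet> r2 \<bullet> v"
  shows "u = v"
proof -
  have t: "t1 \<in> Arr C" "t2 \<in> Arr C" "Dom C t2 = Dom C t1" "Cod C t1 = Dom C (lleg p)" "Cod C t2 = Dom C (lleg q)"
    using assms(1-7) by (simp_all add: t1_def t2_def)
  have s: "s1 \<in> Arr C" "s2 \<in> Arr C" "Dom C s2 = Dom C s1" "Cod C s1 = Dom C (lleg n)" "Cod C s2 = Dom C t1"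
    using assms(1-7) t by (simp_all add: s1_def s2_def)
  have r: "r1 \<in> Arr C" "r2 \<in> Arr C" "Dom C r2 = Dom C r1" "Cod C r1 = Dom C (lleg m)" "Cod C r2 = Dom C s1"
    using assms(1-7) s by (simp_all add: r1_def r2_def)
  have "r2 \<bullet> u = r2 \<bullet> v"
    by (rule right_joint_monic[of n p q, folded t1_def t2_def, folded s1_def s2_def])
      (use assms(1-7,14-22) s r t in simp_all)
  then show ?thesis
    by (intro pb_joint_monic[of "rleg m" "lleg n \<bullet> s1" u v, folded r1_def r2_def])
       (use assms(1-7,14-22) s r t in simp_all)
qed

lemma pentagon_aux:
  assumes "m \<in> spans C" "n \<in> spans C" "p \<in> spans C" "q \<in> spans C"
    "Cod C (rleg m) = Cod C (lleg n)"
    "Cod C (rleg n) = Cod C (lleg p)" "Cod C (rleg p) = Cod C (lleg q)"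
  defines "A1 \<equiv> assoc (span_double C) m n (span_comp C p q)"
    and "A2 \<equiv> assoc (span_double C) (span_comp C m n) p q"
    and "A3 \<equiv> assoc (span_double C) n p q"
    and "B1 \<equiv> hcomp (span_double C) (idcell (span_double C) m) (assoc (span_double C) n p q)"
    and "B2 \<equiv> assoc (span_double C) m (span_comp C n p) q"
    and "A4 \<equiv> assoc (span_double C) m n p"
    and "B3 \<equiv> hcomp (span_double C) (assoc (span_double C) m n p) (idcell (span_double C) q)"
  shows "Comp (span_cellcat C) A1 A2 = Comp (span_cellcat C) B1 (Comp (span_cellcat C) B2 B3)"
    (is "?l = ?r")
proof -
  have c: "span_comp C p q \<in> spans C" "span_comp C m n \<in> spans C" "span_comp C n p \<in> spans C"
    "Cod C (rleg n) = Cod C (lleg (span_comp C p q))"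
    "Cod C (rleg (span_comp C m n)) = Cod C (lleg p)"
    "Cod C (rleg m) = Cod C (lleg (span_comp C n p))"
    "Cod C (rleg (span_comp C n p)) = Cod C (lleg q)"
    using assms(1-7) by simp_all
  note bd = assoc_capx(10-14)[OF assms(1,2) c(1) assms(5) c(4), folded A1_def]
    assoc_capx(10-14)[OF c(2) assms(3,4) c(5) assms(7), folded A2_def]
    assoc_capx(10-14)[OF assms(2,3,4,6,7), folded A3_def]
    assoc_capx(10-14)[OF assms(1,2,3,5,6), folded A4_def]
    assoc_capx(10-14)[OF assms(1) c(3) assms(4) c(6,7), folded B2_def]
  note a1 = assoc_capx[OF assms(1,2) c(1) assms(5) c(4), folded A1_def]
  note a2 = assoc_capx[OF c(2) assms(3,4) c(5) assms(7), folded A2_def]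
  note a3 = assoc_capx[OF assms(2,3,4,6,7), folded A3_def]
  note a4 = assoc_capx[OF assms(1,2,3,5,6), folded A4_def]
  note b2 = assoc_capx[OF assms(1) c(3) assms(4) c(6,7), folded B2_def]
  note simps = span_comp_spans(2-6)[OF assms(1,2,5)] span_comp_spans(2-6)[OF assms(2,3,6)]
     span_comp_spans(2-6)[OF assms(3,4,7)]
  have e1: "(lleg n \<bullet> pb1 C (rleg n) (lleg p)) \<bullet> pb1 C (rleg p \<bullet> pb2 C (rleg n) (lleg p)) (lleg q) =
      lleg n \<bullet> pb1 C (rleg n) (lleg p) \<bullet> pb1 C (rleg p \<bullet> pb2 C (rleg n) (lleg p)) (lleg q)"
    using assms(1-7) by simp
  have e2: "(rleg p \<bullet> pb2 C (rleg n) (lleg p)) \<bullet> pb2 C (rleg m) (lleg n \<bullet> pb1 C (rleg n) (lleg p)) =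
      rleg p \<bullet> pb2 C (rleg n) (lleg p) \<bullet> pb2 C (rleg m) (lleg n \<bullet> pb1 C (rleg n) (lleg p))"
    using assms(1-7) by simp
  note a1 = a1[unfolded simps] note a2 = a2[unfolded simps] note b2 = b2[unfolded simps, unfolded e1 e2]
  have B: "B1 = hcomp (span_double C) (idcell (span_double C) m) A3"
    "B3 = hcomp (span_double C) A4 (idcell (span_double C) q)"
    unfolding B1_def B3_def A3_def A4_def by simp_all
  note sq = assoc_squares[OF assms(1,2) c(1) assms(5) c(4), unfolded simps]
    assoc_squares[OF c(2) assms(3,4) c(5) assms(7), unfolded simps]
    assoc_squares[OF assms(2,3,4,6,7)] assoc_squares[OF assms(1,2,3,5,6)]
    assoc_squares[OF assms(1) c(3) assms(4) c(6,7), unfolded simps, unfolded e1 e2]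
  have capx: "capx ?l = capx ?r"
    unfolding span_cellcat_simps B
    by (rule four_joint_monic[OF assms(1-7)])
       (use assms(1-7) in \<open>simp_all add: hcomp_facts a1 a2 a3 a4 b2
          del: pbmed_simps pbmed_simps' hcomp_capx span_cells_simps'\<close>)
  show ?thesis
    by (rule span_cell_eqI[OF _ _ capx]) (use assms(1-7) in \<open>simp_all add: B bd\<close>)
qed

lemma triangle_aux:
  assumes "m \<in> spans C" "n \<in> spans C" "Cod C (rleg m) = Cod C (lleg n)"
  shows "Comp (span_cellcat C) (hcomp (span_double C) (idcell (span_double C) m) (lunit (span_double C) n))
        (assoc (span_double C) m (span_unit C (Cod C (lleg n))) n) =
     hcomp (span_double C) (runit (span_double C) m) (idcell (span_double C) n)" (is "?l = ?r")
proof -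
  let ?u = "span_unit C (Cod C (lleg n))"
  have u: "?u \<in> spans C" "Cod C (rleg m) = Cod C (lleg ?u)" "Cod C (rleg ?u) = Cod C (lleg n)"
    using assms by simp_all
  have ul: "lleg ?u = Idt C (Cod C (lleg n))" "rleg ?u = Idt C (Cod C (lleg n))" using assms by simp_all
  note a = assoc_capx[OF assms(1) u(1) assms(2) u(2,3), unfolded ul]
  note sq = assoc_squares[OF assms(1) u(1) assms(2) u(2,3), unfolded ul]
  have "capx ?l = capx ?r"
    unfolding span_cellcat_simps(7)
    by (rule pb_joint_monic[of "rleg m" "lleg n"])
       (use assms a(1-9) sq in \<open>simp_all add: hcomp_facts\<close>)
  then show ?thesis using assms a(10-14)
    by (intro span_cell_eqI) (simp_all)
qed

lemma span_double_category: "pseudo_double_category (span_double C)"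
proof (rule pseudo_double_category.intro, goal_cases)
  case 1 then show ?case by (simp add: category_axioms)
next
  case 2 then show ?case by (simp add: span_cell_category)
next
  case 3 then show ?case by (simp add: span_functors)
next
  case 4 then show ?case by (simp add: span_functors)
next
  case 5 then show ?case by (auto simp: is_functor_def hom_def intro!: span_cell_eqI)
next
  case 6 then show ?case by simp
next
  case 7 then show ?case by simp
next
  case 8 then show ?case by simp
next
  case 9 then show ?case by (auto intro!: hcomp_in)
next
  case (10 m x y n)
  then show ?case
    by (intro span_cell_eqI, simp_all)
       (rule pb_joint_monic[of "rleg m" "lleg n"], simp_all add: hcomp_facts)
next
  case 11 then show ?case by (auto intro!: interchange_aux)
next
  case (12 m w x n y p z)
  then have A: "m \<in> spans C" "n \<in> spans C" "p \<in> spans C" "Cod C (rleg m) = Cod C (lleg n)"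
    "Cod C (rleg n) = Cod C (lleg p)" by simp_all
  show ?case using assoc_inverse[OF A] assoc_capx[OF A] A unfolding globular_iso_def iso_def by auto
next
  case (13 m) then show ?case using lunit_inverse[of m] unfolding globular_iso_def iso_def by auto
next
  case (14 m) then show ?case using runit_inverse[of m] unfolding globular_iso_def iso_def by auto
next
  case (15 s m m' f g t n n' h r p p' k)
  then show ?case using assoc_natural_aux[of s t r] by simp
next
  case (16 s m m' f g)
  then show ?case
    by (intro span_cell_eqI) (auto simp: hcomp_facts)
next
  case (17 s m m' f g)
  then show ?case
    by (intro span_cell_eqI) (auto simp: hcomp_facts)
next
  case (18 m v w n x p y q z)
  then show ?case using pentagon_aux[of m n p q] by simp
next
  case (19 m x y n z)
  then show ?case using triangle_aux[of m n] by simp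
qed

end

lemma discrete_category: "category (discrete A)"
  by unfold_locales (auto simp: discrete_def hom_def)

lemma discrete_simps [simp]: "Obj (discrete A) = A" "Arr (discrete A) = A" "Dom (discrete A) = (\<lambda>x. x)"
  "Cod (discrete A) = (\<lambda>x. x)" "Idt (discrete A) = (\<lambda>x. x)" "Comp (discrete A) y x = x"
  "f \<in> hom (discrete A) x y \<longleftrightarrow> f \<in> A \<and> x = f \<and> y = f"
  by (auto simp: discrete_def hom_def)

lemma loose_double_simps [simp]:
  "tightcat (loose_double I) = discrete (Obj I)" "cellcat (loose_double I) = discrete (Arr I)"
  "lsrc (loose_double I) = Dom I" "ltgt (loose_double I) = Cod I" "lft (loose_double I) = Dom I"
  "rgt (loose_double I) = Cod I" "unit (loose_double I) = Idt I" "unitcell (loose_double I) = Idt I"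
  "lcomp (loose_double I) u v = v \<bullet>\<^bsub>I\<^esub> u" "hcomp (loose_double I) u v = v \<bullet>\<^bsub>I\<^esub> u"
  "assoc (loose_double I) u v w = w \<bullet>\<^bsub>I\<^esub> v \<bullet>\<^bsub>I\<^esub> u"
  "lunit (loose_double I) u = u" "runit (loose_double I) u = u"
  by (simp_all add: loose_double_def)

lemma loose_double_lhom [simp]: "u \<in> lhom (loose_double I) i j \<longleftrightarrow> u \<in> Arr I \<and> Dom I u = i \<and> Cod I u = j"
  by (simp add: lhom_def)

lemma loose_double_cells [simp]: "s \<in> cells (loose_double I) u v f g \<longleftrightarrow>
    s \<in> Arr I \<and> u = s \<and> v = s \<and> f = Dom I s \<and> g = Cod I s"
  by (auto simp: cells_def)

lemma loose_double_globular_iso [simp]: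
  "globular_iso (loose_double I) u v s \<longleftrightarrow> s \<in> Arr I \<and> u = s \<and> v = s"
  by (auto simp: globular_iso_def iso_def inverse_arrows_def)

lemma loose_double_category:
  assumes "category I" shows "pseudo_double_category (loose_double I)"
proof -
  interpret category I by fact
  show ?thesis
    by (rule pseudo_double_category.intro) (auto simp: discrete_category is_functor_def)
qed

locale companion_setup = pullback_category C + I: category I
  for C :: "('o, 'a) cat" and I :: "('i, 'j) cat" +
  fixes D :: "('i, 'j, 'o, 'a) ftor"
  assumes D: "is_functor I C D"
begin

lemma D_simps [simp]:
  "i \<in> Obj I \<Longrightarrow> fob D i \<in> Obj C"
  "u \<in> Arr I \<Longrightarrow> far D u \<in> Arr C"
  "u \<in> Arr I \<Longrightarrow> Dom C (far D u) = fob D (Dom I u)"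
  "u \<in> Arr I \<Longrightarrow> Cod C (far D u) = fob D (Cod I u)"
  "i \<in> Obj I \<Longrightarrow> far D (Idt I i) = Idt C (fob D i)"
  "\<lbrakk>u \<in> Arr I; v \<in> Arr I; Cod I u = Dom I v\<rbrakk> \<Longrightarrow> far D (v \<bullet>\<^bsub>I\<^esub> u) = far D v \<bullet>\<^bsub>C\<^esub> far D u"
  using D by (auto simp: is_functor_def hom_def)

lemma companion_simps [simp]:
  "lleg (companion C f) = Idt C (Dom C f)" "rleg (companion C f) = f"
  "f \<in> Arr C \<Longrightarrow> companion C f \<in> spans C"
  by (simp_all add: companion_def in_spansI)

lemma globular_isoI':
  assumes "globular_span_cell C m n h \<in> span_cells C"
    "k \<in> Arr C" "Dom C k = Dom C (lleg n)" "Cod C k = Dom C (lleg m)"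
    "k \<bullet>\<^bsub>C\<^esub> h = Idt C (Dom C (lleg m))" "h \<bullet>\<^bsub>C\<^esub> k = Idt C (Dom C (lleg n))"
  shows "globular_iso (span_double C) m n (globular_span_cell C m n h)"
  using globular_isoI[of "globular_span_cell C m n h" k] assms
  unfolding globular_iso_def iso_def by auto

abbreviation "X \<equiv> companion_diagram I C D"

lemma X_simps [simp]:
  "dob X = fob D" "dtight X = (\<lambda>i. Idt C (fob D i))" "dloose X u = companion C (far D u)"
  "dcell X u = idcell (span_double C) (companion C (far D u))"
  "dcomp X u v = globular_span_cell C (span_comp C (companion C (far D u)) (companion C (far D v)))
     (companion C (far D (v \<bullet>\<^bsub>I\<^esub> u))) (lleg (span_comp C (companion C (far D u)) (companion C (far D v))))"
  "dunit X i = globular_span_cell C (span_unit C (fob D i)) (companion C (far D (Idt I i)))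
                    (lleg (span_unit C (fob D i)))"
  by (simp_all add: companion_diagram_def Let_def)

lemma comp_companion_sq:
  assumes "f \<in> Arr C" "g \<in> Arr C" "Cod C f = Dom C g"
  shows "pb2 C f (Idt C (Dom C g)) = f \<bullet>\<^bsub>C\<^esub> pb1 C f (Idt C (Dom C g))"
  using pb_square[of f "Idt C (Dom C g)"] assms by simp

lemma dcomp_X_iso:
  assumes "u \<in> Arr I" "v \<in> Arr I" "Cod I u = Dom I v"
  shows "globular_iso (span_double C) (span_comp C (companion C (far D u)) (companion C (far D v)))
     (companion C (far D (v \<bullet>\<^bsub>I\<^esub> u))) (dcomp X u v)"
proof -
  let ?f = "far D u" let ?m = "span_comp C (companion C ?f) (companion C (far D v))"
  let ?e = "Idt C (fob D (Dom I v))"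
  let ?k = "pbmed C ?f ?e (Idt C (Dom C ?f)) ?f"
  have sq: "pb2 C ?f ?e = ?f \<bullet>\<^bsub>C\<^esub> pb1 C ?f ?e" using comp_companion_sq[of ?f "far D v"] assms by simp
  have e: "?k \<in> Arr C" "Dom C ?k = Dom C ?f" "Cod C ?k = Dom C (pb1 C ?f ?e)"
    "pb1 C ?f ?e \<bullet>\<^bsub>C\<^esub> ?k = Idt C (Dom C ?f)" "pb2 C ?f ?e \<bullet>\<^bsub>C\<^esub> ?k = ?f"
    using assms by (simp_all add: I.Dom_Obj)
  have k': "?k \<bullet>\<^bsub>C\<^esub> pb1 C ?f ?e = Idt C (Dom C (pb1 C ?f ?e))"
    by (rule pb_joint_monic[of ?f ?e]) (use assms in \<open>simp_all add: sq\<close>)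
  show ?thesis unfolding X_simps
    by (rule globular_isoI'[of _ _ _ ?k])
       (use assms e k' in \<open>simp_all add: sq\<close>)
qed

lemma cell_into_companion_unique:
  assumes "s \<in> span_cells C" "t \<in> span_cells C" "csrc s = csrc t" "ctgt s = companion C f"
    "ctgt t = companion C f" "f \<in> Arr C" "clft s = clft t" "crgt s = crgt t"
  shows "s = t"
proof -
  have "capx s = clft s \<bullet>\<^bsub>C\<^esub> lleg (csrc s)" "capx t = clft s \<bullet>\<^bsub>C\<^esub> lleg (csrc s)"
    using span_cells_simps(12)[OF assms(1)] span_cells_simps(12)[OF assms(2)]
      span_cells_simps(3,5)[OF assms(1)] span_cells_simps(3,5)[OF assms(2)] assms by auto
  then show ?thesis using assms by (intro span_cell_eqI) auto
qed


lemma dcomp_X_in [simp]: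
  assumes "u \<in> Arr I" "v \<in> Arr I" "Cod I u = Dom I v"
  shows "dcomp X u v \<in> span_cells C"
  using dcomp_X_iso[OF assms] by (simp add: globular_iso_def del: X_simps)

lemma dcomp_X_simps:
  "csrc (dcomp X u v) = span_comp C (companion C (far D u)) (companion C (far D v))"
  "ctgt (dcomp X u v) = companion C (far D (v \<bullet>\<^bsub>I\<^esub> u))"
  "clft (dcomp X u v) = Idt C (Cod C (lleg (span_comp C (companion C (far D u)) (companion C (far D v)))))"
  "crgt (dcomp X u v) = Idt C (Cod C (rleg (span_comp C (companion C (far D u)) (companion C (far D v)))))"
  by simp_all

lemma dunit_X_simps:
  assumes "i \<in> Obj I"
  shows "dunit X i \<in> span_cells C"
  "csrc (dunit X i) = span_unit C (fob D i)"
  "ctgt (dunit X i) = companion C (Idt C (fob D i))"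
  "clft (dunit X i) = Idt C (fob D i)"
  "crgt (dunit X i) = Idt C (fob D i)"
  using assms by simp_all

lemma lunit_boundary:
  assumes "m \<in> spans C"
  shows "lunit (span_double C) m \<in> span_cells C"
    "csrc (lunit (span_double C) m) = span_comp C (span_unit C (Cod C (lleg m))) m"
    "ctgt (lunit (span_double C) m) = m"
    "clft (lunit (span_double C) m) = Idt C (Cod C (lleg m))"
    "crgt (lunit (span_double C) m) = Idt C (Cod C (rleg m))"
  using assms lunit_in(1)[OF assms] by simp_all

lemma runit_boundary:
  assumes "m \<in> spans C"
  shows "runit (span_double C) m \<in> span_cells C"
    "csrc (runit (span_double C) m) = span_comp C m (span_unit C (Cod C (rleg m)))"
    "ctgt (runit (span_double C) m) = m"
    "clft (runit (span_double C) m) = Idt C (Cod C (lleg m))"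
    "crgt (runit (span_double C) m) = Idt C (Cod C (rleg m))"
  using assms lunit_in(2)[OF assms] by simp_all

lemmas assoc_boundary = assoc_capx(10-14)

lemma companion_diagram_functor:
  "pseudo_double_functor (loose_double I) (span_double C) X"
proof (rule pseudo_double_functor.intro, goal_cases)
  case 1 show ?case by (auto simp: is_functor_def hom_def)
next
  case 2 show ?case by (auto simp: is_functor_def hom_def intro!: span_cell_eqI)
next
  case 3 then show ?case by auto
next
  case 4 then show ?case by auto
next
  case (5 u i j v k)
  then show ?case using dcomp_X_iso[of u v] by (auto simp del: X_simps(5))
next
  case (6 i)
  then have i: "i \<in> Obj I" by simp
  have "globular_iso (span_double C) (span_unit C (fob D i)) (companion C (Idt C (fob D i)))
      (globular_span_cell C (span_unit C (fob D i)) (companion C (Idt C (fob D i))) (Idt C (fob D i)))"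
    by (rule globular_isoI'[of _ _ _ "Idt C (fob D i)"]) (use i in simp_all)
  then show ?case using i by simp
next
  case (7 s u u' f g t v v' h)
  then have A: "s \<in> Arr I" "t \<in> Arr I" "u = s" "u' = s" "v = t" "v' = t" "Cod I s = Dom I t" by simp_all
  have h: "hcomp (span_double C) (dcell X s) (dcell X t) \<in> span_cells C"
    using A by (intro hcomp_in) simp_all
  show ?case unfolding A(3-6)
    by (rule cell_into_companion_unique[where f = "far D (t \<bullet>\<^bsub>I\<^esub> s)"])
       (use A h in \<open>simp_all add: dcomp_X_simps del: X_simps(5)\<close>)
next
  case (8 f i i')
  then have A: "i \<in> Obj I" "f = i" "i' = i" by auto
  show ?case unfolding A(2,3)
    by (rule cell_into_companion_unique[where f = "Idt C (fob D i)"])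
       (use A in \<open>simp_all add: dunit_X_simps del: X_simps(6)\<close>)
next
  case (9 u i j v k z l)
  then have A: "u \<in> Arr I" "v \<in> Arr I" "z \<in> Arr I" "Cod I u = Dom I v" "Cod I v = Dom I z" by simp_all
  have h: "hcomp (span_double C) (dcomp X u v) (idcell (span_double C) (companion C (far D z))) \<in> span_cells C"
     "hcomp (span_double C) (idcell (span_double C) (companion C (far D u))) (dcomp X v z) \<in> span_cells C"
    using A by (auto intro!: hcomp_in simp: dcomp_X_simps simp del: X_simps(5))
  have as: "companion C (far D u) \<in> spans C" "companion C (far D v) \<in> spans C" "companion C (far D z) \<in> spans C"
    "Cod C (rleg (companion C (far D u))) = Cod C (lleg (companion C (far D v)))"
    "Cod C (rleg (companion C (far D v))) = Cod C (lleg (companion C (far D z)))"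
    using A by simp_all
  note a = assoc_boundary[OF as]
  show ?case
    by (rule cell_into_companion_unique[where f = "far D ((z \<bullet>\<^bsub>I\<^esub> v) \<bullet>\<^bsub>I\<^esub> u)"])
       (use A h a in \<open>simp_all add: dcomp_X_simps del: X_simps(5)\<close>)
next
  case (10 u i j)
  then have A: "u \<in> Arr I" "i = Dom I u" by simp_all
  have h: "hcomp (span_double C) (dunit X i) (idcell (span_double C) (companion C (far D u))) \<in> span_cells C"
    using A by (auto intro!: hcomp_in simp: dunit_X_simps simp del: X_simps(6))
  show ?case
    by (rule cell_into_companion_unique[where f = "far D u"])
       (use A h in \<open>simp_all add: dcomp_X_simps dunit_X_simps lunit_boundary del: X_simps(5,6) lunit_simps\<close>)
next
  case (11 u i j)
  then have A: "u \<in> Arr I" "j = Cod I u" by simp_all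
  have h: "hcomp (span_double C) (idcell (span_double C) (companion C (far D u))) (dunit X j) \<in> span_cells C"
    using A by (auto intro!: hcomp_in simp: dunit_X_simps simp del: X_simps(6))
  show ?case
    by (rule cell_into_companion_unique[where f = "far D u"])
       (use A h in \<open>simp_all add: dcomp_X_simps dunit_X_simps runit_boundary del: X_simps(5,6) lunit_simps\<close>)
qed

end

context pullback_category
begin

lemma inverse_assoc_boundary:
  assumes "m \<in> spans C" "n \<in> spans C" "p \<in> spans C" "Cod C (rleg m) = Cod C (lleg n)"
    "Cod C (rleg n) = Cod C (lleg p)"
  defines "a \<equiv> inverse_arr (span_cellcat C) (assoc (span_double C) m n p)"
  shows "a \<in> span_cells C" "csrc a = span_comp C m (span_comp C n p)"
    "ctgt a = span_comp C (span_comp C m n) p" "clft a = Idt C (Cod C (lleg m))"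
    "crgt a = Idt C (Cod C (rleg p))"
proof -
  from assoc_inverse[OF assms(1-5)] obtain b where
    b: "inverse_arrows (span_cellcat C) (assoc (span_double C) m n p)
      (globular_span_cell C (span_comp C m (span_comp C n p)) (span_comp C (span_comp C m n) p) b)"
    by blast
  from category.inverse_arr_eq[OF span_cell_category b]
  have a: "a = globular_span_cell C (span_comp C m (span_comp C n p)) (span_comp C (span_comp C m n) p) b"
    by (simp add: a_def)
  have "a \<in> span_cells C" using b unfolding a inverse_arrows_def hom_def by (simp add: assoc_capx(10-12)[OF assms(1-5)])
  then show "a \<in> span_cells C" "csrc a = span_comp C m (span_comp C n p)"
    "ctgt a = span_comp C (span_comp C m n) p" "clft a = Idt C (Cod C (lleg m))"
    "crgt a = Idt C (Cod C (rleg p))"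
    using assms(1-5) by (simp_all add: a)
qed

lemma inverse_runit_boundary:
  assumes "m \<in> spans C"
  defines "a \<equiv> inverse_arr (span_cellcat C) (runit (span_double C) m)"
  shows "a \<in> span_cells C" "csrc a = m"
    "ctgt a = span_comp C m (span_unit C (Cod C (rleg m)))" "clft a = Idt C (Cod C (lleg m))"
    "crgt a = Idt C (Cod C (rleg m))"
proof -
  note b = runit_inverse[OF assms(1)]
  note a = category.inverse_arr_eq[OF span_cell_category b]
  have "a \<in> span_cells C" using b unfolding a_def a inverse_arrows_def hom_def by simp
  then show "a \<in> span_cells C" "csrc a = m"
    "ctgt a = span_comp C m (span_unit C (Cod C (rleg m)))" "clft a = Idt C (Cod C (lleg m))"
    "crgt a = Idt C (Cod C (rleg m))"
    using assms(1) by (simp_all add: a a_def del: lunit_simps)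
qed

end

locale cocone_setup = companion_setup +
  fixes c and \<eta>
  assumes cocone: "is_cocone I C D c \<eta>"
begin

lemma eta_simps [simp]: "c \<in> Obj C" "i \<in> Obj I \<Longrightarrow> \<eta> i \<in> Arr C"
  "i \<in> Obj I \<Longrightarrow> Dom C (\<eta> i) = fob D i"
  "i \<in> Obj I \<Longrightarrow> Cod C (\<eta> i) = c"
  "\<lbrakk>u \<in> Arr I; j = Cod I u\<rbrakk> \<Longrightarrow> \<eta> j \<bullet>\<^bsub>C\<^esub> far D u = \<eta> (Dom I u)"
  using cocone by (auto simp: is_cocone_def hom_def)

lemma eta_reassoc: "\<lbrakk>u \<in> Arr I; z \<in> Arr C; Cod C z = fob D (Dom I u)\<rbrakk> \<Longrightarrow>
   \<eta> (Cod I u) \<bullet>\<^bsub>C\<^esub> far D u \<bullet>\<^bsub>C\<^esub> z = \<eta> (Dom I u) \<bullet>\<^bsub>C\<^esub> z"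
  by (rule reassoc1) simp_all

abbreviation "E \<equiv> companion_cocone I C D c \<eta>"
abbreviation "K \<equiv> diag (span_double C) c :: ('c, 'c, 'd, 'd, _, _, _, _) dftor"

lemma E_simps [simp]:
  "lob E = (\<lambda>i. companion C (\<eta> i))" "ltight E i = idcell (span_double C) (companion C (\<eta> i))"
  by (simp_all add: companion_cocone_def)

lemma comp_unit_cell_unique:
  assumes "s \<in> span_cells C" "t \<in> span_cells C" "csrc s = csrc t"
    "ctgt s = span_comp C (companion C f) (span_unit C (Cod C f))"
    "ctgt t = span_comp C (companion C f) (span_unit C (Cod C f))"
    "f \<in> Arr C" "clft s = clft t" "crgt s = crgt t"
  shows "s = t"
proof -
  let ?e = "Idt C (Cod C f)"
  have q: "pb2 C f ?e = f \<bullet>\<^bsub>C\<^esub> pb1 C f ?e" using pb_square[of f ?e] assms(6) by simp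
  have 1: "pb1 C f ?e \<bullet>\<^bsub>C\<^esub> capx s = clft s \<bullet>\<^bsub>C\<^esub> lleg (csrc s)"
    using span_cells_simps(12)[OF assms(1)] assms(4,6) by simp
  have 2: "pb1 C f ?e \<bullet>\<^bsub>C\<^esub> capx t = clft s \<bullet>\<^bsub>C\<^esub> lleg (csrc s)"
    using span_cells_simps(12)[OF assms(2)] assms(3,5,6,7) by simp
  have a: "Cod C (capx s) = Dom C (pb1 C f ?e)" "Cod C (capx t) = Dom C (pb1 C f ?e)"
    "Dom C (capx s) = Dom C (capx t)" "capx s \<in> Arr C" "capx t \<in> Arr C"
    using assms span_cells_simps(5)[OF assms(1)] span_cells_simps(5)[OF assms(2)] by simp_all
  have "capx s = capx t"
    by (rule pb_joint_monic[of f ?e]) (use a 1 2 assms(6) in \<open>simp_all add: q\<close>)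
  then show ?thesis using assms by (intro span_cell_eqI) auto
qed

lemma lloose_E:
  assumes "u \<in> Arr I"
  shows "lloose E u \<in> span_cells C"
    "csrc (lloose E u) = span_comp C (companion C (far D u)) (companion C (\<eta> (Cod I u)))"
    "ctgt (lloose E u) = span_comp C (companion C (\<eta> (Dom I u))) (span_unit C c)"
    "clft (lloose E u) = Idt C (fob D (Dom I u))"
    "crgt (lloose E u) = Idt C c"
    "globular_iso (span_double C) (csrc (lloose E u)) (ctgt (lloose E u)) (lloose E u)"
proof -
  let ?f = "far D u" and ?g = "\<eta> (Cod I u)" and ?h = "\<eta> (Dom I u)"
  let ?m = "span_comp C (companion C ?f) (companion C ?g)"
  let ?n = "span_comp C (companion C ?h) (span_unit C c)"
  let ?x = "pbmed C ?h (Idt C c) (lleg ?m) (rleg ?m)"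
  let ?d = "Idt C (Dom C ?g)"
  have e: "lloose E u = globular_span_cell C ?m ?n ?x"
    by (simp add: companion_cocone_def Let_def)
  have q: "pb2 C ?f ?d = ?f \<bullet>\<^bsub>C\<^esub> pb1 C ?f ?d"
    using pb_square[of ?f ?d] assms by simp
  have q': "pb2 C ?h (Idt C c) = ?h \<bullet>\<^bsub>C\<^esub> pb1 C ?h (Idt C c)"
    using pb_square[of ?h "Idt C c"] assms by simp
  have d: "?d = Idt C (fob D (Cod I u))" using assms by simp
  note q = q[unfolded d]
  have m: "lleg ?m = pb1 C ?f ?d" "rleg ?m = ?h \<bullet>\<^bsub>C\<^esub> pb1 C ?f ?d"
    using assms by (simp_all add: q eta_reassoc)
  note m = m[unfolded d]
  have x: "?x \<in> Arr C" "Dom C ?x = Dom C (pb1 C ?f ?d)" "Cod C ?x = Dom C (pb1 C ?h (Idt C c))"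
    "pb1 C ?h (Idt C c) \<bullet>\<^bsub>C\<^esub> ?x = pb1 C ?f ?d"
    unfolding m d using assms by simp_all
  define y where "y = pbmed C ?f ?d (pb1 C ?h (Idt C c)) (?f \<bullet>\<^bsub>C\<^esub> pb1 C ?h (Idt C c))"
  have y: "y \<in> Arr C" "Dom C y = Dom C (pb1 C ?h (Idt C c))" "Cod C y = Dom C (pb1 C ?f ?d)"
    "pb1 C ?f ?d \<bullet>\<^bsub>C\<^esub> y = pb1 C ?h (Idt C c)"
    unfolding y_def using assms by simp_all
  have x': "pb1 C ?h (Idt C c) \<bullet>\<^bsub>C\<^esub> ?x \<bullet>\<^bsub>C\<^esub> z = pb1 C ?f ?d \<bullet>\<^bsub>C\<^esub> z"
    if "z \<in> Arr C" "Cod C z = Dom C ?x" for z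
    by (rule reassoc1[OF x(4)]) (use x that assms in simp_all)
  have y': "pb1 C ?f ?d \<bullet>\<^bsub>C\<^esub> y \<bullet>\<^bsub>C\<^esub> z = pb1 C ?h (Idt C c) \<bullet>\<^bsub>C\<^esub> z"
    if "z \<in> Arr C" "Cod C z = Dom C y" for z
    by (rule reassoc1[OF y(4)]) (use y that assms in simp_all)
  have yx: "y \<bullet>\<^bsub>C\<^esub> ?x = Idt C (Dom C (pb1 C ?f ?d))"
    by (rule pb_joint_monic[of ?f ?d]) (use x y x' y' assms in \<open>simp_all add: q m\<close>)
  have xy: "?x \<bullet>\<^bsub>C\<^esub> y = Idt C (Dom C (pb1 C ?h (Idt C c)))"
    by (rule pb_joint_monic[of ?h "Idt C c"]) (use x y x' y' assms in \<open>simp_all add: q' m\<close>)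
  have s: "globular_span_cell C ?m ?n ?x \<in> span_cells C"
    using x assms by (intro globular_span_cell_in) (simp_all add: q' q eta_reassoc)
  show "lloose E u \<in> span_cells C"
    "csrc (lloose E u) = span_comp C (companion C (far D u)) (companion C (\<eta> (Cod I u)))"
    "ctgt (lloose E u) = span_comp C (companion C (\<eta> (Dom I u))) (span_unit C c)"
    "clft (lloose E u) = Idt C (fob D (Dom I u))"
    "crgt (lloose E u) = Idt C c"
    using s assms by (simp_all add: e)
  show "globular_iso (span_double C) (csrc (lloose E u)) (ctgt (lloose E u)) (lloose E u)"
    unfolding e globular_span_cell_simps
    by (rule globular_isoI'[OF s, of y]) (use y assms xy yx in simp_all)
qed

lemma K_simps [simp]: "dob K i = c" "dtight K f = Idt C c" "dloose K u = span_unit C c"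
  "dcell K w = idcell (span_double C) (span_unit C c)"
  "dcomp K u v = lunit (span_double C) (span_unit C c)"
  "dunit K i = idcell (span_double C) (span_unit C c)"
  by (simp_all add: diag_def)

lemma companion_loose_cocone:
  "pseudo_loose_transformation (loose_double I) (span_double C) X K E"
proof (rule pseudo_loose_transformation.intro, goal_cases)
  case (1 i) then show ?case by simp
next
  case 2 then show ?case by (auto simp: is_functor_def hom_def intro!: span_cell_eqI)
next
  case 3 then show ?case by auto
next
  case (4 u i j) then show ?case using lloose_E(2,3,6)[of u] by auto
next
  case (5 w u u' f g)
  then have A: "w \<in> Arr I" "u = w" "u' = w" "f = Dom I w" "g = Cod I w" by simp_all
  have h: "hcomp (span_double C) (dcell X w) (ltight E g) \<in> span_cells C"
    "hcomp (span_double C) (ltight E f) (dcell K w) \<in> span_cells C"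
    using A by (auto intro!: hcomp_in)
  show ?case unfolding A(2-5)
    by (rule comp_unit_cell_unique[where f = "\<eta> (Dom I w)"]) (use A h in \<open>simp_all add: lloose_E\<close>)
next
  case (6 i)
  then have A: "i \<in> Obj I" by simp
  have h: "hcomp (span_double C) (dunit X i) (idcell (span_double C) (lob E i)) \<in> span_cells C"
    "hcomp (span_double C) (idcell (span_double C) (lob E i)) (dunit K i) \<in> span_cells C"
    using A by (auto intro!: hcomp_in)
  have m: "companion C (\<eta> i) \<in> spans C" using A by simp
  note r = inverse_runit_boundary[OF m]
  show ?case
    by (rule comp_unit_cell_unique[where f = "\<eta> i"])
       (use A h r in \<open>simp_all add: lloose_E dunit_X_simps lunit_boundary del: X_simps(6) lunit_simps\<close>)
next
  case (7 u i j v k)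
  then have A: "u \<in> Arr I" "v \<in> Arr I" "Cod I u = Dom I v" "i = Dom I u" "j = Dom I v" "k = Cod I v"
    by simp_all
  have sp: "companion C (far D u) \<in> spans C" "companion C (far D v) \<in> spans C"
    "companion C (\<eta> i) \<in> spans C" "companion C (\<eta> j) \<in> spans C" "companion C (\<eta> k) \<in> spans C"
    "span_unit C c \<in> spans C" using A by simp_all
  have h: "hcomp (span_double C) (dcomp X u v) (idcell (span_double C) (lob E k)) \<in> span_cells C"
    "hcomp (span_double C) (idcell (span_double C) (lob E i)) (dcomp K u v) \<in> span_cells C"
    "hcomp (span_double C) (lloose E u) (idcell (span_double C) (span_unit C c)) \<in> span_cells C"
    "hcomp (span_double C) (idcell (span_double C) (companion C (far D u))) (lloose E v) \<in> span_cells C"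
    using A by (auto intro!: hcomp_in simp: lloose_E dcomp_X_simps lunit_boundary simp del: X_simps(5) lunit_simps)
  have c1: "Cod C (rleg (companion C (\<eta> i))) = Cod C (lleg (span_unit C c))"
     "Cod C (rleg (span_unit C c)) = Cod C (lleg (span_unit C c))"
     "Cod C (rleg (companion C (far D u))) = Cod C (lleg (companion C (\<eta> j)))"
     "Cod C (rleg (companion C (\<eta> j))) = Cod C (lleg (span_unit C c))"
     "Cod C (rleg (companion C (far D u))) = Cod C (lleg (companion C (far D v)))"
     "Cod C (rleg (companion C (far D v))) = Cod C (lleg (companion C (\<eta> k)))"
    using A by simp_all
  note a1 = assoc_boundary[OF sp(3,6,6) c1(1,2)]
  note a2 = inverse_assoc_boundary[OF sp(1,4,6) c1(3,4)]
  note a3 = assoc_boundary[OF sp(1,2,5) c1(5,6)]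
  show ?case
    by (rule comp_unit_cell_unique[where f = "\<eta> (Dom I u)"])
       (use A h a1 a2 a3 in \<open>simp_all add: lloose_E dcomp_X_simps lunit_boundary del: X_simps(5) lunit_simps\<close>)
qed

end

theorem pseudo_double_category_spans:
  assumes "category C" "has_pullbacks C"
  shows "pseudo_double_category (span_double C)"
proof -
  interpret pullback_category C
    using assms by (simp add: pullback_category_def pullback_category_axioms_def)
  show ?thesis by (rule span_double_category)
qed

theorem companion_cocone_is_loose_cocone:
  assumes "category C" "has_pullbacks C" "category I" "is_functor I C D" "is_cocone I C D c \<eta>"
  shows "pseudo_double_functor (loose_double I) (span_double C) (companion_diagram I C D)"
    and "loose_cocone (loose_double I) (span_double C) (companion_diagram I C D) c
      (companion_cocone I C D c \<eta>)"
proof -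
  interpret pullback_category C
    using assms by (simp add: pullback_category_def pullback_category_axioms_def)
  interpret cocone_setup C I D c \<eta>
    using assms by (intro cocone_setup.intro companion_setup.intro)
      (simp_all add: pullback_category_axioms companion_setup_axioms_def cocone_setup_axioms_def)
  show "pseudo_double_functor (loose_double I) (span_double C) (companion_diagram I C D)"
    by (rule companion_diagram_functor)
  show "loose_cocone (loose_double I) (span_double C) (companion_diagram I C D) c
      (companion_cocone I C D c \<eta>)"
    by (simp add: loose_cocone_def companion_loose_cocone)
qed

end

theory Submission
  imports Defs
begin

text \<open>
A loose cocone \<open>\<theta>\<close> with vertex \<open>d\<close> under the companion diagram of \<open>D\<close> amounts to a
cartesian transformation together with an ordinary cocone.  Its components are spans \<open>D i \<leftarrow> E i \<rightarrow> d\<close> with legs \<open>\<alpha> i\<close> and \<open>\<beta> i\<close>, and its invertible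
cell at \<open>u : i \<rightarrow> j\<close> identifies the pullback of \<open>\<alpha> j\<close> along \<open>D u\<close> with \<open>E i\<close>.  Composing the inverse
of this identification with the projection to \<open>E j\<close> gives an arrow \<open>E u : E i \<rightarrow> E j\<close> that makes the
square over \<open>D u\<close> a pullback, and the unit and composition laws of the cells say that \<open>E\<close> is a functor
(\<open>unit_law_iff\<close>, \<open>comp_law_iff\<close>).  So loose cocones are the same as triples of a diagram \<open>E\<close>, a
cartesian transformation \<open>\<alpha> : E \<rightarrow> D\<close> and a cocone \<open>\<beta> : E \<rightarrow> d\<close>
(\<open>loose_transformation_presented\<close>, \<open>presented_loose_transformation_exists\<close>), and modifications
between them are natural families of arrows over \<open>D\<close> and over the right boundary
(\<open>modifications_iff\<close>).  Whiskering the companion cocone of \<open>\<eta>\<close> with a span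
\<open>c \<leftarrow> x \<rightarrow> d\<close> with legs \<open>h\<close> and \<open>g\<close> yields the pullbacks \<open>D i \<times>\<^sub>c x\<close> with the cocone that projects to \<open>x\<close> and
applies \<open>g\<close> (\<open>whisker_presented\<close>).

Call a cocone \<open>l : E \<rightarrow> x\<close> with an arrow \<open>h : x \<rightarrow> c\<close> a pullback cocone if all squares
\<open>h l\<^sub>i = \<eta>\<^sub>i \<alpha>\<^sub>i\<close> are pullbacks.  Under the dictionary, the two halves of the definition of a loose
colimit become statements about \<open>C\<close> alone.

  \<^item> Every cocone \<open>\<beta> : E \<rightarrow> d\<close> factors as \<open>g l\<close> for some pullback cocone \<open>l : E \<rightarrow> x\<close> and \<open>g : x \<rightarrow> d\<close>.

  \<^item> Let \<open>(l, h)\<close> be a pullback cocone of \<open>E\<close>, let \<open>l' : E \<rightarrow> x'\<close> be a cocone over \<open>h' : x' \<rightarrow> c\<close>, and let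
    \<open>g' l' = f g l\<close>.  Then there is exactly one \<open>k : x \<rightarrow> x'\<close> with \<open>h' k = h\<close>, \<open>g' k = f g\<close> and \<open>k l = l'\<close>.

These two statements are equivalent to the van Kampen property together with the existence of
colimits of all diagrams that are cartesian over \<open>D\<close>
(\<open>van_kampen_iff_spans_represent_cocones\<close>).  If \<open>\<eta>\<close> is van Kampen, a pullback cocone is a colimit, and
a colimit cocone of \<open>E\<close> is a pullback cocone, so both statements are instances of the universal property.
For the converse one has to see that a pullback cocone \<open>(l, h)\<close> is a colimit.  Given
\<open>\<beta> : E \<rightarrow> d\<close>, the first statement yields another pullback cocone \<open>(l', h')\<close> of \<open>E\<close> and \<open>g'\<close> with
\<open>g' l' = \<beta>\<close>.  There is no arrow to \<open>d\<close> out of \<open>x\<close> yet with which to compare the two; instead the second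
statement is applied to the spans with both legs \<open>h\<close> and both legs \<open>h'\<close>, whose right boundary is the
identity of \<open>c\<close>.  The resulting \<open>k\<close> has \<open>k l = l'\<close>, so \<open>g' k\<close> is the required factorisation.  If \<open>p l = q l\<close>,
the spans \<open>(h, q)\<close> and \<open>(h, p)\<close> give \<open>k\<close> with \<open>p k = q\<close>, \<open>h k = h\<close> and \<open>k l = l\<close>; by uniqueness for
the span \<open>(h, h)\<close> this \<open>k\<close> is the identity.
\<close>

section \<open>Pullback squares\<close>

context category
begin

lemma is_pullback_simps:
  assumes "is_pullback C f g p q"
  shows "f \<in> Arr C" "g \<in> Arr C" "p \<in> Arr C" "q \<in> Arr C" "Cod C g = Cod C f"
    "Dom C q = Dom C p" "Cod C p = Dom C f" "Cod C q = Dom C g" "f \<bullet> p = g \<bullet> q"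
  using assms by (auto simp: is_pullback_def commuting_square_def)

lemma pullback_lift:
  assumes "is_pullback C f g p q" "a \<in> Arr C" "b \<in> Arr C" "Dom C a = Dom C b"
    "Cod C a = Dom C f" "Cod C b = Dom C g" "f \<bullet> a = g \<bullet> b"
  obtains u where "u \<in> Arr C" "Dom C u = Dom C b" "Cod C u = Dom C p" "p \<bullet> u = a" "q \<bullet> u = b"
proof -
  have "commuting_square C f g a b"
    using assms by (auto simp: is_pullback_def commuting_square_def)
  with assms(1) obtain u where "u \<in> hom C (Dom C a) (Dom C p)" "p \<bullet> u = a" "q \<bullet> u = b"
    unfolding is_pullback_def by blast
  then show thesis using that assms(4) by (auto simp: hom_def)
qed

lemma pullback_jointly_monic:
  assumes pb: "is_pullback C f g p q" and uv: "u \<in> Arr C" "v \<in> Arr C" "Dom C u = Dom C v"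
    "Cod C u = Dom C p" "Cod C v = Dom C p" and eq: "p \<bullet> u = p \<bullet> v" "q \<bullet> u = q \<bullet> v"
  shows "u = v"
proof -
  note s = is_pullback_simps[OF pb]
  have "commuting_square C f g (p \<bullet> u) (q \<bullet> u)"
    using s uv by (simp add: commuting_square_def) (rule reassoc[OF s(9)], simp_all)
  with pb have "\<exists>!w. w \<in> hom C (Dom C (p \<bullet> u)) (Dom C p) \<and> p \<bullet> w = p \<bullet> u \<and> q \<bullet> w = q \<bullet> u"
    unfolding is_pullback_def by blast
  moreover have "u \<in> hom C (Dom C (p \<bullet> u)) (Dom C p)" "v \<in> hom C (Dom C (p \<bullet> u)) (Dom C p)"
    using s uv by (simp_all add: hom_def)
  ultimately show ?thesis using eq by metis
qed

lemma is_pullbackI: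
  assumes "f \<in> Arr C" "g \<in> Arr C" "p \<in> Arr C" "q \<in> Arr C" "Cod C f = Cod C g"
    "Dom C p = Dom C q" "Cod C p = Dom C f" "Cod C q = Dom C g" "f \<bullet> p = g \<bullet> q"
    and lift: "\<And>a b. \<lbrakk>a \<in> Arr C; b \<in> Arr C; Dom C a = Dom C b; Cod C a = Dom C f;
      Cod C b = Dom C g; f \<bullet> a = g \<bullet> b\<rbrakk>
      \<Longrightarrow> \<exists>u. u \<in> Arr C \<and> Dom C u = Dom C b \<and> Cod C u = Dom C p \<and> p \<bullet> u = a \<and> q \<bullet> u = b"
    and monic: "\<And>u v. \<lbrakk>u \<in> Arr C; v \<in> Arr C; Dom C u = Dom C v; Cod C u = Dom C p;
      Cod C v = Dom C p; p \<bullet> u = p \<bullet> v; q \<bullet> u = q \<bullet> v\<rbrakk> \<Longrightarrow> u = v"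
  shows "is_pullback C f g p q"
  unfolding is_pullback_def
proof (intro conjI allI impI)
  show "commuting_square C f g p q" using assms(1-9) by (simp add: commuting_square_def)
  fix a b assume "commuting_square C f g a b"
  then have ab: "a \<in> Arr C" "b \<in> Arr C" "Dom C a = Dom C b" "Cod C a = Dom C f"
    "Cod C b = Dom C g" "f \<bullet> a = g \<bullet> b"
    by (auto simp: commuting_square_def)
  from lift[OF ab] obtain u where
    u: "u \<in> Arr C" "Dom C u = Dom C b" "Cod C u = Dom C p" "p \<bullet> u = a" "q \<bullet> u = b" by blast
  show "\<exists>!u. u \<in> hom C (Dom C a) (Dom C p) \<and> p \<bullet> u = a \<and> q \<bullet> u = b"
  proof (rule ex1I[of _ u])
    show "u \<in> hom C (Dom C a) (Dom C p) \<and> p \<bullet> u = a \<and> q \<bullet> u = b"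
      using u ab(3) by (simp add: hom_def)
    show "w = u" if "w \<in> hom C (Dom C a) (Dom C p) \<and> p \<bullet> w = a \<and> q \<bullet> w = b" for w
      by (rule monic) (use that u ab(3) in \<open>auto simp: hom_def\<close>)
  qed
qed

lemma is_pullback_sym:
  assumes pb: "is_pullback C f g p q" shows "is_pullback C g f q p"
proof (rule is_pullbackI)
  note s = is_pullback_simps[OF pb]
  show "g \<in> Arr C" "f \<in> Arr C" "q \<in> Arr C" "p \<in> Arr C" "Cod C g = Cod C f" "Dom C q = Dom C p"
    "Cod C q = Dom C g" "Cod C p = Dom C f" "g \<bullet> q = f \<bullet> p"
    by (fact s s(9)[symmetric])+
  fix a b assume ab: "a \<in> Arr C" "b \<in> Arr C" "Dom C a = Dom C b" "Cod C a = Dom C g"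
    "Cod C b = Dom C f" "g \<bullet> a = f \<bullet> b"
  obtain u where "u \<in> Arr C" "Dom C u = Dom C a" "Cod C u = Dom C p" "p \<bullet> u = b" "q \<bullet> u = a"
    by (rule pullback_lift[OF pb ab(2,1) ab(3)[symmetric] ab(5,4) ab(6)[symmetric]])
  then show "\<exists>u. u \<in> Arr C \<and> Dom C u = Dom C b \<and> Cod C u = Dom C q \<and> q \<bullet> u = a \<and> p \<bullet> u = b"
    using ab(3) s(6) by metis
next
  note s = is_pullback_simps[OF pb]
  fix u v assume uv: "u \<in> Arr C" "v \<in> Arr C" "Dom C u = Dom C v" "Cod C u = Dom C q"
      "Cod C v = Dom C q" "q \<bullet> u = q \<bullet> v" "p \<bullet> u = p \<bullet> v"
  show "u = v"
    by (rule pullback_jointly_monic[OF pb uv(1-3) _ _ uv(7,6)]) (use uv(4,5) s(6) in simp_all)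
qed

lemma is_pullback_precomp_iso:
  assumes pb: "is_pullback C f g p q" and b: "inverse_arrows C b b'" "Cod C b = Dom C p"
  shows "is_pullback C f g (p \<bullet> b) (q \<bullet> b)"
proof -
  note s = is_pullback_simps[OF pb]
  have b [simp]: "b \<in> Arr C" "b' \<in> Arr C" "Cod C b = Dom C p" "Dom C b' = Dom C p"
    "Cod C b' = Dom C b" "b' \<bullet> b = Idt C (Dom C b)" "b \<bullet> b' = Idt C (Dom C p)"
    using b by (auto simp: inverse_arrows_def hom_def)
  show ?thesis
  proof (rule is_pullbackI)
    show "f \<bullet> p \<bullet> b = g \<bullet> q \<bullet> b" by (rule reassoc) (use s in simp_all)
  next
    fix x y assume xy: "x \<in> Arr C" "y \<in> Arr C" "Dom C x = Dom C y" "Cod C x = Dom C f"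
      "Cod C y = Dom C g" "f \<bullet> x = g \<bullet> y"
    from pullback_lift[OF pb xy] obtain u where
      u: "u \<in> Arr C" "Dom C u = Dom C y" "Cod C u = Dom C p" "p \<bullet> u = x" "q \<bullet> u = y" .
    have "b \<bullet> b' \<bullet> u = u" using reassoc1[of b b' "Idt C (Dom C p)" u] u by simp
    then show "\<exists>u. u \<in> Arr C \<and> Dom C u = Dom C y \<and> Cod C u = Dom C (p \<bullet> b) \<and>
        (p \<bullet> b) \<bullet> u = x \<and> (q \<bullet> b) \<bullet> u = y"
      using u s by (intro exI[of _ "b' \<bullet> u"]) simp
  next
    fix u v assume uv: "u \<in> Arr C" "v \<in> Arr C" "Dom C u = Dom C v" "Cod C u = Dom C (p \<bullet> b)"
      "Cod C v = Dom C (p \<bullet> b)" "(p \<bullet> b) \<bullet> u = (p \<bullet> b) \<bullet> v" "(q \<bullet> b) \<bullet> u = (q \<bullet> b) \<bullet> v"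
    have "b \<bullet> u = b \<bullet> v"
      by (rule pullback_jointly_monic[OF pb]) (use uv s in simp_all)
    then have "b' \<bullet> b \<bullet> u = b' \<bullet> b \<bullet> v" by simp
    moreover have "b' \<bullet> b \<bullet> w = w" if "w \<in> Arr C" "Cod C w = Dom C b" for w
      using reassoc1[of b' b "Idt C (Dom C b)" w] that by simp
    ultimately show "u = v" using uv s by simp
  qed (use s in simp_all)
qed

lemma pullback_comparison_iso:
  assumes pb: "is_pullback C f g p q" and pb': "is_pullback C f g p' q'"
  obtains b b' where "inverse_arrows C b b'" "Dom C b = Dom C p'" "Cod C b = Dom C p"
    "p \<bullet> b = p'" "q \<bullet> b = q'" "p' \<bullet> b' = p" "q' \<bullet> b' = q"
proof -
  note s = is_pullback_simps[OF pb] and s' = is_pullback_simps[OF pb']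
  obtain b where b: "b \<in> Arr C" "Dom C b = Dom C q'" "Cod C b = Dom C p" "p \<bullet> b = p'" "q \<bullet> b = q'"
    by (rule pullback_lift[OF pb, of p' q']) (use s s' in simp_all)
  obtain b' where b': "b' \<in> Arr C" "Dom C b' = Dom C q" "Cod C b' = Dom C p'" "p' \<bullet> b' = p" "q' \<bullet> b' = q"
    by (rule pullback_lift[OF pb', of p q]) (use s s' in simp_all)
  have r: "p \<bullet> b \<bullet> z = p' \<bullet> z" "q \<bullet> b \<bullet> z = q' \<bullet> z" if "z \<in> Arr C" "Cod C z = Dom C p'" for z
    using reassoc1[OF b(4)] reassoc1[OF b(5)] b s s' that by simp_all
  have r': "p' \<bullet> b' \<bullet> z = p \<bullet> z" "q' \<bullet> b' \<bullet> z = q \<bullet> z" if "z \<in> Arr C" "Cod C z = Dom C p" for z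
    using reassoc1[OF b'(4)] reassoc1[OF b'(5)] b' s s' that by simp_all
  have "b \<bullet> b' = Idt C (Dom C p)"
    by (rule pullback_jointly_monic[OF pb]) (use s s' b b' in \<open>simp_all add: r\<close>)
  moreover have "b' \<bullet> b = Idt C (Dom C p')"
    by (rule pullback_jointly_monic[OF pb']) (use s s' b b' in \<open>simp_all add: r'\<close>)
  ultimately have "inverse_arrows C b b'"
    using b b' s s' by (auto simp: inverse_arrows_def hom_def)
  then show thesis using that b b' s s' by simp
qed

text \<open>Pasting of pullbacks.  With \<open>f = \<eta> j\<close> and \<open>w = D u\<close> it shows that the pullbacks of an arrow \<open>h\<close> along
the \<open>\<eta> i\<close> form a diagram that is cartesian over \<open>D\<close>.\<close>

lemma is_pullback_left_cancel:
  assumes right: "is_pullback C f h p q" and outer: "is_pullback C (f \<bullet> w) h p' q'"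
    and w: "w \<in> Arr C" "Cod C w = Dom C f"
    and e: "e \<in> Arr C" "Dom C e = Dom C p'" "Cod C e = Dom C p" "p \<bullet> e = w \<bullet> p'" "q \<bullet> e = q'"
  shows "is_pullback C w p p' e"
proof (rule is_pullbackI)
  note s = is_pullback_simps[OF right] and s' = is_pullback_simps[OF outer]
  fix a b assume ab: "a \<in> Arr C" "b \<in> Arr C" "Dom C a = Dom C b" "Cod C a = Dom C w"
    "Cod C b = Dom C p" "w \<bullet> a = p \<bullet> b"
  have "f \<bullet> w \<bullet> a = h \<bullet> q \<bullet> b"
    unfolding ab(6) by (rule reassoc[OF s(9)]) (use s ab in simp_all)
  then obtain u where u: "u \<in> Arr C" "Dom C u = Dom C b" "Cod C u = Dom C p'" "p' \<bullet> u = a"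
    "q' \<bullet> u = q \<bullet> b"
    by (rule_tac pullback_lift[OF outer, of a "q \<bullet> b"]) (use s w ab in simp_all)
  have peu: "p \<bullet> e \<bullet> u = w \<bullet> p' \<bullet> u" by (rule reassoc[OF e(4)]) (use s s' u e w in simp_all)
  have qeu: "q \<bullet> e \<bullet> u = q' \<bullet> u" by (rule reassoc1[OF e(5)]) (use s s' u e w in simp_all)
  have "e \<bullet> u = b"
    by (rule pullback_jointly_monic[OF right]) (use s e u ab peu qeu in simp_all)
  then show "\<exists>u. u \<in> Arr C \<and> Dom C u = Dom C b \<and> Cod C u = Dom C p' \<and> p' \<bullet> u = a \<and> e \<bullet> u = b"
    using u by blast
next
  note s = is_pullback_simps[OF right] and s' = is_pullback_simps[OF outer]
  fix u v assume uv: "u \<in> Arr C" "v \<in> Arr C" "Dom C u = Dom C v" "Cod C u = Dom C p'"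
      "Cod C v = Dom C p'" "p' \<bullet> u = p' \<bullet> v" "e \<bullet> u = e \<bullet> v"
  have "q \<bullet> e \<bullet> u = q' \<bullet> u" "q \<bullet> e \<bullet> v = q' \<bullet> v"
    using uv(1-5) s s' e w by (simp_all add: reassoc1[OF e(5)])
  then have "q' \<bullet> u = q' \<bullet> v" using uv(7) by simp
  then show "u = v" by (rule pullback_jointly_monic[OF outer uv(1-6)])
qed (use is_pullback_simps[OF right] is_pullback_simps[OF outer] w e in simp_all)

text \<open>Any colimit of a diagram is isomorphic to one whose squares are known to be pullbacks; this lemma
carries the pullback property along that isomorphism of vertices.\<close>

lemma is_pullback_transport_apex:
  assumes pb: "is_pullback C h2 n l2 a" and b: "inverse_arrows C b b'" "Dom C b = x" "Cod C b = Dom C h2"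
    and h: "h2 \<bullet> b = h" and l: "l \<in> Arr C" "Cod C l = x" "b \<bullet> l = l2"
  shows "is_pullback C h n l a"
proof -
  note s = is_pullback_simps[OF pb]
  have b [simp]: "b \<in> Arr C" "b' \<in> Arr C" "Dom C b = x" "Cod C b = Dom C h2" "Dom C b' = Dom C h2"
    "Cod C b' = x" "b' \<bullet> b = Idt C x" "b \<bullet> b' = Idt C (Dom C h2)"
    using b by (auto simp: inverse_arrows_def hom_def)
  have b'b: "b' \<bullet> b \<bullet> z = z" if "z \<in> Arr C" "Cod C z = x" for z
    using reassoc1[of b' b "Idt C x" z] that by simp
  have dl: "Dom C l = Dom C l2" using l by auto
  have hz: "h \<bullet> z = h2 \<bullet> b \<bullet> z" if "z \<in> Arr C" "Cod C z = x" for z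
    using that s b by (simp flip: h)
  have lz: "b \<bullet> l \<bullet> z = l2 \<bullet> z" if "z \<in> Arr C" "Cod C z = Dom C l2" for z
    by (rule reassoc1[OF l(3)]) (use l that dl in simp_all)
  have hA: "h \<in> Arr C" "Dom C h = x" "Cod C h = Cod C h2" using s b by (simp_all flip: h)
  show ?thesis
  proof (rule is_pullbackI)
    show "h \<bullet> l = n \<bullet> a" using hz[OF l(1,2)] l s by simp
  next
    fix y z assume yz: "y \<in> Arr C" "z \<in> Arr C" "Dom C y = Dom C z" "Cod C y = Dom C h"
      "Cod C z = Dom C n" "h \<bullet> y = n \<bullet> z"
    have "h2 \<bullet> b \<bullet> y = n \<bullet> z" using yz hz hA by simp
    then obtain u where u: "u \<in> Arr C" "Dom C u = Dom C z" "Cod C u = Dom C l2"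
      "l2 \<bullet> u = b \<bullet> y" "a \<bullet> u = z"
      using yz hA by (elim pullback_lift[OF pb, rotated -1]) simp_all
    have "b' \<bullet> b \<bullet> l \<bullet> u = b' \<bullet> b \<bullet> y" using lz u by simp
    then have "l \<bullet> u = y" using b'b u yz hA l dl by simp
    then show "\<exists>u. u \<in> Arr C \<and> Dom C u = Dom C z \<and> Cod C u = Dom C l \<and> l \<bullet> u = y \<and> a \<bullet> u = z"
      using u dl by metis
  next
    fix u v assume uv: "u \<in> Arr C" "v \<in> Arr C" "Dom C u = Dom C v" "Cod C u = Dom C l"
      "Cod C v = Dom C l" "l \<bullet> u = l \<bullet> v" "a \<bullet> u = a \<bullet> v"
    have "l2 \<bullet> u = l2 \<bullet> v" using lz[of u] lz[of v] uv dl by simp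
    then show "u = v"
      using pullback_jointly_monic[OF pb uv(1-3) _ _ _ uv(7)] uv(4,5) dl by simp
  qed (use s hA l dl in simp_all)
qed

end

section \<open>Van Kampen colimits and representation of cocones by spans\<close>

definition pullback_cocone ::
  "('i, 'j) cat \<Rightarrow> ('o, 'a) cat \<Rightarrow> ('i, 'j, 'o, 'a) ftor \<Rightarrow> 'o \<Rightarrow> ('i \<Rightarrow> 'a)
     \<Rightarrow> ('i, 'j, 'o, 'a) ftor \<Rightarrow> ('i \<Rightarrow> 'a) \<Rightarrow> 'o \<Rightarrow> ('i \<Rightarrow> 'a) \<Rightarrow> 'a \<Rightarrow> bool" where
  "pullback_cocone I C D c \<eta> E \<alpha> x l h \<longleftrightarrow>
     is_functor I C E \<and> cartesian_transformation I C E D \<alpha> \<and> is_cocone I C E x l \<and>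
     h \<in> hom C x c \<and> (\<forall>i\<in>Obj I. is_pullback C h (\<eta> i) (l i) (\<alpha> i))"

text \<open>Essential surjectivity of the map from spans to loose cocones, stated in \<open>C\<close>: \<open>h\<close> and \<open>g\<close> are the legs
of the span.\<close>

definition cocones_factor_through_pullbacks ::
  "('i, 'j) cat \<Rightarrow> ('o, 'a) cat \<Rightarrow> ('i, 'j, 'o, 'a) ftor \<Rightarrow> 'o \<Rightarrow> ('i \<Rightarrow> 'a) \<Rightarrow> bool" where
  "cocones_factor_through_pullbacks I C D c \<eta> \<longleftrightarrow>
     (\<forall>E \<alpha> d \<beta>. is_functor I C E \<and> cartesian_transformation I C E D \<alpha> \<and> is_cocone I C E d \<beta> \<longrightarrow>
        (\<exists>x l h g. pullback_cocone I C D c \<eta> E \<alpha> x l h \<and> g \<in> hom C x d \<and>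
           (\<forall>i\<in>Obj I. g \<bullet>\<^bsub>C\<^esub> l i = \<beta> i)))"

text \<open>Full faithfulness of the map from spans to loose cocones, stated in \<open>C\<close>: \<open>k\<close> is a cell from the span
\<open>(h, g)\<close> to \<open>(h', g')\<close> with right boundary \<open>f\<close>.  The family \<open>l'\<close> is any cocone over \<open>h'\<close>, because an arrow
over \<open>D i\<close> into the pullback of \<open>h'\<close> along \<open>\<eta> i\<close> amounts to an arrow into \<open>x'\<close> that is compatible with \<open>h'\<close>
and \<open>\<eta> i\<close>.\<close>

definition pullback_cocones_fully_faithful ::
  "('i, 'j) cat \<Rightarrow> ('o, 'a) cat \<Rightarrow> ('i, 'j, 'o, 'a) ftor \<Rightarrow> 'o \<Rightarrow> ('i \<Rightarrow> 'a) \<Rightarrow> bool" where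
  "pullback_cocones_fully_faithful I C D c \<eta> \<longleftrightarrow>
     (\<forall>E \<alpha> x l h x' l' h' d d' g g' f.
        pullback_cocone I C D c \<eta> E \<alpha> x l h \<and> is_cocone I C E x' l' \<and> h' \<in> hom C x' c \<and>
        (\<forall>i\<in>Obj I. h' \<bullet>\<^bsub>C\<^esub> l' i = \<eta> i \<bullet>\<^bsub>C\<^esub> \<alpha> i) \<and>
        g \<in> hom C x d \<and> g' \<in> hom C x' d' \<and> f \<in> hom C d d' \<and>
        (\<forall>i\<in>Obj I. g' \<bullet>\<^bsub>C\<^esub> l' i = f \<bullet>\<^bsub>C\<^esub> g \<bullet>\<^bsub>C\<^esub> l i) \<longrightarrow>
        (\<exists>!k. k \<in> hom C x x' \<and> h' \<bullet>\<^bsub>C\<^esub> k = h \<and> g' \<bullet>\<^bsub>C\<^esub> k = f \<bullet>\<^bsub>C\<^esub> g \<and>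
           (\<forall>i\<in>Obj I. k \<bullet>\<^bsub>C\<^esub> l i = l' i)))"

locale base_cocone = category C + I: category I
  for C :: "('o, 'a) cat" (structure) and I :: "('i, 'j) cat" +
  fixes D :: "('i, 'j, 'o, 'a) ftor" and c :: 'o and \<eta> :: "'i \<Rightarrow> 'a"
  assumes base_cocone: "is_cocone I C D c \<eta>"
begin

lemma cocone_postcomp:
  assumes "is_functor I C E" "is_cocone I C E x l" "g \<in> hom C x d"
  shows "is_cocone I C E d (\<lambda>i. g \<bullet>\<^bsub>C\<^esub> l i)"
proof -
  have "(g \<bullet>\<^bsub>C\<^esub> l (Cod I u)) \<bullet>\<^bsub>C\<^esub> far E u = g \<bullet>\<^bsub>C\<^esub> l (Dom I u)" if "u \<in> Arr I" for u
    using assms that Comp_assoc[of "far E u" _ _ "l (Cod I u)" x g d]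
    by (auto simp: is_functor_def is_cocone_def)
  then show ?thesis using assms by (auto simp: is_cocone_def hom_def)
qed

lemma cocone_precomp:
  assumes E: "is_functor I C E" and \<alpha>: "cartesian_transformation I C E D \<alpha>"
  shows "is_cocone I C E c (\<lambda>i. \<eta> i \<bullet>\<^bsub>C\<^esub> \<alpha> i)"
  unfolding is_cocone_def
proof (intro conjI ballI)
  show "c \<in> Obj C" using base_cocone by (simp add: is_cocone_def)
next
  fix i assume "i \<in> Obj I"
  then show "\<eta> i \<bullet>\<^bsub>C\<^esub> \<alpha> i \<in> hom C (fob E i) c"
    using base_cocone \<alpha> Comp_hom by (auto simp: is_cocone_def cartesian_transformation_def)
next
  fix u assume u: "u \<in> Arr I"
  have pb: "is_pullback C (far D u) (\<alpha> (Cod I u)) (\<alpha> (Dom I u)) (far E u)"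
    using \<alpha> u by (simp add: cartesian_transformation_def)
  note s = is_pullback_simps[OF pb]
  have h: "\<eta> (Cod I u) \<in> Arr C" "\<eta> (Cod I u) \<bullet>\<^bsub>C\<^esub> far D u = \<eta> (Dom I u)"
    "Dom C (\<eta> (Cod I u)) = fob D (Cod I u)"
    "\<alpha> (Cod I u) \<in> hom C (fob E (Cod I u)) (fob D (Cod I u))"
    using base_cocone \<alpha> u by (auto simp: is_cocone_def cartesian_transformation_def hom_def)
  have "(\<eta> (Cod I u) \<bullet>\<^bsub>C\<^esub> \<alpha> (Cod I u)) \<bullet>\<^bsub>C\<^esub> far E u = \<eta> (Cod I u) \<bullet>\<^bsub>C\<^esub> (far D u \<bullet>\<^bsub>C\<^esub> \<alpha> (Dom I u))"
    using s h by (simp add: hom_def)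
  also have "\<dots> = \<eta> (Dom I u) \<bullet>\<^bsub>C\<^esub> \<alpha> (Dom I u)"
    by (rule reassoc1) (use s h in \<open>simp_all add: hom_def\<close>)
  finally show "(\<eta> (Cod I u) \<bullet>\<^bsub>C\<^esub> \<alpha> (Cod I u)) \<bullet>\<^bsub>C\<^esub> far E u = \<eta> (Dom I u) \<bullet>\<^bsub>C\<^esub> \<alpha> (Dom I u)" .
qed

lemma colimit_map:
  assumes "colimit_cocone I C E x l" "is_cocone I C E d \<beta>"
  obtains g where "g \<in> hom C x d" "\<And>i. i \<in> Obj I \<Longrightarrow> g \<bullet>\<^bsub>C\<^esub> l i = \<beta> i"
  using assms unfolding colimit_cocone_def by blast

lemma colimit_map_eqI:
  assumes "is_functor I C E" "colimit_cocone I C E x l" "p \<in> hom C x d" "q \<in> hom C x d"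
    "\<And>i. i \<in> Obj I \<Longrightarrow> p \<bullet>\<^bsub>C\<^esub> l i = q \<bullet>\<^bsub>C\<^esub> l i"
  shows "p = q"
proof -
  have "is_cocone I C E d (\<lambda>i. q \<bullet>\<^bsub>C\<^esub> l i)"
    using assms cocone_postcomp unfolding colimit_cocone_def by blast
  then have "\<exists>!h. h \<in> hom C x d \<and> (\<forall>i\<in>Obj I. h \<bullet>\<^bsub>C\<^esub> l i = q \<bullet>\<^bsub>C\<^esub> l i)"
    using assms(2) unfolding colimit_cocone_def by blast
  then show ?thesis using assms(3-5) by metis
qed

lemma pullback_coconeD:
  assumes "pullback_cocone I C D c \<eta> E \<alpha> x l h"
  shows "is_functor I C E" "cartesian_transformation I C E D \<alpha>" "is_cocone I C E x l"
    "h \<in> hom C x c" "i \<in> Obj I \<Longrightarrow> is_pullback C h (\<eta> i) (l i) (\<alpha> i)"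
    "i \<in> Obj I \<Longrightarrow> h \<bullet>\<^bsub>C\<^esub> l i = \<eta> i \<bullet>\<^bsub>C\<^esub> \<alpha> i" "i \<in> Obj I \<Longrightarrow> l i \<in> hom C (fob E i) x"
    "x \<in> Obj C"
  using assms is_pullback_simps(9)
  by (auto simp: pullback_cocone_def is_cocone_def)

text \<open>The pullback cocone is a colimit of \<open>E\<close>, which has pullback squares by the van Kampen property; \<open>h\<close>
and \<open>g\<close> are the factorisations of \<open>\<eta> \<alpha>\<close> and \<open>\<beta>\<close>.\<close>

lemma van_kampen_imp_cocones_factor:
  assumes vk: "van_kampen I C D c \<eta>" and cc: "cartesian_colimits I C D"
  shows "cocones_factor_through_pullbacks I C D c \<eta>"
  unfolding cocones_factor_through_pullbacks_def
proof (intro allI impI, elim conjE)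
  fix E \<alpha> d \<beta>
  assume E: "is_functor I C E" and \<alpha>: "cartesian_transformation I C E D \<alpha>"
    and \<beta>: "is_cocone I C E d \<beta>"
  obtain x l where col: "colimit_cocone I C E x l"
    using cc E \<alpha> unfolding cartesian_colimits_def by blast
  obtain h where h: "h \<in> hom C x c" "\<And>i. i \<in> Obj I \<Longrightarrow> h \<bullet>\<^bsub>C\<^esub> l i = \<eta> i \<bullet>\<^bsub>C\<^esub> \<alpha> i"
    using colimit_map[OF col cocone_precomp[OF E \<alpha>]] by blast
  obtain g where g: "g \<in> hom C x d" "\<And>i. i \<in> Obj I \<Longrightarrow> g \<bullet>\<^bsub>C\<^esub> l i = \<beta> i"
    using colimit_map[OF col \<beta>] by blast
  have l: "is_cocone I C E x l" using col by (simp add: colimit_cocone_def)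
  have "\<forall>i\<in>Obj I. is_pullback C h (\<eta> i) (l i) (\<alpha> i)"
    using vk E \<alpha> l h col unfolding van_kampen_def by blast
  then have "pullback_cocone I C D c \<eta> E \<alpha> x l h"
    using E \<alpha> l h by (simp add: pullback_cocone_def)
  then show "\<exists>x l h g. pullback_cocone I C D c \<eta> E \<alpha> x l h \<and> g \<in> hom C x d \<and>
      (\<forall>i\<in>Obj I. g \<bullet>\<^bsub>C\<^esub> l i = \<beta> i)"
    using g by blast
qed

text \<open>A pullback cocone is a colimit, so \<open>k\<close> is the arrow induced by \<open>l'\<close>, and the equations with \<open>h'\<close> and \<open>g'\<close>
hold because they hold after composition with \<open>l\<close>.\<close>

lemma van_kampen_imp_fully_faithful:
  assumes vk: "van_kampen I C D c \<eta>"
  shows "pullback_cocones_fully_faithful I C D c \<eta>"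
  unfolding pullback_cocones_fully_faithful_def
proof (intro allI impI, elim conjE)
  fix E \<alpha> x l h x' l' h' d d' g g' f
  assume pc: "pullback_cocone I C D c \<eta> E \<alpha> x l h" and l': "is_cocone I C E x' l'"
    and h': "h' \<in> hom C x' c" "\<forall>i\<in>Obj I. h' \<bullet>\<^bsub>C\<^esub> l' i = \<eta> i \<bullet>\<^bsub>C\<^esub> \<alpha> i"
    and g: "g \<in> hom C x d" "g' \<in> hom C x' d'" "f \<in> hom C d d'"
      "\<forall>i\<in>Obj I. g' \<bullet>\<^bsub>C\<^esub> l' i = f \<bullet>\<^bsub>C\<^esub> g \<bullet>\<^bsub>C\<^esub> l i"
  note p = pullback_coconeD[OF pc]
  have col: "colimit_cocone I C E x l"
    using vk p(1-6) unfolding van_kampen_def by blast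
  obtain k where k: "k \<in> hom C x x'" "\<And>i. i \<in> Obj I \<Longrightarrow> k \<bullet>\<^bsub>C\<^esub> l i = l' i"
    using colimit_map[OF col l'] by blast
  have "h' \<bullet>\<^bsub>C\<^esub> k = h"
  proof (rule colimit_map_eqI[OF p(1) col])
    show "(h' \<bullet>\<^bsub>C\<^esub> k) \<bullet>\<^bsub>C\<^esub> l i = h \<bullet>\<^bsub>C\<^esub> l i" if "i \<in> Obj I" for i
      using that Comp_assoc[OF p(7) k(1) h'(1)] k(2) h'(2) p(6) by simp
  qed (use k h' p(4) in \<open>auto intro: Comp_hom\<close>)
  moreover have "g' \<bullet>\<^bsub>C\<^esub> k = f \<bullet>\<^bsub>C\<^esub> g"
  proof (rule colimit_map_eqI[OF p(1) col])
    show "(g' \<bullet>\<^bsub>C\<^esub> k) \<bullet>\<^bsub>C\<^esub> l i = (f \<bullet>\<^bsub>C\<^esub> g) \<bullet>\<^bsub>C\<^esub> l i" if "i \<in> Obj I" for i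
      using that Comp_assoc[OF p(7) k(1) g(2)] Comp_assoc[OF p(7) g(1,3)] k(2) g(4) by simp
  qed (use k g in \<open>auto intro: Comp_hom\<close>)
  ultimately show "\<exists>!k. k \<in> hom C x x' \<and> h' \<bullet>\<^bsub>C\<^esub> k = h \<and> g' \<bullet>\<^bsub>C\<^esub> k = f \<bullet>\<^bsub>C\<^esub> g \<and>
           (\<forall>i\<in>Obj I. k \<bullet>\<^bsub>C\<^esub> l i = l' i)"
    using k colimit_map_eqI[OF p(1) col] by (intro ex1I[of _ k]) auto
qed

text \<open>Spans whose two legs are equal to the projection to \<open>c\<close> have identity right boundary, so full
faithfulness compares two pullback cocones of the same \<open>E\<close> without reference to \<open>d\<close>.  Full faithfulness for
spans with distinct right legs then gives uniqueness of the factorisation.\<close>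

lemma pullback_cocone_colimit:
  assumes fac: "cocones_factor_through_pullbacks I C D c \<eta>"
    and ff: "pullback_cocones_fully_faithful I C D c \<eta>"
    and pc: "pullback_cocone I C D c \<eta> E \<alpha> x l h"
  shows "colimit_cocone I C E x l"
  unfolding colimit_cocone_def
proof (intro conjI allI impI)
  note p = pullback_coconeD[OF pc]
  show "is_cocone I C E x l" by (rule p)
  fix d \<beta> assume \<beta>: "is_cocone I C E d \<beta>"
  have c: "Idt C c \<in> hom C c c" "c \<in> Obj C"
    using base_cocone Idt_hom by (auto simp: is_cocone_def)
  have d: "Idt C d \<in> hom C d d" using \<beta> Idt_hom by (auto simp: is_cocone_def)
  have idc: "Idt C c \<bullet>\<^bsub>C\<^esub> y = y" if "y \<in> hom C z c" for y z
    using that by (auto simp: hom_def)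
  have idd: "Idt C d \<bullet>\<^bsub>C\<^esub> y = y" if "y \<in> hom C z d" for y z
    using that by (auto simp: hom_def)
  have descent: "\<exists>!k. k \<in> hom C x x' \<and> h' \<bullet>\<^bsub>C\<^esub> k = h \<and> g' \<bullet>\<^bsub>C\<^esub> k = f \<bullet>\<^bsub>C\<^esub> g \<and>
      (\<forall>i\<in>Obj I. k \<bullet>\<^bsub>C\<^esub> l i = l' i)"
    if "is_cocone I C E x' l'" "h' \<in> hom C x' c" "\<forall>i\<in>Obj I. h' \<bullet>\<^bsub>C\<^esub> l' i = \<eta> i \<bullet>\<^bsub>C\<^esub> \<alpha> i"
      "g \<in> hom C x d1" "g' \<in> hom C x' d2" "f \<in> hom C d1 d2"
      "\<forall>i\<in>Obj I. g' \<bullet>\<^bsub>C\<^esub> l' i = f \<bullet>\<^bsub>C\<^esub> g \<bullet>\<^bsub>C\<^esub> l i" for x' l' h' d1 d2 g g' f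
    using ff pc that unfolding pullback_cocones_fully_faithful_def by blast
  obtain x2 l2 h2 g2 where p2: "pullback_cocone I C D c \<eta> E \<alpha> x2 l2 h2"
    and g2: "g2 \<in> hom C x2 d" "\<And>i. i \<in> Obj I \<Longrightarrow> g2 \<bullet>\<^bsub>C\<^esub> l2 i = \<beta> i"
    using fac p(1,2) \<beta> unfolding cocones_factor_through_pullbacks_def by blast
  note p2 = pullback_coconeD[OF p2]
  have hl: "Idt C c \<bullet>\<^bsub>C\<^esub> h \<bullet>\<^bsub>C\<^esub> l i = h \<bullet>\<^bsub>C\<^esub> l i" if "i \<in> Obj I" for i
    using idc Comp_hom[OF p(7)[OF that] p(4)] by blast
  have h1: "Idt C c \<bullet>\<^bsub>C\<^esub> h = h" using idc p(4) by blast
  have 1: "\<forall>i\<in>Obj I. h2 \<bullet>\<^bsub>C\<^esub> l2 i = \<eta> i \<bullet>\<^bsub>C\<^esub> \<alpha> i"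
    and 2: "\<forall>i\<in>Obj I. h2 \<bullet>\<^bsub>C\<^esub> l2 i = Idt C c \<bullet>\<^bsub>C\<^esub> h \<bullet>\<^bsub>C\<^esub> l i"
    and 3: "\<forall>i\<in>Obj I. h \<bullet>\<^bsub>C\<^esub> l i = \<eta> i \<bullet>\<^bsub>C\<^esub> \<alpha> i"
    and 4: "\<forall>i\<in>Obj I. h \<bullet>\<^bsub>C\<^esub> l i = Idt C c \<bullet>\<^bsub>C\<^esub> h \<bullet>\<^bsub>C\<^esub> l i"
    using p(6) p2(6) hl by simp_all
  \<comment> \<open>the spans \<open>(h, h)\<close> and \<open>(h2, h2)\<close>, with right boundary the identity of \<open>c\<close>\<close>
  obtain k where k: "k \<in> hom C x x2" "\<And>i. i \<in> Obj I \<Longrightarrow> k \<bullet>\<^bsub>C\<^esub> l i = l2 i"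
    using ex1_implies_ex[OF descent[OF p2(3,4) 1 p(4) p2(4) c(1) 2]] by blast
  define g where "g = g2 \<bullet>\<^bsub>C\<^esub> k"
  have g: "g \<in> hom C x d" "\<forall>i\<in>Obj I. g \<bullet>\<^bsub>C\<^esub> l i = \<beta> i"
    using Comp_hom[OF k(1) g2(1)] Comp_assoc[OF p(7) k(1) g2(1)] k(2) g2(2)
    by (simp_all add: g_def)
  have uniq: "q = g" if q: "q \<in> hom C x d" "\<forall>i\<in>Obj I. q \<bullet>\<^bsub>C\<^esub> l i = \<beta> i" for q
  proof -
    have "\<forall>i\<in>Obj I. g \<bullet>\<^bsub>C\<^esub> l i = Idt C d \<bullet>\<^bsub>C\<^esub> q \<bullet>\<^bsub>C\<^esub> l i"
      using g q \<beta> by (auto simp: is_cocone_def hom_def)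
    \<comment> \<open>the spans \<open>(h, q)\<close> and \<open>(h, g)\<close>, with right boundary the identity of \<open>d\<close>\<close>
    from ex1_implies_ex[OF descent[OF p(3,4) 3 q(1) g(1) d this]]
    obtain k where k: "k \<in> hom C x x" "h \<bullet>\<^bsub>C\<^esub> k = h" "g \<bullet>\<^bsub>C\<^esub> k = q" "\<forall>i\<in>Obj I. k \<bullet>\<^bsub>C\<^esub> l i = l i"
      unfolding idd[OF q(1)] by blast
    have one: "Idt C x \<in> hom C x x" "h \<bullet>\<^bsub>C\<^esub> Idt C x = h" "g \<bullet>\<^bsub>C\<^esub> Idt C x = g"
        "\<forall>i\<in>Obj I. Idt C x \<bullet>\<^bsub>C\<^esub> l i = l i"
      using p(4,7,8) g Idt_hom by (auto simp: hom_def)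
    \<comment> \<open>both are endomorphisms of the span \<open>(h, h)\<close> that fix the cocone \<open>l\<close>\<close>
    have "k = Idt C x"
      using descent[OF p(3,4) 3 p(4) p(4) c(1) 4] k one unfolding h1 by blast
    then show "q = g" using k(3) one(3) by simp
  qed
  show "\<exists>!h. h \<in> hom C x d \<and> (\<forall>i\<in>Obj I. h \<bullet>\<^bsub>C\<^esub> l i = \<beta> i)"
    by (rule ex1I[of _ g]; use g uniq in blast)
qed

text \<open>For the converse, factoring the cocone \<open>\<eta> \<alpha>\<close> gives every cartesian \<open>E\<close> a pullback cocone, which is a
colimit.  Every other colimit cocone is isomorphic to this one, hence also has pullback squares.\<close>

theorem van_kampen_iff_spans_represent_cocones:
  "van_kampen I C D c \<eta> \<and> cartesian_colimits I C D \<longleftrightarrow>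
     cocones_factor_through_pullbacks I C D c \<eta> \<and> pullback_cocones_fully_faithful I C D c \<eta>"
    (is "?vk \<longleftrightarrow> ?fac \<and> ?ff")
proof
  assume ?vk then show "?fac \<and> ?ff"
    using van_kampen_imp_cocones_factor van_kampen_imp_fully_faithful by blast
next
  assume asm: "?fac \<and> ?ff"
  then have col: "colimit_cocone I C E x l" if "pullback_cocone I C D c \<eta> E \<alpha> x l h" for E \<alpha> x l h
    using that pullback_cocone_colimit by blast
  have ex: "\<exists>x l h. pullback_cocone I C D c \<eta> E \<alpha> x l h"
    if "is_functor I C E" "cartesian_transformation I C E D \<alpha>" for E \<alpha>
    using asm that cocone_precomp[OF that]
    unfolding cocones_factor_through_pullbacks_def by blast
  have "cartesian_colimits I C D"
    unfolding cartesian_colimits_def using ex col by blast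
  moreover have "van_kampen I C D c \<eta>"
    unfolding van_kampen_def
  proof (intro allI impI, elim conjE)
    fix E \<alpha> x l h
    assume E: "is_functor I C E" and \<alpha>: "cartesian_transformation I C E D \<alpha>"
      and l: "is_cocone I C E x l" and h: "h \<in> hom C x c"
        "\<forall>i\<in>Obj I. h \<bullet>\<^bsub>C\<^esub> l i = \<eta> i \<bullet>\<^bsub>C\<^esub> \<alpha> i"
    show "colimit_cocone I C E x l \<longleftrightarrow> (\<forall>i\<in>Obj I. is_pullback C h (\<eta> i) (l i) (\<alpha> i))"
    proof
      assume "\<forall>i\<in>Obj I. is_pullback C h (\<eta> i) (l i) (\<alpha> i)"
      then show "colimit_cocone I C E x l"
        using E \<alpha> l h by (intro col[of E \<alpha> x l h]) (simp add: pullback_cocone_def)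
    next
      assume xl: "colimit_cocone I C E x l"
      obtain x2 l2 h2 where "pullback_cocone I C D c \<eta> E \<alpha> x2 l2 h2" using ex[OF E \<alpha>] by blast
      note xl2 = col[OF this] and p2 = pullback_coconeD[OF this]
      have li: "l i \<in> hom C (fob E i) x" if "i \<in> Obj I" for i using l that by (simp add: is_cocone_def)
      obtain b where b: "b \<in> hom C x x2" "\<And>i. i \<in> Obj I \<Longrightarrow> b \<bullet>\<^bsub>C\<^esub> l i = l2 i"
        using colimit_map[OF xl p2(3)] by blast
      obtain b' where b': "b' \<in> hom C x2 x" "\<And>i. i \<in> Obj I \<Longrightarrow> b' \<bullet>\<^bsub>C\<^esub> l2 i = l i"
        using colimit_map[OF xl2 l] by blast
      have x: "x \<in> Obj C" using l by (simp add: is_cocone_def)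
      have "b' \<bullet>\<^bsub>C\<^esub> b = Idt C x"
      proof (rule colimit_map_eqI[OF E xl])
        show "(b' \<bullet>\<^bsub>C\<^esub> b) \<bullet>\<^bsub>C\<^esub> l i = Idt C x \<bullet>\<^bsub>C\<^esub> l i" if "i \<in> Obj I" for i
          using Comp_assoc[OF li[OF that] b(1) b'(1)] b(2) b'(2) li[OF that] that
          by (simp add: hom_def)
      qed (use b b' x in \<open>auto intro: Comp_hom Idt_hom\<close>)
      moreover have "b \<bullet>\<^bsub>C\<^esub> b' = Idt C x2"
      proof (rule colimit_map_eqI[OF E xl2])
        show "(b \<bullet>\<^bsub>C\<^esub> b') \<bullet>\<^bsub>C\<^esub> l2 i = Idt C x2 \<bullet>\<^bsub>C\<^esub> l2 i" if "i \<in> Obj I" for i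
          using Comp_assoc[OF p2(7)[OF that] b'(1) b(1)] b(2) b'(2) p2(7)[OF that] that
          by (simp add: hom_def)
      qed (use b b' p2(8) in \<open>auto intro: Comp_hom Idt_hom\<close>)
      ultimately have inv: "inverse_arrows C b b'"
        using b(1) b'(1) by (auto simp: inverse_arrows_def hom_def)
      have "h2 \<bullet>\<^bsub>C\<^esub> b = h"
      proof (rule colimit_map_eqI[OF E xl])
        show "(h2 \<bullet>\<^bsub>C\<^esub> b) \<bullet>\<^bsub>C\<^esub> l i = h \<bullet>\<^bsub>C\<^esub> l i" if "i \<in> Obj I" for i
          using Comp_assoc[OF li[OF that] b(1) p2(4)] b(2) p2(6) h(2) that by simp
      qed (use b h p2(4) in \<open>auto intro: Comp_hom\<close>)
      then show "\<forall>i\<in>Obj I. is_pullback C h (\<eta> i) (l i) (\<alpha> i)"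
        using is_pullback_transport_apex[OF p2(5) inv] b li p2(4) by (auto simp: hom_def)
    qed
  qed
  ultimately show ?vk by blast
qed

end

section \<open>Loose cocones over a companion diagram\<close>

context pullback_category
begin

lemma pb2_Idt:
  assumes "f \<in> Arr C" "x = Cod C f"
  shows "pb2 C f (Idt C x) = f \<bullet>\<^bsub>C\<^esub> pb1 C f (Idt C x)"
proof -
  have "Idt C x \<bullet>\<^bsub>C\<^esub> pb2 C f (Idt C x) = f \<bullet>\<^bsub>C\<^esub> pb1 C f (Idt C x)"
    by (rule pb_square) (use assms(1) in \<open>simp_all add: assms(2)\<close>)
  moreover have "Idt C x \<bullet>\<^bsub>C\<^esub> pb2 C f (Idt C x) = pb2 C f (Idt C x)"
    by (rule Comp_Idt'(2)) (use assms(1) in \<open>simp_all add: assms(2)\<close>)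
  ultimately show ?thesis by (rule trans[OF sym, rotated])
qed

lemma pb1_Idt_monic:
  assumes "f \<in> Arr C" "x = Cod C f" "u \<in> Arr C" "v \<in> Arr C" "Dom C u = Dom C v"
    "Cod C u = Dom C (pb1 C f (Idt C x))" "Cod C v = Dom C (pb1 C f (Idt C x))"
    "pb1 C f (Idt C x) \<bullet>\<^bsub>C\<^esub> u = pb1 C f (Idt C x) \<bullet>\<^bsub>C\<^esub> v"
  shows "u = v"
  by (rule pb_joint_monic[of f "Idt C x"]) (use assms in \<open>simp_all add: pb2_Idt\<close>)

text \<open>The arrow inverse to the associator, described by its three projections, so that composites with it
can be computed without unfolding the definite description in \<open>inverse_arr\<close>.\<close>

lemma inverse_assoc_capx:
  assumes "m \<in> spans C" "n \<in> spans C" "p \<in> spans C" "Cod C (rleg m) = Cod C (lleg n)"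
    "Cod C (rleg n) = Cod C (lleg p)"
  defines "q1 \<equiv> pb1 C (rleg m) (lleg n)" and "q2 \<equiv> pb2 C (rleg m) (lleg n)"
  defines "p1 \<equiv> pb1 C (rleg n \<bullet>\<^bsub>C\<^esub> q2) (lleg p)" and "p2 \<equiv> pb2 C (rleg n \<bullet>\<^bsub>C\<^esub> q2) (lleg p)"
  defines "s1 \<equiv> pb1 C (rleg n) (lleg p)" and "s2 \<equiv> pb2 C (rleg n) (lleg p)"
  defines "r1 \<equiv> pb1 C (rleg m) (lleg n \<bullet>\<^bsub>C\<^esub> s1)" and "r2 \<equiv> pb2 C (rleg m) (lleg n \<bullet>\<^bsub>C\<^esub> s1)"
  defines "b \<equiv> capx (inverse_arr (span_cellcat C) (assoc (span_double C) m n p))"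
  shows "b \<in> Arr C" "Dom C b = Dom C r1" "Cod C b = Dom C p1"
    "q1 \<bullet>\<^bsub>C\<^esub> p1 \<bullet>\<^bsub>C\<^esub> b = r1" "q2 \<bullet>\<^bsub>C\<^esub> p1 \<bullet>\<^bsub>C\<^esub> b = s1 \<bullet>\<^bsub>C\<^esub> r2" "p2 \<bullet>\<^bsub>C\<^esub> b = s2 \<bullet>\<^bsub>C\<^esub> r2"
    "\<And>z. \<lbrakk>z \<in> Arr C; Cod C z = Dom C r1\<rbrakk> \<Longrightarrow> q1 \<bullet>\<^bsub>C\<^esub> p1 \<bullet>\<^bsub>C\<^esub> b \<bullet>\<^bsub>C\<^esub> z = r1 \<bullet>\<^bsub>C\<^esub> z"
    "\<And>z. \<lbrakk>z \<in> Arr C; Cod C z = Dom C r1\<rbrakk> \<Longrightarrow>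
      q2 \<bullet>\<^bsub>C\<^esub> p1 \<bullet>\<^bsub>C\<^esub> b \<bullet>\<^bsub>C\<^esub> z = s1 \<bullet>\<^bsub>C\<^esub> r2 \<bullet>\<^bsub>C\<^esub> z"
    "\<And>z. \<lbrakk>z \<in> Arr C; Cod C z = Dom C r1\<rbrakk> \<Longrightarrow> p2 \<bullet>\<^bsub>C\<^esub> b \<bullet>\<^bsub>C\<^esub> z = s2 \<bullet>\<^bsub>C\<^esub> r2 \<bullet>\<^bsub>C\<^esub> z"
proof -
  obtain b' where b': "b' \<in> Arr C" "Dom C b' = Dom C r1" "Cod C b' = Dom C p1"
    "q1 \<bullet>\<^bsub>C\<^esub> p1 \<bullet>\<^bsub>C\<^esub> b' = r1" "q2 \<bullet>\<^bsub>C\<^esub> p1 \<bullet>\<^bsub>C\<^esub> b' = s1 \<bullet>\<^bsub>C\<^esub> r2" "p2 \<bullet>\<^bsub>C\<^esub> b' = s2 \<bullet>\<^bsub>C\<^esub> r2"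
    and inv: "inverse_arrows (span_cellcat C) (assoc (span_double C) m n p)
      (globular_span_cell C (span_comp C m (span_comp C n p)) (span_comp C (span_comp C m n) p) b')"
    using assoc_inverse[OF assms(1-5)]
    unfolding q1_def q2_def p1_def p2_def s1_def s2_def r1_def r2_def by blast
  have "b = b'"
    unfolding b_def category.inverse_arr_eq[OF span_cell_category inv] by simp
  then show b: "b \<in> Arr C" "Dom C b = Dom C r1" "Cod C b = Dom C p1"
    "q1 \<bullet>\<^bsub>C\<^esub> p1 \<bullet>\<^bsub>C\<^esub> b = r1" "q2 \<bullet>\<^bsub>C\<^esub> p1 \<bullet>\<^bsub>C\<^esub> b = s1 \<bullet>\<^bsub>C\<^esub> r2" "p2 \<bullet>\<^bsub>C\<^esub> b = s2 \<bullet>\<^bsub>C\<^esub> r2"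
    using b' by simp_all
  have arr: "p1 \<in> Arr C" "p2 \<in> Arr C" "q1 \<in> Arr C" "q2 \<in> Arr C" "r1 \<in> Arr C" "r2 \<in> Arr C"
    "s1 \<in> Arr C" "s2 \<in> Arr C" "Cod C p1 = Dom C q1" "Dom C q2 = Dom C q1" "Dom C p2 = Dom C p1"
    "Cod C r2 = Dom C s1" "Dom C s2 = Dom C s1" "Dom C r2 = Dom C r1"
    using assms(1-5)
    by (simp_all add: q1_def q2_def p1_def p2_def s1_def s2_def r1_def r2_def)
  fix z assume z: "z \<in> Arr C" "Cod C z = Dom C r1"
  show "q1 \<bullet>\<^bsub>C\<^esub> p1 \<bullet>\<^bsub>C\<^esub> b \<bullet>\<^bsub>C\<^esub> z = r1 \<bullet>\<^bsub>C\<^esub> z"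
    using reassoc1[of "q1 \<bullet>\<^bsub>C\<^esub> p1" b r1 z] b arr z by simp
  show "q2 \<bullet>\<^bsub>C\<^esub> p1 \<bullet>\<^bsub>C\<^esub> b \<bullet>\<^bsub>C\<^esub> z = s1 \<bullet>\<^bsub>C\<^esub> r2 \<bullet>\<^bsub>C\<^esub> z"
    using reassoc1[of "q2 \<bullet>\<^bsub>C\<^esub> p1" b "s1 \<bullet>\<^bsub>C\<^esub> r2" z] b arr z by simp
  show "p2 \<bullet>\<^bsub>C\<^esub> b \<bullet>\<^bsub>C\<^esub> z = s2 \<bullet>\<^bsub>C\<^esub> r2 \<bullet>\<^bsub>C\<^esub> z"
    using reassoc1[of p2 b "s2 \<bullet>\<^bsub>C\<^esub> r2" z] b arr z by simp
qed

lemma inverse_runit_capx: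
  assumes "m \<in> spans C"
  defines "b \<equiv> capx (inverse_arr (span_cellcat C) (runit (span_double C) m))"
    and "f \<equiv> pb1 C (rleg m) (Idt C (Cod C (rleg m)))"
  shows "b \<in> Arr C" "Dom C b = Dom C (lleg m)" "Cod C b = Dom C f" "f \<bullet>\<^bsub>C\<^esub> b = Idt C (Dom C (lleg m))"
    "\<And>z. \<lbrakk>z \<in> Arr C; Cod C z = Dom C (lleg m)\<rbrakk> \<Longrightarrow> f \<bullet>\<^bsub>C\<^esub> b \<bullet>\<^bsub>C\<^esub> z = z"
proof -
  note inv = category.inverse_arr_eq[OF span_cell_category runit_inverse[OF assms(1)]]
  show b: "b \<in> Arr C" "Dom C b = Dom C (lleg m)" "Cod C b = Dom C f" "f \<bullet>\<^bsub>C\<^esub> b = Idt C (Dom C (lleg m))"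
    unfolding b_def inv f_def using assms(1) by simp_all
  have f: "f \<in> Arr C" using assms(1) by (simp add: f_def)
  show "f \<bullet>\<^bsub>C\<^esub> b \<bullet>\<^bsub>C\<^esub> z = z" if "z \<in> Arr C" "Cod C z = Dom C (lleg m)" for z
    using reassoc1[OF b(4)] b f that by simp
qed

end

text \<open>The data of a loose cocone under the companion diagram, with the boundaries of its cells but without
invertibility and coherence.  Stating the coherence laws for such families allows one computation to
serve both the analysis of a given loose cocone and the construction of a new one.\<close>

locale loose_family = companion_setup C I D
  for C :: "('o, 'a) cat" and I :: "('i, 'j) cat" and D :: "('i, 'j, 'o, 'a) ftor" +
  fixes d :: 'o and \<theta> :: "('i, 'i, 'j, 'a span, 'a span_cell) ltrans"
  assumes vertex [simp]: "d \<in> Obj C"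
    and lob_simps [simp]: "i \<in> Obj I \<Longrightarrow> lob \<theta> i \<in> spans C"
      "i \<in> Obj I \<Longrightarrow> Cod C (lleg (lob \<theta> i)) = fob D i"
      "i \<in> Obj I \<Longrightarrow> Cod C (rleg (lob \<theta> i)) = d"
    and ltight_idcell [simp]: "i \<in> Obj I \<Longrightarrow> ltight \<theta> i = idcell (span_double C) (lob \<theta> i)"
    and lloose_simps [simp]: "u \<in> Arr I \<Longrightarrow> lloose \<theta> u \<in> span_cells C"
      "u \<in> Arr I \<Longrightarrow> csrc (lloose \<theta> u) =
        span_comp C (companion C (far D u)) (lob \<theta> (Cod I u))"
      "u \<in> Arr I \<Longrightarrow> ctgt (lloose \<theta> u) = span_comp C (lob \<theta> (Dom I u)) (span_unit C d)"
      "u \<in> Arr I \<Longrightarrow> clft (lloose \<theta> u) = Idt C (fob D (Dom I u))"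
      "u \<in> Arr I \<Longrightarrow> crgt (lloose \<theta> u) = Idt C d"
begin

declare unit_sq [simp del]

abbreviation "S \<equiv> span_double C"
abbreviation "Y \<equiv> diag (span_double C) d :: ('i, 'i, 'j, 'j, 'o, 'a, 'a span, 'a span_cell) dftor"

lemma Y_simps [simp]: "dob Y i = d" "dtight Y f = Idt C d" "dloose Y u = span_unit C d"
  "dcell Y w = idcell S (span_unit C d)" "dcomp Y u v = lunit S (span_unit C d)"
  "dunit Y i = idcell S (span_unit C d)"
  by (simp_all add: diag_def)

text \<open>An arrow into the apex of \<open>\<theta>\<^sub>i \<odot> U d\<close> is determined by its projection to the apex of \<open>\<theta>\<^sub>i\<close>.  For the cell at
\<open>u : i \<rightarrow> j\<close> this projection is an arrow from the pullback of \<open>\<theta>\<^sub>j\<close> along \<open>D u\<close> to the apex of \<open>\<theta>\<^sub>i\<close>.\<close>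

definition comparison :: "'j \<Rightarrow> 'a" where
  "comparison u = pb1 C (rleg (lob \<theta> (Dom I u))) (Idt C d) \<bullet>\<^bsub>C\<^esub> capx (lloose \<theta> u)"

lemma lloose_capx:
  assumes "u \<in> Arr I"
  shows "capx (lloose \<theta> u) \<in> Arr C"
    "Dom C (capx (lloose \<theta> u)) = Dom C (pb1 C (far D u) (lleg (lob \<theta> (Cod I u))))"
    "Cod C (capx (lloose \<theta> u)) = Dom C (pb1 C (rleg (lob \<theta> (Dom I u))) (Idt C d))"
  using assms by simp_all

lemma comparison_simps [simp]:
  assumes "u \<in> Arr I"
  shows "comparison u \<in> Arr C"
    "Dom C (comparison u) = Dom C (pb1 C (far D u) (lleg (lob \<theta> (Cod I u))))"
    "Cod C (comparison u) = Dom C (lleg (lob \<theta> (Dom I u)))"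
    "lleg (lob \<theta> (Dom I u)) \<bullet>\<^bsub>C\<^esub> comparison u = pb1 C (far D u) (lleg (lob \<theta> (Cod I u)))"
    "rleg (lob \<theta> (Dom I u)) \<bullet>\<^bsub>C\<^esub> comparison u =
       rleg (lob \<theta> (Cod I u)) \<bullet>\<^bsub>C\<^esub> pb2 C (far D u) (lleg (lob \<theta> (Cod I u)))"
proof -
  note s = lloose_simps[OF assms]
  show "comparison u \<in> Arr C"
    "Dom C (comparison u) = Dom C (pb1 C (far D u) (lleg (lob \<theta> (Cod I u))))"
    "Cod C (comparison u) = Dom C (lleg (lob \<theta> (Dom I u)))"
    "lleg (lob \<theta> (Dom I u)) \<bullet>\<^bsub>C\<^esub> comparison u = pb1 C (far D u) (lleg (lob \<theta> (Cod I u)))"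
    "rleg (lob \<theta> (Dom I u)) \<bullet>\<^bsub>C\<^esub> comparison u =
       rleg (lob \<theta> (Cod I u)) \<bullet>\<^bsub>C\<^esub> pb2 C (far D u) (lleg (lob \<theta> (Cod I u)))"
    using assms span_cells_simps(12,13)[OF s(1)] lloose_capx[OF assms]
    by (simp_all add: comparison_def pb2_Idt)
qed

lemma comparison_simps' [simp]:
  assumes u: "u \<in> Arr I" "i = Dom I u"
  shows "lleg (lob \<theta> i) \<bullet>\<^bsub>C\<^esub> comparison u = pb1 C (far D u) (lleg (lob \<theta> (Cod I u)))"
    "pb1 C (rleg (lob \<theta> i)) (Idt C d) \<bullet>\<^bsub>C\<^esub> capx (lloose \<theta> u) = comparison u"
    "\<lbrakk>z \<in> Arr C; Cod C z = Dom C (pb1 C (far D u) (lleg (lob \<theta> (Cod I u))))\<rbrakk> \<Longrightarrow>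
      lleg (lob \<theta> i) \<bullet>\<^bsub>C\<^esub> comparison u \<bullet>\<^bsub>C\<^esub> z = pb1 C (far D u) (lleg (lob \<theta> (Cod I u))) \<bullet>\<^bsub>C\<^esub> z"
    "\<lbrakk>z \<in> Arr C; Cod C z = Dom C (pb1 C (far D u) (lleg (lob \<theta> (Cod I u))))\<rbrakk> \<Longrightarrow>
      pb1 C (rleg (lob \<theta> i)) (Idt C d) \<bullet>\<^bsub>C\<^esub> capx (lloose \<theta> u) \<bullet>\<^bsub>C\<^esub> z = comparison u \<bullet>\<^bsub>C\<^esub> z"
proof -
  show "lleg (lob \<theta> i) \<bullet>\<^bsub>C\<^esub> comparison u = pb1 C (far D u) (lleg (lob \<theta> (Cod I u)))"
    "pb1 C (rleg (lob \<theta> i)) (Idt C d) \<bullet>\<^bsub>C\<^esub> capx (lloose \<theta> u) = comparison u"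
    using u by (simp_all add: comparison_def[symmetric])
  assume z: "z \<in> Arr C" "Cod C z = Dom C (pb1 C (far D u) (lleg (lob \<theta> (Cod I u))))"
  show "lleg (lob \<theta> i) \<bullet>\<^bsub>C\<^esub> comparison u \<bullet>\<^bsub>C\<^esub> z = pb1 C (far D u) (lleg (lob \<theta> (Cod I u))) \<bullet>\<^bsub>C\<^esub> z"
    unfolding u(2) by (rule reassoc1[OF comparison_simps(4)]) (use u(1) z in simp_all)
  show "pb1 C (rleg (lob \<theta> i)) (Idt C d) \<bullet>\<^bsub>C\<^esub> capx (lloose \<theta> u) \<bullet>\<^bsub>C\<^esub> z = comparison u \<bullet>\<^bsub>C\<^esub> z"
    unfolding u(2) by (rule reassoc1[OF comparison_def[symmetric]]) (use u(1) z in simp_all)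
qed

lemma cell_into_unit_comp_eqI:
  assumes i: "i \<in> Obj I" and s: "s \<in> span_cells C" "t \<in> span_cells C" "csrc s = csrc t"
    "ctgt s = span_comp C (lob \<theta> i) (span_unit C d)" "ctgt t = span_comp C (lob \<theta> i) (span_unit C d)"
    "clft s = clft t" "crgt s = crgt t"
    and eq: "pb1 C (rleg (lob \<theta> i)) (Idt C d) \<bullet>\<^bsub>C\<^esub> capx s = pb1 C (rleg (lob \<theta> i)) (Idt C d) \<bullet>\<^bsub>C\<^esub> capx t"
  shows "s = t"
proof -
  have "capx s = capx t"
    by (rule pb1_Idt_monic[of "rleg (lob \<theta> i)" d])
       (use i s eq span_cells_simps(4,5)[OF s(1)] span_cells_simps(4,5)[OF s(2)] in simp_all)
  then show ?thesis using s by (intro span_cell_eqI) simp_all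
qed

end

text \<open>The arrow \<open>e u\<close> plays the role of \<open>E u\<close> for the diagram \<open>E\<close> of apices.  The last condition says that
\<open>comparison u\<close> is inverse to the canonical arrow from \<open>E i\<close> to the pullback of \<open>E j\<close> along \<open>D u\<close>.\<close>

locale presented_family = loose_family C I D d \<theta>
  for C :: "('o, 'a) cat" and I :: "('i, 'j) cat" and D :: "('i, 'j, 'o, 'a) ftor"
    and d :: 'o and \<theta> :: "('i, 'i, 'j, 'a span, 'a span_cell) ltrans" +
  fixes e :: "'j \<Rightarrow> 'a"
  assumes e_pullback: "u \<in> Arr I \<Longrightarrow>
      is_pullback C (far D u) (lleg (lob \<theta> (Cod I u))) (lleg (lob \<theta> (Dom I u))) (e u)"
    and e_comparison [simp]: "u \<in> Arr I \<Longrightarrow>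
      e u \<bullet>\<^bsub>C\<^esub> comparison u = pb2 C (far D u) (lleg (lob \<theta> (Cod I u)))"
begin

lemma e_simps [simp]:
  assumes "u \<in> Arr I"
  shows "e u \<in> Arr C" "Dom C (e u) = Dom C (lleg (lob \<theta> (Dom I u)))"
    "Cod C (e u) = Dom C (lleg (lob \<theta> (Cod I u)))"
    "j = Cod I u \<Longrightarrow> lleg (lob \<theta> j) \<bullet>\<^bsub>C\<^esub> e u = far D u \<bullet>\<^bsub>C\<^esub> lleg (lob \<theta> (Dom I u))"
  using is_pullback_simps[OF e_pullback[OF assms]] by simp_all

lemma e_comparison' [simp]:
  assumes "u \<in> Arr I" "z \<in> Arr C" "Cod C z = Dom C (pb1 C (far D u) (lleg (lob \<theta> (Cod I u))))"
  shows "e u \<bullet>\<^bsub>C\<^esub> comparison u \<bullet>\<^bsub>C\<^esub> z = pb2 C (far D u) (lleg (lob \<theta> (Cod I u))) \<bullet>\<^bsub>C\<^esub> z"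
  by (rule reassoc1[OF e_comparison]) (use assms in simp_all)

lemma comparison_inverse:
  assumes u: "u \<in> Arr I"
  obtains b where "b \<in> Arr C" "Dom C b = Dom C (lleg (lob \<theta> (Dom I u)))"
    "Cod C b = Dom C (comparison u)" "b \<bullet>\<^bsub>C\<^esub> comparison u = Idt C (Dom C (comparison u))"
    "comparison u \<bullet>\<^bsub>C\<^esub> b = Idt C (Dom C (lleg (lob \<theta> (Dom I u))))"
proof -
  let ?f = "far D u" and ?g = "lleg (lob \<theta> (Cod I u))"
  have pb: "is_pullback C ?f ?g (pb1 C ?f ?g) (pb2 C ?f ?g)"
    by (rule is_pullback_pb) (use u in simp_all)
  obtain b b' where b: "inverse_arrows C b b'" "Dom C b = Dom C (pb1 C ?f ?g)"
    "Cod C b = Dom C (lleg (lob \<theta> (Dom I u)))"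
    "lleg (lob \<theta> (Dom I u)) \<bullet>\<^bsub>C\<^esub> b = pb1 C ?f ?g" "e u \<bullet>\<^bsub>C\<^esub> b = pb2 C ?f ?g"
    by (rule pullback_comparison_iso[OF e_pullback[OF u] pb])
  have "b = comparison u"
    by (rule pullback_jointly_monic[OF e_pullback[OF u]])
       (use b u in \<open>simp_all add: inverse_arrows_def\<close>)
  then show thesis
    using that[of b'] b u by (auto simp: inverse_arrows_def hom_def)
qed

lemma comparison_epi:
  assumes u: "u \<in> Arr I" and xy: "x \<in> Arr C" "y \<in> Arr C"
    "Dom C x = Dom C (lleg (lob \<theta> (Dom I u)))" "Dom C y = Dom C (lleg (lob \<theta> (Dom I u)))"
    and eq: "x \<bullet>\<^bsub>C\<^esub> comparison u = y \<bullet>\<^bsub>C\<^esub> comparison u"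
  shows "x = y"
proof -
  obtain b where b: "b \<in> Arr C" "Cod C b = Dom C (comparison u)"
    "comparison u \<bullet>\<^bsub>C\<^esub> b = Idt C (Dom C (lleg (lob \<theta> (Dom I u))))"
    using comparison_inverse[OF u] by metis
  have "x \<bullet>\<^bsub>C\<^esub> comparison u \<bullet>\<^bsub>C\<^esub> b = y \<bullet>\<^bsub>C\<^esub> comparison u \<bullet>\<^bsub>C\<^esub> b"
    by (rule reassoc[OF eq]) (use u xy b in simp_all)
  then show ?thesis using b xy by simp
qed

lemma rleg_e [simp]:
  assumes u: "u \<in> Arr I" "j = Cod I u"
  shows "rleg (lob \<theta> j) \<bullet>\<^bsub>C\<^esub> e u = rleg (lob \<theta> (Dom I u))"
  unfolding u(2) by (rule comparison_epi[OF u(1)]) (use u(1) in simp_all)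

lemma lloose_globular_iso:
  assumes u: "u \<in> Arr I"
  shows "globular_iso S (span_comp C (companion C (far D u)) (lob \<theta> (Cod I u)))
    (span_comp C (lob \<theta> (Dom I u)) (span_unit C d)) (lloose \<theta> u)"
proof -
  obtain b where b: "b \<in> Arr C" "Dom C b = Dom C (lleg (lob \<theta> (Dom I u)))"
    "Cod C b = Dom C (comparison u)" "b \<bullet>\<^bsub>C\<^esub> comparison u = Idt C (Dom C (comparison u))"
    "comparison u \<bullet>\<^bsub>C\<^esub> b = Idt C (Dom C (lleg (lob \<theta> (Dom I u))))"
    using comparison_inverse[OF u] .
  let ?p = "pb1 C (rleg (lob \<theta> (Dom I u))) (Idt C d)"
  have b': "comparison u \<bullet>\<^bsub>C\<^esub> b \<bullet>\<^bsub>C\<^esub> ?p = ?p"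
    by (rule trans[OF reassoc1[OF b(5)]]) (use u b in simp_all)
  have "capx (lloose \<theta> u) \<bullet>\<^bsub>C\<^esub> b \<bullet>\<^bsub>C\<^esub> ?p = Idt C (Dom C ?p)"
    by (rule pb1_Idt_monic[of "rleg (lob \<theta> (Dom I u))" d]) (use u b b' in simp_all)
  then show ?thesis
    by (intro span_globular_isoI[where k = "b \<bullet>\<^bsub>C\<^esub> ?p"])
       (use u b in \<open>simp_all add: comparison_def[symmetric]\<close>)
qed

text \<open>Two cells with the same boundary into \<open>\<theta>\<^sub>i \<odot> U d\<close> agree as soon as their projections to the apex of \<open>\<theta>\<^sub>i\<close>
agree.  On the right-hand side of the law this projection is the second projection of \<open>U \<odot> \<theta>\<^sub>i\<close>; on the
left-hand side it becomes the second projection after composition with \<open>e\<close> at the identity.  The second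
projection has a section, so the law says that this \<open>e\<close> is an identity.\<close>

lemma unit_law_iff:
  assumes i: "i \<in> Obj I"
  shows "lloose \<theta> (Idt I i) \<cdot>\<^bsub>S\<^esub> (dunit X i \<star>\<^bsub>S\<^esub> idcell S (lob \<theta> i))
      = (idcell S (lob \<theta> i) \<star>\<^bsub>S\<^esub> dunit Y i)
        \<cdot>\<^bsub>S\<^esub> inverse_arr (cellcat S) (runit S (lob \<theta> i)) \<cdot>\<^bsub>S\<^esub> lunit S (lob \<theta> i)
    \<longleftrightarrow> e (Idt I i) = Idt C (Dom C (lleg (lob \<theta> i)))" (is "?L = ?R \<longleftrightarrow> _")
proof -
  let ?t = "lob \<theta> i" and ?p = "pb1 C (rleg (lob \<theta> i)) (Idt C d)"
  let ?q = "pb2 C (Idt C (fob D i)) (lleg ?t)"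
  have t: "?t \<in> spans C" using i by simp
  have h: "dunit X i \<star>\<^bsub>S\<^esub> idcell S ?t \<in> span_cells C" "idcell S ?t \<star>\<^bsub>S\<^esub> dunit Y i \<in> span_cells C"
    using i by (auto intro!: hcomp_in simp: dunit_X_simps simp del: X_simps(6))
  note r = inverse_runit_boundary[OF t] inverse_runit_capx[OF t]
  have L: "e (Idt I i) \<bullet>\<^bsub>C\<^esub> ?p \<bullet>\<^bsub>C\<^esub> capx ?L = ?q"
    using i h by (simp add: hcomp_facts dunit_X_simps del: X_simps(6))
  have R: "?p \<bullet>\<^bsub>C\<^esub> capx ?R = ?q"
    using i h r by (simp add: hcomp_facts)
  obtain k where k: "k \<in> Arr C" "Cod C k = Dom C ?q" "?q \<bullet>\<^bsub>C\<^esub> k = Idt C (Dom C (lleg ?t))"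
    using i by (intro that[of "pbmed C (Idt C (fob D i)) (lleg ?t) (lleg ?t) (Idt C (Dom C (lleg ?t)))"]) simp_all
  have e: "e (Idt I i) \<in> Arr C" "Dom C (e (Idt I i)) = Dom C (lleg ?t)" "Cod C (e (Idt I i)) = Dom C (lleg ?t)"
    using i by simp_all
  show ?thesis
  proof
    assume "?L = ?R"
    then have "e (Idt I i) \<bullet>\<^bsub>C\<^esub> ?q = ?q" using L R by simp
    then have "e (Idt I i) \<bullet>\<^bsub>C\<^esub> ?q \<bullet>\<^bsub>C\<^esub> k = ?q \<bullet>\<^bsub>C\<^esub> k"
      by (rule reassoc1) (use i k e in simp_all)
    then show "e (Idt I i) = Idt C (Dom C (lleg ?t))" using e k by simp
  next
    assume e1: "e (Idt I i) = Idt C (Dom C (lleg ?t))"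
    show "?L = ?R"
    proof (rule cell_into_unit_comp_eqI[OF i])
      show "?p \<bullet>\<^bsub>C\<^esub> capx ?L = ?p \<bullet>\<^bsub>C\<^esub> capx ?R"
        using L R i h unfolding e1 by (simp add: dunit_X_simps del: X_simps(6) lunit_simps)
    qed (use i h r in \<open>simp_all add: dunit_X_simps lunit_boundary del: X_simps(6) lunit_simps\<close>)
  qed
qed

text \<open>Both sides are cells \<open>(D u \<odot> D v) \<odot> \<theta>\<^sub>k \<rightarrow> \<theta>\<^sub>i \<odot> U d\<close>, determined by their projections to the apex of \<open>\<theta>\<^sub>i\<close>.
Chasing the projections, the left-hand side composed with \<open>e (v u)\<close> and the right-hand side composed with
\<open>e v \<circ> e u\<close> are both the projection \<open>?q\<close> to the apex of \<open>\<theta>\<^sub>k\<close>.  If the law holds, the common projection of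
both sides is a split epimorphism and can be cancelled.  If \<open>e\<close> preserves the composite, the two projections
agree after \<open>e (v u)\<close>; they also agree after the left leg of \<open>\<theta>\<^sub>i\<close>, and these two arrows are jointly
monic by the pullback property of \<open>e (v u)\<close>.\<close>

lemma comp_law_iff:
  assumes u: "u \<in> Arr I" and v: "v \<in> Arr I" and uv: "Cod I u = Dom I v"
  shows "lloose \<theta> (v \<bullet>\<^bsub>I\<^esub> u) \<cdot>\<^bsub>S\<^esub> (dcomp X u v \<star>\<^bsub>S\<^esub> idcell S (lob \<theta> (Cod I v)))
      = (idcell S (lob \<theta> (Dom I u)) \<star>\<^bsub>S\<^esub> dcomp Y u v)
        \<cdot>\<^bsub>S\<^esub> assoc S (lob \<theta> (Dom I u)) (dloose Y u) (dloose Y v)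
        \<cdot>\<^bsub>S\<^esub> (lloose \<theta> u \<star>\<^bsub>S\<^esub> idcell S (dloose Y v))
        \<cdot>\<^bsub>S\<^esub> inverse_arr (cellcat S) (assoc S (dloose X u) (lob \<theta> (Cod I u)) (dloose Y v))
        \<cdot>\<^bsub>S\<^esub> (idcell S (dloose X u) \<star>\<^bsub>S\<^esub> lloose \<theta> v)
        \<cdot>\<^bsub>S\<^esub> assoc S (dloose X u) (dloose X v) (lob \<theta> (Cod I v))
    \<longleftrightarrow> e (v \<bullet>\<^bsub>I\<^esub> u) = e v \<bullet>\<^bsub>C\<^esub> e u" (is "?L = ?R \<longleftrightarrow> _")
proof -
  let ?i = "Dom I u" and ?j = "Cod I u" and ?k = "Cod I v"
  let ?p = "pb1 C (rleg (lob \<theta> ?i)) (Idt C d)"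
  let ?u = "companion C (far D u)" and ?v = "companion C (far D v)" and ?d = "span_unit C d"
  let ?q = "pb2 C (far D v \<bullet>\<^bsub>C\<^esub> pb2 C (far D u) (Idt C (fob D ?j))) (lleg (lob \<theta> ?k))"
  have sp: "?u \<in> spans C" "?v \<in> spans C" "lob \<theta> ?i \<in> spans C" "lob \<theta> ?j \<in> spans C"
    "lob \<theta> ?k \<in> spans C" "?d \<in> spans C" using u v by simp_all
  have c: "Cod C (rleg (lob \<theta> ?i)) = Cod C (lleg ?d)" "Cod C (rleg ?d) = Cod C (lleg ?d)"
    "Cod C (rleg ?u) = Cod C (lleg (lob \<theta> ?j))" "Cod C (rleg (lob \<theta> ?j)) = Cod C (lleg ?d)"
    "Cod C (rleg ?u) = Cod C (lleg ?v)" "Cod C (rleg ?v) = Cod C (lleg (lob \<theta> ?k))"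
    using u v uv by simp_all
  have h: "dcomp X u v \<star>\<^bsub>S\<^esub> idcell S (lob \<theta> ?k) \<in> span_cells C"
    "idcell S (lob \<theta> ?i) \<star>\<^bsub>S\<^esub> dcomp Y u v \<in> span_cells C"
    "lloose \<theta> u \<star>\<^bsub>S\<^esub> idcell S ?d \<in> span_cells C"
    "idcell S ?u \<star>\<^bsub>S\<^esub> lloose \<theta> v \<in> span_cells C"
    using u v uv by (auto intro!: hcomp_in simp: dcomp_X_simps lunit_boundary simp del: X_simps(5) lunit_simps)
  note a1 = assoc_capx[OF sp(3,6,6) c(1,2)]
  note a2 = inverse_assoc_capx[OF sp(1,4,6) c(3,4)] inverse_assoc_boundary[OF sp(1,4,6) c(3,4)]
  note a3 = assoc_capx[OF sp(1,2,5) c(5,6)]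
  define H where "H = dcomp X u v \<star>\<^bsub>S\<^esub> idcell S (lob \<theta> ?k)"
  have vu: "v \<bullet>\<^bsub>I\<^esub> u \<in> Arr I" "Dom I (v \<bullet>\<^bsub>I\<^esub> u) = ?i" "Cod I (v \<bullet>\<^bsub>I\<^esub> u) = ?k"
    using u v uv by simp_all
  have hH: "dcomp X u v \<in> span_cells C" "idcell S (lob \<theta> ?k) \<in> span_cells C"
    "crgt (dcomp X u v) = clft (idcell S (lob \<theta> ?k))"
    "Cod C (rleg (csrc (dcomp X u v))) = Cod C (lleg (csrc (idcell S (lob \<theta> ?k))))"
    "Cod C (rleg (ctgt (dcomp X u v))) = Cod C (lleg (ctgt (idcell S (lob \<theta> ?k))))"
    using u v uv by (simp_all add: dcomp_X_simps del: X_simps(5))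
  have bd: "rleg (csrc (dcomp X u v)) = far D v \<bullet>\<^bsub>C\<^esub> pb2 C (far D u) (Idt C (fob D ?j))"
    "rleg (ctgt (dcomp X u v)) = far D (v \<bullet>\<^bsub>I\<^esub> u)"
    "lleg (csrc (idcell S (lob \<theta> ?k))) = lleg (lob \<theta> ?k)"
    "lleg (ctgt (idcell S (lob \<theta> ?k))) = lleg (lob \<theta> ?k)"
    "capx (idcell S (lob \<theta> ?k)) = Idt C (Dom C (lleg (lob \<theta> ?k)))"
    using u v uv by simp_all
  have H: "capx H \<in> Arr C" "Cod C (capx H) = Dom C (pb1 C (far D (v \<bullet>\<^bsub>I\<^esub> u)) (lleg (lob \<theta> ?k)))"
    "pb2 C (far D (v \<bullet>\<^bsub>I\<^esub> u)) (lleg (lob \<theta> ?k)) \<bullet>\<^bsub>C\<^esub> capx H = ?q"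
    using hcomp_facts(1,3)[OF hH] hcomp_facts(5)[OF hH refl refl] u v uv
    unfolding H_def bd by simp_all
  have Hc: "H \<in> span_cells C" "csrc H = span_comp C (span_comp C ?u ?v) (lob \<theta> ?k)"
    "ctgt H = span_comp C (companion C (far D (v \<bullet>\<^bsub>I\<^esub> u))) (lob \<theta> ?k)"
    "clft H = Idt C (fob D ?i)" "crgt H = Idt C d"
    using h(1) u v uv unfolding H_def by (simp_all add: dcomp_X_simps del: X_simps(5))
  have yL: "?p \<bullet>\<^bsub>C\<^esub> capx ?L = comparison (v \<bullet>\<^bsub>I\<^esub> u) \<bullet>\<^bsub>C\<^esub> capx H"
    unfolding H_def[symmetric] using comparison_simps'(4)[OF vu(1) vu(2)[symmetric] H(1)] H(2) vu(3) by simp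
  have L: "e (v \<bullet>\<^bsub>I\<^esub> u) \<bullet>\<^bsub>C\<^esub> ?p \<bullet>\<^bsub>C\<^esub> capx ?L = ?q"
    unfolding yL using e_comparison'[OF vu(1) H(1)] H(2,3) vu(3) by simp
  have R: "e v \<bullet>\<^bsub>C\<^esub> e u \<bullet>\<^bsub>C\<^esub> ?p \<bullet>\<^bsub>C\<^esub> capx ?R = ?q"
    using u v uv h a1 a2 a3 by (simp add: hcomp_facts lunit_boundary del: X_simps(5) lunit_simps)
  have Lc: "?L \<in> span_cells C" "csrc ?L = span_comp C (span_comp C ?u ?v) (lob \<theta> ?k)"
    "ctgt ?L = span_comp C (lob \<theta> ?i) ?d" "clft ?L = Idt C (fob D ?i)" "crgt ?L = Idt C d"
    unfolding H_def[symmetric] using lloose_simps[OF vu(1), unfolded vu] Hc u by simp_all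
  have Rc: "?R \<in> span_cells C" "csrc ?R = span_comp C (span_comp C ?u ?v) (lob \<theta> ?k)"
    "ctgt ?R = span_comp C (lob \<theta> ?i) ?d" "clft ?R = Idt C (fob D ?i)" "crgt ?R = Idt C d"
    using u v uv h a1(10-14) a2(10-14) a3(10-14)
    by (simp_all add: lunit_boundary del: X_simps(5) lunit_simps)
  have p: "?p \<in> Arr C" "Cod C ?p = Dom C (lleg (lob \<theta> ?i))" using u by simp_all
  have capL: "capx ?L \<in> Arr C" "Cod C (capx ?L) = Dom C ?p"
      "Dom C (capx ?L) = Dom C (lleg (span_comp C (span_comp C ?u ?v) (lob \<theta> ?k)))"
      "lleg (span_comp C (lob \<theta> ?i) ?d) \<bullet>\<^bsub>C\<^esub> capx ?L =
       Idt C (fob D ?i) \<bullet>\<^bsub>C\<^esub> lleg (span_comp C (span_comp C ?u ?v) (lob \<theta> ?k))"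
    using span_cells_simps(3-5,12)[OF Lc(1), unfolded Lc] u v uv by simp_all
  have capR: "capx ?R \<in> Arr C" "Cod C (capx ?R) = Dom C ?p"
      "Dom C (capx ?R) = Dom C (lleg (span_comp C (span_comp C ?u ?v) (lob \<theta> ?k)))"
      "lleg (span_comp C (lob \<theta> ?i) ?d) \<bullet>\<^bsub>C\<^esub> capx ?R =
       Idt C (fob D ?i) \<bullet>\<^bsub>C\<^esub> lleg (span_comp C (span_comp C ?u ?v) (lob \<theta> ?k))"
    using span_cells_simps(3-5,12)[OF Rc(1), unfolded Rc] u v uv by simp_all
  have lleg_p: "lleg (span_comp C (lob \<theta> ?i) ?d) = lleg (lob \<theta> ?i) \<bullet>\<^bsub>C\<^esub> ?p"
    using u by simp
  have e: "e u \<in> Arr C" "e v \<in> Arr C" "Cod C (e u) = Dom C (e v)" "Dom C (e u) = Dom C (lleg (lob \<theta> ?i))"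
    "e (v \<bullet>\<^bsub>I\<^esub> u) \<in> Arr C" "Dom C (e (v \<bullet>\<^bsub>I\<^esub> u)) = Dom C (lleg (lob \<theta> ?i))"
    using u v uv by simp_all
  \<comment> \<open>\<open>H\<close> is invertible because the comparison cell of the companion diagram is; a section is enough here\<close>
  obtain s where s: "s \<in> Arr C" "Cod C s = Dom C (capx H)"
    "capx H \<bullet>\<^bsub>C\<^esub> s = Idt C (Dom C (pb1 C (far D (v \<bullet>\<^bsub>I\<^esub> u)) (lleg (lob \<theta> ?k))))"
  proof -
    let ?w = "far D (v \<bullet>\<^bsub>I\<^esub> u)" and ?a = "lleg (lob \<theta> ?k)" and ?j' = "Idt C (fob D ?j)"
    let ?b = "far D v \<bullet>\<^bsub>C\<^esub> pb2 C (far D u) ?j'"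
    define \<sigma> where "\<sigma> = pbmed C (far D u) ?j' (Idt C (fob D ?i)) (far D u)"
    have \<sigma>: "\<sigma> \<in> Arr C" "Dom C \<sigma> = fob D ?i" "Cod C \<sigma> = Dom C (pb1 C (far D u) ?j')"
      "pb1 C (far D u) ?j' \<bullet>\<^bsub>C\<^esub> \<sigma> = Idt C (fob D ?i)" "pb2 C (far D u) ?j' \<bullet>\<^bsub>C\<^esub> \<sigma> = far D u"
      using u by (simp_all add: \<sigma>_def)
    have w: "?w \<in> Arr C" "Dom C ?w = fob D ?i" "Cod C ?w = fob D ?k" "?w = far D v \<bullet>\<^bsub>C\<^esub> far D u"
      using u v uv by simp_all
    have b: "?b \<in> Arr C" "Dom C ?b = Dom C (pb1 C (far D u) ?j')" "Cod C ?b = fob D ?k"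
      using u v uv by simp_all
    have a: "?a \<in> Arr C" "Cod C ?a = fob D ?k" using v by simp_all
    define r1 r2 where r: "r1 = pb1 C ?w ?a" "r2 = pb2 C ?w ?a"
    have r': "r1 \<in> Arr C" "r2 \<in> Arr C" "Dom C r2 = Dom C r1" "Cod C r1 = fob D ?i" "Cod C r2 = Dom C ?a"
      "?w \<bullet>\<^bsub>C\<^esub> r1 = ?a \<bullet>\<^bsub>C\<^esub> r2"
      using pb_simps[OF w(1) a(1)] pb_square[OF w(1) a(1)] w(2,3) a(2) unfolding r by simp_all
    have "?b \<bullet>\<^bsub>C\<^esub> \<sigma> = ?w"
      using u v uv \<sigma> w(4) by simp
    then have sq: "?b \<bullet>\<^bsub>C\<^esub> \<sigma> \<bullet>\<^bsub>C\<^esub> r1 = ?a \<bullet>\<^bsub>C\<^esub> r2"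
      unfolding r'(6)[symmetric] by (rule reassoc1) (use \<sigma> b r' in simp_all)
    define s where "s = pbmed C ?b ?a (\<sigma> \<bullet>\<^bsub>C\<^esub> r1) r2"
    have s: "s \<in> Arr C" "Dom C s = Dom C r1" "Cod C s = Dom C (pb1 C ?b ?a)"
      "pb1 C ?b ?a \<bullet>\<^bsub>C\<^esub> s = \<sigma> \<bullet>\<^bsub>C\<^esub> r1" "pb2 C ?b ?a \<bullet>\<^bsub>C\<^esub> s = r2"
      using pbmed_simps[of ?b ?a "\<sigma> \<bullet>\<^bsub>C\<^esub> r1" r2] sq b a \<sigma> r' unfolding s_def by simp_all
    have DH: "Dom C (capx H) = Dom C (pb1 C ?b ?a)"
      using hcomp_facts(2)[OF hH] unfolding H_def bd .
    have cd: "capx (dcomp X u v) = pb1 C (far D u) ?j'" using u v uv by simp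
    have H1: "r1 \<bullet>\<^bsub>C\<^esub> capx H \<bullet>\<^bsub>C\<^esub> s = r1"
    proof -
      have "r1 \<bullet>\<^bsub>C\<^esub> capx H \<bullet>\<^bsub>C\<^esub> s = capx (dcomp X u v) \<bullet>\<^bsub>C\<^esub> pb1 C ?b ?a \<bullet>\<^bsub>C\<^esub> s"
        using hcomp_facts(6)[OF hH refl refl s(1)] s(3) unfolding H_def bd r by simp
      also have "\<dots> = r1" unfolding s(4) cd
        by (rule trans[OF reassoc1[OF \<sigma>(4)]]) (use \<sigma> r' u in simp_all)
      finally show ?thesis .
    qed
    have H2: "r2 \<bullet>\<^bsub>C\<^esub> capx H \<bullet>\<^bsub>C\<^esub> s = r2"
      using reassoc1[OF H(3), of s] s H DH r' pb_simps[OF w(1) a(1)] w(3) a(2) unfolding r by simp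
    have "capx H \<bullet>\<^bsub>C\<^esub> s = Idt C (Dom C r1)"
      by (rule pb_joint_monic[of ?w ?a, folded r]) (use w(1-3) a s H DH H1 H2 r' in \<open>simp_all add: r\<close>)
    then show thesis using that[of s] s DH by (simp add: r)
  qed
  show ?thesis
  proof
    assume "?L = ?R"
    then have "(e v \<bullet>\<^bsub>C\<^esub> e u) \<bullet>\<^bsub>C\<^esub> ?p \<bullet>\<^bsub>C\<^esub> capx ?L = e (v \<bullet>\<^bsub>I\<^esub> u) \<bullet>\<^bsub>C\<^esub> ?p \<bullet>\<^bsub>C\<^esub> capx ?L"
      unfolding L using R capL p e by simp
    then have "(e v \<bullet>\<^bsub>C\<^esub> e u) \<bullet>\<^bsub>C\<^esub> comparison (v \<bullet>\<^bsub>I\<^esub> u) \<bullet>\<^bsub>C\<^esub> capx H =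
        e (v \<bullet>\<^bsub>I\<^esub> u) \<bullet>\<^bsub>C\<^esub> comparison (v \<bullet>\<^bsub>I\<^esub> u) \<bullet>\<^bsub>C\<^esub> capx H"
      unfolding yL .
    then have "((e v \<bullet>\<^bsub>C\<^esub> e u) \<bullet>\<^bsub>C\<^esub> comparison (v \<bullet>\<^bsub>I\<^esub> u)) \<bullet>\<^bsub>C\<^esub> capx H \<bullet>\<^bsub>C\<^esub> s =
        (e (v \<bullet>\<^bsub>I\<^esub> u) \<bullet>\<^bsub>C\<^esub> comparison (v \<bullet>\<^bsub>I\<^esub> u)) \<bullet>\<^bsub>C\<^esub> capx H \<bullet>\<^bsub>C\<^esub> s"
      by (intro reassoc) (use e comparison_simps[OF vu(1), unfolded vu] H(1,2) s in simp_all)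
    then have eq: "(e v \<bullet>\<^bsub>C\<^esub> e u) \<bullet>\<^bsub>C\<^esub> comparison (v \<bullet>\<^bsub>I\<^esub> u) =
        e (v \<bullet>\<^bsub>I\<^esub> u) \<bullet>\<^bsub>C\<^esub> comparison (v \<bullet>\<^bsub>I\<^esub> u)"
      using e comparison_simps(1-3)[OF vu(1), unfolded vu] s(3) by simp
    show "e (v \<bullet>\<^bsub>I\<^esub> u) = e v \<bullet>\<^bsub>C\<^esub> e u"
      by (rule comparison_epi[OF vu(1) _ _ _ _ eq[symmetric]], unfold vu) (use e in simp_all)
  next
    assume eq: "e (v \<bullet>\<^bsub>I\<^esub> u) = e v \<bullet>\<^bsub>C\<^esub> e u"
    have "?p \<bullet>\<^bsub>C\<^esub> capx ?L = ?p \<bullet>\<^bsub>C\<^esub> capx ?R"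
    proof (rule pullback_jointly_monic[OF e_pullback[OF vu(1)]], unfold vu)
      show "lleg (lob \<theta> ?i) \<bullet>\<^bsub>C\<^esub> ?p \<bullet>\<^bsub>C\<^esub> capx ?L = lleg (lob \<theta> ?i) \<bullet>\<^bsub>C\<^esub> ?p \<bullet>\<^bsub>C\<^esub> capx ?R"
        using capL(1,2,4) capR(1,2,4) p u unfolding lleg_p by simp
      show "e (v \<bullet>\<^bsub>I\<^esub> u) \<bullet>\<^bsub>C\<^esub> ?p \<bullet>\<^bsub>C\<^esub> capx ?L = e (v \<bullet>\<^bsub>I\<^esub> u) \<bullet>\<^bsub>C\<^esub> ?p \<bullet>\<^bsub>C\<^esub> capx ?R"
        unfolding L unfolding eq using R capR p e by simp
    qed (use capL(1-3) capR(1-3) p in simp_all)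
    then show "?L = ?R"
      using Lc Rc u by (intro cell_into_unit_comp_eqI[of ?i]) simp_all
  qed
qed

end

text \<open>The comparison of an invertible cell is invertible, and \<open>e u\<close> is its inverse followed by the second
projection of the pullback.\<close>

lemma (in loose_family) globular_iso_lloose_presented:
  assumes iso: "\<And>u. u \<in> Arr I \<Longrightarrow> globular_iso S (csrc (lloose \<theta> u)) (ctgt (lloose \<theta> u)) (lloose \<theta> u)"
  obtains e where "presented_family C I D d \<theta> e"
proof -
  have "\<exists>f. is_pullback C (far D u) (lleg (lob \<theta> (Cod I u))) (lleg (lob \<theta> (Dom I u))) f \<and>
      f \<bullet>\<^bsub>C\<^esub> comparison u = pb2 C (far D u) (lleg (lob \<theta> (Cod I u)))" if u: "u \<in> Arr I" for u
  proof -
    let ?f = "far D u" and ?a = "lleg (lob \<theta> (Cod I u))" and ?\<beta> = "rleg (lob \<theta> (Dom I u))"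
    let ?\<phi> = "capx (lloose \<theta> u)" and ?p = "pb1 C ?\<beta> (Idt C d)"
    obtain t where t: "inverse_arrows (span_cellcat C) (lloose \<theta> u) t"
      using iso[OF u] by (auto simp: globular_iso_def iso_def)
    then have ti: "t \<in> span_cells C" "csrc t = ctgt (lloose \<theta> u)" "ctgt t = csrc (lloose \<theta> u)"
      "Comp (span_cellcat C) t (lloose \<theta> u) = idcell S (csrc (lloose \<theta> u))"
      "Comp (span_cellcat C) (lloose \<theta> u) t = idcell S (ctgt (lloose \<theta> u))"
      by (auto simp: inverse_arrows_def hom_def)
    have t1: "capx t \<bullet>\<^bsub>C\<^esub> ?\<phi> = Idt C (Dom C (pb1 C ?f ?a))"
      using arg_cong[OF ti(4), of capx] u by simp
    have t2: "?\<phi> \<bullet>\<^bsub>C\<^esub> capx t = Idt C (Dom C ?p)"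
      using arg_cong[OF ti(5), of capx] u by simp
    have tc: "capx t \<in> Arr C" "Dom C (capx t) = Dom C ?p" "Cod C (capx t) = Dom C (pb1 C ?f ?a)"
      using span_cells_simps(3-5)[OF ti(1)] ti(2,3) u by simp_all
    \<comment> \<open>\<open>r\<close> inverts the projection \<open>?p\<close> from the apex of \<open>\<theta>\<^sub>i \<odot> U d\<close> to that of \<open>\<theta>\<^sub>i\<close>\<close>
    define r where "r = pbmed C ?\<beta> (Idt C d) (Idt C (Dom C ?\<beta>)) ?\<beta>"
    have r: "r \<in> Arr C" "Dom C r = Dom C ?\<beta>" "Cod C r = Dom C ?p" "?p \<bullet>\<^bsub>C\<^esub> r = Idt C (Dom C ?\<beta>)"
      using u by (simp_all add: r_def)
    have p: "?p \<in> Arr C" "Cod C ?p = Dom C ?\<beta>" using u by simp_all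
    have rp: "r \<bullet>\<^bsub>C\<^esub> ?p = Idt C (Dom C ?p)"
      by (rule pb1_Idt_monic[of ?\<beta> d])
         (use u r p reassoc1[OF r(4), of ?p] in simp_all)
    have rp': "r \<bullet>\<^bsub>C\<^esub> ?p \<bullet>\<^bsub>C\<^esub> ?\<phi> = ?\<phi>"
      using reassoc1[OF rp, of ?\<phi>] r p lloose_capx[OF u] by simp
    have tp': "?\<phi> \<bullet>\<^bsub>C\<^esub> capx t \<bullet>\<^bsub>C\<^esub> r = r"
      using reassoc1[OF t2, of r] r tc lloose_capx[OF u] by simp
    let ?b = "capx t \<bullet>\<^bsub>C\<^esub> r"
    have 1: "?b \<bullet>\<^bsub>C\<^esub> comparison u = Idt C (Dom C (comparison u))"
      using u r tc p rp' t1 lloose_capx[OF u]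
      by (simp add: comparison_def del: comparison_simps' comparison_simps)
    have 2: "comparison u \<bullet>\<^bsub>C\<^esub> ?b = Idt C (Dom C ?b)"
      using u r tc p tp' lloose_capx[OF u]
      by (simp add: comparison_def del: comparison_simps' comparison_simps)
    have inv: "inverse_arrows C ?b (comparison u)"
      using 1 2 u r tc by (auto simp: inverse_arrows_def hom_def)
    have pb: "is_pullback C ?f ?a (pb1 C ?f ?a) (pb2 C ?f ?a)"
      by (rule is_pullback_pb) (use u in simp_all)
    have "is_pullback C ?f ?a (pb1 C ?f ?a \<bullet>\<^bsub>C\<^esub> ?b) (pb2 C ?f ?a \<bullet>\<^bsub>C\<^esub> ?b)"
      by (rule is_pullback_precomp_iso[OF pb inv]) (use tc r in simp)
    moreover have "pb1 C ?f ?a \<bullet>\<^bsub>C\<^esub> ?b = lleg (lob \<theta> (Dom I u))"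
    proof -
      have "lleg (lob \<theta> (Dom I u)) \<bullet>\<^bsub>C\<^esub> comparison u \<bullet>\<^bsub>C\<^esub> ?b = pb1 C ?f ?a \<bullet>\<^bsub>C\<^esub> ?b"
        by (rule reassoc1[OF comparison_simps(4)[OF u]]) (use u r tc in simp_all)
      then show ?thesis unfolding 2 using u r tc by simp
    qed
    moreover have "(pb2 C ?f ?a \<bullet>\<^bsub>C\<^esub> ?b) \<bullet>\<^bsub>C\<^esub> comparison u = pb2 C ?f ?a"
    proof -
      have "(pb2 C ?f ?a \<bullet>\<^bsub>C\<^esub> ?b) \<bullet>\<^bsub>C\<^esub> comparison u = pb2 C ?f ?a \<bullet>\<^bsub>C\<^esub> ?b \<bullet>\<^bsub>C\<^esub> comparison u"
        by (rule assoc_simp) (use u r tc in simp_all)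
      then show ?thesis unfolding 1 using u by simp
    qed
    ultimately show ?thesis by metis
  qed
  then obtain e where "\<And>u. u \<in> Arr I \<Longrightarrow>
      is_pullback C (far D u) (lleg (lob \<theta> (Cod I u))) (lleg (lob \<theta> (Dom I u))) (e u) \<and>
      e u \<bullet>\<^bsub>C\<^esub> comparison u = pb2 C (far D u) (lleg (lob \<theta> (Cod I u)))"
    by metis
  then have "presented_family C I D d \<theta> e"
    by unfold_locales simp_all
  then show thesis by (rule that)
qed

context presented_family
begin

abbreviation "E \<equiv> \<lparr>fob = (\<lambda>i. Dom C (lleg (lob \<theta> i))), far = e\<rparr>"

lemma E_cartesian: "cartesian_transformation I C E D (\<lambda>i. lleg (lob \<theta> i))"
  by (simp add: cartesian_transformation_def hom_def e_pullback)

lemma E_cocone: "is_cocone I C E d (\<lambda>i. rleg (lob \<theta> i))"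
  by (simp add: is_cocone_def hom_def)

lemma E_functor_iff:
  "is_functor I C E \<longleftrightarrow>
     (\<forall>i\<in>Obj I. e (Idt I i) = Idt C (Dom C (lleg (lob \<theta> i)))) \<and>
     (\<forall>u\<in>Arr I. \<forall>v\<in>Arr I. Cod I u = Dom I v \<longrightarrow> e (v \<bullet>\<^bsub>I\<^esub> u) = e v \<bullet>\<^bsub>C\<^esub> e u)"
  by (simp add: is_functor_def hom_def)

lemma loose_transformation_if_functor:
  assumes E: "is_functor I C E"
  shows "pseudo_loose_transformation (loose_double I) S X Y \<theta>"
proof (rule pseudo_loose_transformation.intro, goal_cases)
  case (1 i) then show ?case by simp
next
  case 2 then show ?case by (auto simp: is_functor_def hom_def intro!: span_cell_eqI)
next
  case 3 then show ?case by auto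
next
  case (4 u i j) then show ?case using lloose_globular_iso[of u] by auto
next
  case (5 w u u' f g)
  then have A: "w \<in> Arr I" "u = w" "u' = w" "f = Dom I w" "g = Cod I w" by simp_all
  have h: "dcell X w \<star>\<^bsub>S\<^esub> ltight \<theta> (Cod I w) \<in> span_cells C"
    "ltight \<theta> (Dom I w) \<star>\<^bsub>S\<^esub> dcell Y w \<in> span_cells C"
    using A(1) by (auto intro!: hcomp_in)
  have a: "pb1 C (far D w) (lleg (lob \<theta> (Cod I w))) \<bullet>\<^bsub>C\<^esub> capx (dcell X w \<star>\<^bsub>S\<^esub> ltight \<theta> (Cod I w)) =
     pb1 C (far D w) (lleg (lob \<theta> (Cod I w)))"
    "pb2 C (far D w) (lleg (lob \<theta> (Cod I w))) \<bullet>\<^bsub>C\<^esub> capx (dcell X w \<star>\<^bsub>S\<^esub> ltight \<theta> (Cod I w)) =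
     pb2 C (far D w) (lleg (lob \<theta> (Cod I w)))"
    "pb1 C (rleg (lob \<theta> (Dom I w))) (Idt C d) \<bullet>\<^bsub>C\<^esub> capx (ltight \<theta> (Dom I w) \<star>\<^bsub>S\<^esub> dcell Y w) =
      pb1 C (rleg (lob \<theta> (Dom I w))) (Idt C d)"
    using A(1) by (simp_all add: hcomp_facts)
  have b: "capx (dcell X w \<star>\<^bsub>S\<^esub> ltight \<theta> (Cod I w)) = Idt C (Dom C (pb1 C (far D w) (lleg (lob \<theta> (Cod I w)))))"
    by (rule pb_joint_monic[of "far D w" "lleg (lob \<theta> (Cod I w))"]) (use A(1) a h in simp_all)
  have c: "capx (ltight \<theta> (Dom I w) \<star>\<^bsub>S\<^esub> dcell Y w) = Idt C (Dom C (pb1 C (rleg (lob \<theta> (Dom I w))) (Idt C d)))"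
    by (rule pb1_Idt_monic[of "rleg (lob \<theta> (Dom I w))" d]) (use A(1) a h in simp_all)
  show ?case unfolding A(2-5)
    by (rule cell_into_unit_comp_eqI[of "Dom I w"])
       (use A(1) h b c in simp_all)
next
  case (6 i)
  then have i: "i \<in> Obj I" by simp
  then have "e (Idt I i) = Idt C (Dom C (lleg (lob \<theta> i)))"
    using E unfolding E_functor_iff by blast
  with unit_law_iff[OF i] show ?case by (simp only: loose_double_simps span_double_simps)
next
  case (7 u i j v k)
  then have A: "u \<in> Arr I" "v \<in> Arr I" "Cod I u = Dom I v" "i = Dom I u" "j = Cod I u" "k = Cod I v"
    by simp_all
  then have "e (v \<bullet>\<^bsub>I\<^esub> u) = e v \<bullet>\<^bsub>C\<^esub> e u"
    using E unfolding E_functor_iff by blast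
  with comp_law_iff[OF A(1-3)] show ?case
    unfolding A(4-6) by (simp only: loose_double_simps span_double_simps)
qed

lemma functor_if_loose_transformation:
  assumes T: "pseudo_loose_transformation (loose_double I) S X Y \<theta>"
  shows "is_functor I C E"
  unfolding E_functor_iff
proof (intro conjI ballI impI)
  fix i assume i: "i \<in> Obj I"
  have "i \<in> Obj (tightcat (loose_double I))" using i by simp
  from pseudo_loose_transformation.lloose_unit[OF T this]
  show "e (Idt I i) = Idt C (Dom C (lleg (lob \<theta> i)))"
    using unit_law_iff[OF i] by (simp only: loose_double_simps span_double_simps simp_thms)
next
  fix u v assume A: "u \<in> Arr I" "v \<in> Arr I" "Cod I u = Dom I v"
  have "u \<in> lhom (loose_double I) (Dom I u) (Cod I u)" "v \<in> lhom (loose_double I) (Cod I u) (Cod I v)"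
    using A by simp_all
  from pseudo_loose_transformation.lloose_comp[OF T this]
  show "e (v \<bullet>\<^bsub>I\<^esub> u) = e v \<bullet>\<^bsub>C\<^esub> e u"
    using comp_law_iff[OF A] by (simp only: loose_double_simps span_double_simps simp_thms)
qed

end

context companion_setup
begin

text \<open>The passage from loose cocones to diagrams that are cartesian over \<open>D\<close>.\<close>

lemma loose_transformation_presented:
  assumes T: "pseudo_loose_transformation (loose_double I) (span_double C) X (diag (span_double C) d) \<theta>"
    and d: "d \<in> Obj C"
  obtains e where "presented_family C I D d \<theta> e"
    "is_functor I C \<lparr>fob = (\<lambda>i. Dom C (lleg (lob \<theta> i))), far = e\<rparr>"
proof -
  interpret T: pseudo_loose_transformation "loose_double I" "span_double C" X "diag (span_double C) d" \<theta>
    by (rule T)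
  have lob: "lob \<theta> i \<in> spans C" "Cod C (lleg (lob \<theta> i)) = fob D i" "Cod C (rleg (lob \<theta> i)) = d"
    if "i \<in> Obj I" for i
    using T.lob_lhom[of i] that by (simp_all add: diag_def)
  have lt: "ltight \<theta> i = idcell (span_double C) (lob \<theta> i)" if "i \<in> Obj I" for i
    using T.ltight_functor that by (simp add: is_functor_def)
  have iso: "globular_iso (span_double C) (span_comp C (companion C (far D u)) (lob \<theta> (Cod I u)))
     (span_comp C (lob \<theta> (Dom I u)) (span_unit C d)) (lloose \<theta> u)" if "u \<in> Arr I" for u
    using T.lloose_iso[of u "Dom I u" "Cod I u"] that by (simp add: diag_def)
  interpret F: loose_family C I D d \<theta>
  proof unfold_locales
    fix u assume u: "u \<in> Arr I"
    note i = iso[OF u, unfolded globular_iso_def, THEN conjunct1, unfolded cells_span]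
    show "lloose \<theta> u \<in> span_cells C"
      "csrc (lloose \<theta> u) = span_comp C (companion C (far D u)) (lob \<theta> (Cod I u))"
      "ctgt (lloose \<theta> u) = span_comp C (lob \<theta> (Dom I u)) (span_unit C d)"
      "clft (lloose \<theta> u) = Idt C (fob D (Dom I u))" "crgt (lloose \<theta> u) = Idt C d"
      using i u lob by simp_all
  qed (use d lob lt in simp_all)
  obtain e where e: "presented_family C I D d \<theta> e"
    by (rule F.globular_iso_lloose_presented) (use iso in simp)
  interpret e: presented_family C I D d \<theta> e by (rule e)
  show thesis using that[OF e] e.functor_if_loose_transformation[OF T] by simp
qed

text \<open>The passage back.  The cell at \<open>u : i \<rightarrow> j\<close> has to have the inverse of the canonical arrow from \<open>E i\<close> to the
pullback of \<open>E j\<close> along \<open>D u\<close> as its comparison.  This inverse is the arrow \<open>b u\<close> below, obtained from the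
pullback property of the naturality square of \<open>\<alpha>\<close>.\<close>

lemma presented_loose_transformation_exists:
  assumes E: "is_functor I C E" and \<alpha>: "cartesian_transformation I C E D \<alpha>"
    and \<beta>: "is_cocone I C E d \<beta>"
  obtains \<theta> where "\<And>i. lob \<theta> i = \<lparr>lleg = \<alpha> i, rleg = \<beta> i\<rparr>" "presented_family C I D d \<theta> (far E)"
    "pseudo_loose_transformation (loose_double I) (span_double C) X (diag (span_double C) d) \<theta>"
proof -
  have E' [simp]: "i \<in> Obj I \<Longrightarrow> fob E i \<in> Obj C"
    "u \<in> Arr I \<Longrightarrow> far E u \<in> Arr C"
    "u \<in> Arr I \<Longrightarrow> Dom C (far E u) = fob E (Dom I u)"
    "u \<in> Arr I \<Longrightarrow> Cod C (far E u) = fob E (Cod I u)" for i u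
    using E by (auto simp: is_functor_def hom_def)
  have \<alpha>' [simp]: "i \<in> Obj I \<Longrightarrow> \<alpha> i \<in> Arr C" "i \<in> Obj I \<Longrightarrow> Dom C (\<alpha> i) = fob E i"
    "i \<in> Obj I \<Longrightarrow> Cod C (\<alpha> i) = fob D i" for i
    using \<alpha> by (auto simp: cartesian_transformation_def hom_def)
  have pb: "is_pullback C (far D u) (\<alpha> (Cod I u)) (\<alpha> (Dom I u)) (far E u)" if "u \<in> Arr I" for u
    using \<alpha> that by (simp add: cartesian_transformation_def)
  have \<beta>' [simp]: "d \<in> Obj C" "i \<in> Obj I \<Longrightarrow> \<beta> i \<in> Arr C" "i \<in> Obj I \<Longrightarrow> Dom C (\<beta> i) = fob E i"
    "i \<in> Obj I \<Longrightarrow> Cod C (\<beta> i) = d"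
    "u \<in> Arr I \<Longrightarrow> \<beta> (Cod I u) \<bullet>\<^bsub>C\<^esub> far E u = \<beta> (Dom I u)" for i u
    using \<beta> by (auto simp: is_cocone_def hom_def)
  have "\<exists>b. b \<in> Arr C \<and> Dom C b = Dom C (pb1 C (far D u) (\<alpha> (Cod I u))) \<and> Cod C b = fob E (Dom I u) \<and>
      \<alpha> (Dom I u) \<bullet>\<^bsub>C\<^esub> b = pb1 C (far D u) (\<alpha> (Cod I u)) \<and>
      far E u \<bullet>\<^bsub>C\<^esub> b = pb2 C (far D u) (\<alpha> (Cod I u))" if u: "u \<in> Arr I" for u
  proof -
    let ?f = "far D u" and ?a = "\<alpha> (Cod I u)"
    have q: "pb1 C ?f ?a \<in> Arr C" "pb2 C ?f ?a \<in> Arr C" "Dom C (pb1 C ?f ?a) = Dom C (pb2 C ?f ?a)"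
      "Cod C (pb1 C ?f ?a) = Dom C ?f" "Cod C (pb2 C ?f ?a) = Dom C ?a"
      "?f \<bullet>\<^bsub>C\<^esub> pb1 C ?f ?a = ?a \<bullet>\<^bsub>C\<^esub> pb2 C ?f ?a"
      using u pb_square[of ?f ?a] by simp_all
    obtain b where "b \<in> Arr C" "Dom C b = Dom C (pb2 C ?f ?a)" "Cod C b = Dom C (\<alpha> (Dom I u))"
      "\<alpha> (Dom I u) \<bullet>\<^bsub>C\<^esub> b = pb1 C ?f ?a" "far E u \<bullet>\<^bsub>C\<^esub> b = pb2 C ?f ?a"
      by (rule pullback_lift[OF pb[OF u] q])
    then show ?thesis using u by (intro exI[of _ b]) simp
  qed
  then obtain b where b: "\<And>u. u \<in> Arr I \<Longrightarrow> b u \<in> Arr C \<and>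
      Dom C (b u) = Dom C (pb1 C (far D u) (\<alpha> (Cod I u))) \<and> Cod C (b u) = fob E (Dom I u) \<and>
      \<alpha> (Dom I u) \<bullet>\<^bsub>C\<^esub> b u = pb1 C (far D u) (\<alpha> (Cod I u)) \<and>
      far E u \<bullet>\<^bsub>C\<^esub> b u = pb2 C (far D u) (\<alpha> (Cod I u))"
    by metis
  then have b [simp]: "b u \<in> Arr C" "Dom C (b u) = Dom C (pb1 C (far D u) (\<alpha> (Cod I u)))"
      "Cod C (b u) = fob E (Dom I u)"
      "\<alpha> (Dom I u) \<bullet>\<^bsub>C\<^esub> b u = pb1 C (far D u) (\<alpha> (Cod I u))"
      "far E u \<bullet>\<^bsub>C\<^esub> b u = pb2 C (far D u) (\<alpha> (Cod I u))" if "u \<in> Arr I" for u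
    using that by blast+
  have \<beta>b [simp]: "\<beta> (Dom I u) \<bullet>\<^bsub>C\<^esub> b u = \<beta> (Cod I u) \<bullet>\<^bsub>C\<^esub> pb2 C (far D u) (\<alpha> (Cod I u))" if u: "u \<in> Arr I" for u
    using reassoc1[OF \<beta>'(5)[OF u], of "b u"] u by simp
  define t where "t i = \<lparr>lleg = \<alpha> i, rleg = \<beta> i\<rparr>" for i
  have t [simp]: "lleg (t i) = \<alpha> i" "rleg (t i) = \<beta> i" "i \<in> Obj I \<Longrightarrow> t i \<in> spans C" for i
    by (simp_all add: t_def in_spansI)
  define \<phi> where "\<phi> u = pbmed C (\<beta> (Dom I u)) (Idt C d) (b u)
      (\<beta> (Cod I u) \<bullet>\<^bsub>C\<^esub> pb2 C (far D u) (\<alpha> (Cod I u)))" for u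
  have \<phi> [simp]: "\<phi> u \<in> Arr C" "Dom C (\<phi> u) = Dom C (pb1 C (far D u) (\<alpha> (Cod I u)))"
    "Cod C (\<phi> u) = Dom C (pb1 C (\<beta> (Dom I u)) (Idt C d))"
    "pb1 C (\<beta> (Dom I u)) (Idt C d) \<bullet>\<^bsub>C\<^esub> \<phi> u = b u"
    "pb2 C (\<beta> (Dom I u)) (Idt C d) \<bullet>\<^bsub>C\<^esub> \<phi> u = \<beta> (Cod I u) \<bullet>\<^bsub>C\<^esub> pb2 C (far D u) (\<alpha> (Cod I u))"
    if "u \<in> Arr I" for u
    using that by (simp_all add: \<phi>_def)
  define \<theta> where "\<theta> = \<lparr>lob = t, ltight = (\<lambda>i. idcell (span_double C) (t i)),
     lloose = (\<lambda>u. globular_span_cell C (span_comp C (companion C (far D u)) (t (Cod I u)))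
       (span_comp C (t (Dom I u)) (span_unit C d)) (\<phi> u))\<rparr>"
  have \<theta>s: "lob \<theta> = t" "lloose \<theta> u = globular_span_cell C
      (span_comp C (companion C (far D u)) (t (Cod I u))) (span_comp C (t (Dom I u)) (span_unit C d)) (\<phi> u)" for u
    by (simp_all add: \<theta>_def)
  interpret F: loose_family C I D d \<theta>
  proof unfold_locales
    fix u assume u: "u \<in> Arr I"
    show "lloose \<theta> u \<in> span_cells C" unfolding \<theta>_def ltrans.simps
      by (rule globular_span_cell_in) (use u in simp_all)
  qed (simp_all add: \<theta>_def)
  interpret e: presented_family C I D d \<theta> "far E"
  proof unfold_locales
    fix u assume u: "u \<in> Arr I"
    show "is_pullback C (far D u) (lleg (lob \<theta> (Cod I u))) (lleg (lob \<theta> (Dom I u))) (far E u)"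
      using pb[OF u] by (simp add: \<theta>s)
    show "far E u \<bullet>\<^bsub>C\<^esub> F.comparison u = pb2 C (far D u) (lleg (lob \<theta> (Cod I u)))"
      unfolding F.comparison_def \<theta>s using u by simp
  qed
  have "is_functor I C e.E"
    using E unfolding e.E_functor_iff \<theta>s by (simp add: is_functor_def)
  from e.loose_transformation_if_functor[OF this]
  show thesis
    by (intro that[of \<theta>]) (simp_all add: \<theta>s t_def e.presented_family_axioms)
qed

end

section \<open>Modifications between loose cocones\<close>

context companion_setup
begin

text \<open>As for the coherence laws of loose cocones, both sides are determined by their projections to the apex of
\<open>\<theta>'\<^sub>i\<close>, which agree after the left leg.  After \<open>e' u\<close> they become the two sides of the naturality square
composed with the comparison of \<open>\<theta>\<close>, which is invertible.\<close>

lemma modification_naturality_iff: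
  assumes T: "presented_family C I D d \<theta> e" and T': "presented_family C I D d' \<theta>' e'"
    and f: "f \<in> hom C d d'"
    and \<mu>: "\<And>i. i \<in> Obj I \<Longrightarrow>
      \<mu> i \<in> cells (span_double C) (lob \<theta> i) (lob \<theta>' i) (Idt C (fob D i)) f"
    and u: "u \<in> Arr I"
  defines "S \<equiv> span_double C"
  shows "lloose \<theta>' u \<cdot>\<^bsub>S\<^esub> (idcell S (companion C (far D u)) \<star>\<^bsub>S\<^esub> \<mu> (Cod I u)) =
      (\<mu> (Dom I u) \<star>\<^bsub>S\<^esub> unitcell S f) \<cdot>\<^bsub>S\<^esub> lloose \<theta> u
    \<longleftrightarrow> e' u \<bullet>\<^bsub>C\<^esub> capx (\<mu> (Dom I u)) = capx (\<mu> (Cod I u)) \<bullet>\<^bsub>C\<^esub> e u" (is "?L = ?R \<longleftrightarrow> _")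
proof -
  interpret T: presented_family C I D d \<theta> e by (rule T)
  interpret T': presented_family C I D d' \<theta>' e' by (rule T')
  let ?i = "Dom I u" and ?j = "Cod I u"
  have f [simp]: "f \<in> Arr C" "Dom C f = d" "Cod C f = d'" using f by (auto simp: hom_def)
  have \<mu>' [simp]: "\<mu> i \<in> span_cells C" "csrc (\<mu> i) = lob \<theta> i" "ctgt (\<mu> i) = lob \<theta>' i"
    "clft (\<mu> i) = Idt C (fob D i)" "crgt (\<mu> i) = f" if "i \<in> Obj I" for i
    using \<mu>[OF that] by simp_all
  have cap [simp]: "capx (\<mu> i) \<in> Arr C" "Dom C (capx (\<mu> i)) = Dom C (lleg (lob \<theta> i))"
     "Cod C (capx (\<mu> i)) = Dom C (lleg (lob \<theta>' i))" 
     "lleg (lob \<theta>' i) \<bullet>\<^bsub>C\<^esub> capx (\<mu> i) = lleg (lob \<theta> i)" if "i \<in> Obj I" for i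
    using span_cells_simps(3-5,12)[OF \<mu>'(1)[OF that]] that by simp_all
  let ?p = "pb1 C (rleg (lob \<theta>' ?i)) (Idt C d')"
  have h: "idcell S (companion C (far D u)) \<star>\<^bsub>S\<^esub> \<mu> ?j \<in> span_cells C"
    "\<mu> ?i \<star>\<^bsub>S\<^esub> unitcell S f \<in> span_cells C"
    unfolding S_def using u by (auto intro!: hcomp_in)
  have h1: "capx (idcell S (companion C (far D u)) \<star>\<^bsub>S\<^esub> \<mu> ?j) \<in> Arr C"
    "Dom C (capx (idcell S (companion C (far D u)) \<star>\<^bsub>S\<^esub> \<mu> ?j)) = Dom C (pb1 C (far D u) (lleg (lob \<theta> ?j)))"
    "Cod C (capx (idcell S (companion C (far D u)) \<star>\<^bsub>S\<^esub> \<mu> ?j)) = Dom C (pb1 C (far D u) (lleg (lob \<theta>' ?j)))"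
    "pb1 C (far D u) (lleg (lob \<theta>' ?j)) \<bullet>\<^bsub>C\<^esub> capx (idcell S (companion C (far D u)) \<star>\<^bsub>S\<^esub> \<mu> ?j) =
      pb1 C (far D u) (lleg (lob \<theta> ?j))"
    "pb2 C (far D u) (lleg (lob \<theta>' ?j)) \<bullet>\<^bsub>C\<^esub> capx (idcell S (companion C (far D u)) \<star>\<^bsub>S\<^esub> \<mu> ?j) =
      capx (\<mu> ?j) \<bullet>\<^bsub>C\<^esub> pb2 C (far D u) (lleg (lob \<theta> ?j))"
    unfolding S_def using u by (simp_all add: hcomp_facts)
  have h2: "capx (\<mu> ?i \<star>\<^bsub>S\<^esub> unitcell S f) \<in> Arr C"
    "Dom C (capx (\<mu> ?i \<star>\<^bsub>S\<^esub> unitcell S f)) = Dom C (pb1 C (rleg (lob \<theta> ?i)) (Idt C d))"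
    "Cod C (capx (\<mu> ?i \<star>\<^bsub>S\<^esub> unitcell S f)) = Dom C ?p"
    "?p \<bullet>\<^bsub>C\<^esub> capx (\<mu> ?i \<star>\<^bsub>S\<^esub> unitcell S f) = capx (\<mu> ?i) \<bullet>\<^bsub>C\<^esub> pb1 C (rleg (lob \<theta> ?i)) (Idt C d)"
    unfolding S_def using u by (simp_all add: hcomp_facts)
  have Lc: "?L \<in> span_cells C" "csrc ?L = span_comp C (companion C (far D u)) (lob \<theta> ?j)"
    "ctgt ?L = span_comp C (lob \<theta>' ?i) (span_unit C d')" "clft ?L = Idt C (fob D ?i)" "crgt ?L = f"
    using u h unfolding S_def by simp_all
  have Rc: "?R \<in> span_cells C" "csrc ?R = span_comp C (companion C (far D u)) (lob \<theta> ?j)"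
    "ctgt ?R = span_comp C (lob \<theta>' ?i) (span_unit C d')" "clft ?R = Idt C (fob D ?i)" "crgt ?R = f"
    using u h unfolding S_def by simp_all
  have yL: "?p \<bullet>\<^bsub>C\<^esub> capx ?L = T'.comparison u \<bullet>\<^bsub>C\<^esub> capx (idcell S (companion C (far D u)) \<star>\<^bsub>S\<^esub> \<mu> ?j)"
    using T'.comparison_simps'(4)[OF u refl h1(1,3)] by (simp add: S_def)
  have yR: "?p \<bullet>\<^bsub>C\<^esub> capx ?R = capx (\<mu> ?i) \<bullet>\<^bsub>C\<^esub> T.comparison u"
  proof -
    have "?p \<bullet>\<^bsub>C\<^esub> capx ?R = (?p \<bullet>\<^bsub>C\<^esub> capx (\<mu> ?i \<star>\<^bsub>S\<^esub> unitcell S f)) \<bullet>\<^bsub>C\<^esub> capx (lloose \<theta> u)"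
      using u h2(1-3) by (simp add: S_def)
    then show ?thesis unfolding h2(4) using u by simp
  qed
  have eL: "e' u \<bullet>\<^bsub>C\<^esub> ?p \<bullet>\<^bsub>C\<^esub> capx ?L = (capx (\<mu> ?j) \<bullet>\<^bsub>C\<^esub> e u) \<bullet>\<^bsub>C\<^esub> T.comparison u"
    unfolding yL using T'.e_comparison'[OF u h1(1,3)] u h1(5) by simp
  have eR: "e' u \<bullet>\<^bsub>C\<^esub> ?p \<bullet>\<^bsub>C\<^esub> capx ?R = (e' u \<bullet>\<^bsub>C\<^esub> capx (\<mu> ?i)) \<bullet>\<^bsub>C\<^esub> T.comparison u"
    unfolding yR using u by simp
  show ?thesis
  proof
    assume "?L = ?R"
    then have eq: "(e' u \<bullet>\<^bsub>C\<^esub> capx (\<mu> ?i)) \<bullet>\<^bsub>C\<^esub> T.comparison u = (capx (\<mu> ?j) \<bullet>\<^bsub>C\<^esub> e u) \<bullet>\<^bsub>C\<^esub> T.comparison u"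
      using eL eR by simp
    show "e' u \<bullet>\<^bsub>C\<^esub> capx (\<mu> ?i) = capx (\<mu> ?j) \<bullet>\<^bsub>C\<^esub> e u"
      by (rule T.comparison_epi[OF u _ _ _ _ eq]) (use u in simp_all)
  next
    assume eq: "e' u \<bullet>\<^bsub>C\<^esub> capx (\<mu> ?i) = capx (\<mu> ?j) \<bullet>\<^bsub>C\<^esub> e u"
    have "lleg (lob \<theta>' ?i) \<bullet>\<^bsub>C\<^esub> T'.comparison u \<bullet>\<^bsub>C\<^esub> capx (idcell S (companion C (far D u)) \<star>\<^bsub>S\<^esub> \<mu> ?j) =
        pb1 C (far D u) (lleg (lob \<theta> ?j))"
      using T'.comparison_simps'(3)[OF u refl h1(1,3)] h1(4) by simp
    moreover have "lleg (lob \<theta>' ?i) \<bullet>\<^bsub>C\<^esub> capx (\<mu> ?i) \<bullet>\<^bsub>C\<^esub> T.comparison u = pb1 C (far D u) (lleg (lob \<theta> ?j))"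
      by (rule trans[OF reassoc1[OF cap(4)]]) (use u in simp_all)
    ultimately have l: "lleg (lob \<theta>' ?i) \<bullet>\<^bsub>C\<^esub> ?p \<bullet>\<^bsub>C\<^esub> capx ?L = lleg (lob \<theta>' ?i) \<bullet>\<^bsub>C\<^esub> ?p \<bullet>\<^bsub>C\<^esub> capx ?R"
      unfolding yL yR by (rule trans[OF _ sym])
    have ee: "e' u \<bullet>\<^bsub>C\<^esub> ?p \<bullet>\<^bsub>C\<^esub> capx ?L = e' u \<bullet>\<^bsub>C\<^esub> ?p \<bullet>\<^bsub>C\<^esub> capx ?R"
      unfolding eL eR eq ..
    have "?p \<bullet>\<^bsub>C\<^esub> capx ?L = ?p \<bullet>\<^bsub>C\<^esub> capx ?R"
      by (rule pullback_jointly_monic[OF T'.e_pullback[OF u] _ _ _ _ _ l ee], unfold yL yR)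
         (use u h1 in simp_all)
    then show "?L = ?R"
      using Lc Rc u by (intro T'.cell_into_unit_comp_eqI[of ?i]) simp_all
  qed
qed

lemma modifications_iff:
  assumes T: "presented_family C I D d \<theta> e" and T': "presented_family C I D d' \<theta>' e'"
    and f: "f \<in> hom C d d'"
  shows "\<mu> \<in> modifications (loose_double I) (span_double C) \<theta> \<theta>'
      (ttrans_id (span_double C) X) (diag_tight (span_double C) f) \<longleftrightarrow>
    \<mu> \<in> extensional (Obj I) \<and>
    (\<forall>i\<in>Obj I. \<mu> i \<in> cells (span_double C) (lob \<theta> i) (lob \<theta>' i) (Idt C (fob D i)) f) \<and>
    (\<forall>u\<in>Arr I. e' u \<bullet>\<^bsub>C\<^esub> capx (\<mu> (Dom I u)) = capx (\<mu> (Cod I u)) \<bullet>\<^bsub>C\<^esub> e u)"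
    (is "_ \<longleftrightarrow> ?ext \<and> ?cells \<and> ?nat")
proof -
  interpret T: presented_family C I D d \<theta> e by (rule T)
  interpret T': presented_family C I D d' \<theta>' e' by (rule T')
  have l: "\<mu> i \<cdot>\<^bsub>span_double C\<^esub> ltight \<theta> i = ltight \<theta>' i \<cdot>\<^bsub>span_double C\<^esub> \<mu> i"
    if "i \<in> Obj I" "\<mu> i \<in> cells (span_double C) (lob \<theta> i) (lob \<theta>' i) (Idt C (fob D i)) f" for i
    using that span_cells_simps(3-11)[of "\<mu> i"] by (intro span_cell_eqI) simp_all
  have "\<mu> \<in> modifications (loose_double I) (span_double C) \<theta> \<theta>'
      (ttrans_id (span_double C) X) (diag_tight (span_double C) f) \<longleftrightarrow>
    ?ext \<and> ?cells \<and>
    (\<forall>u\<in>Arr I. lloose \<theta>' u \<cdot>\<^bsub>span_double C\<^esub>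
        (idcell (span_double C) (companion C (far D u)) \<star>\<^bsub>span_double C\<^esub> \<mu> (Cod I u)) =
      (\<mu> (Dom I u) \<star>\<^bsub>span_double C\<^esub> unitcell (span_double C) f) \<cdot>\<^bsub>span_double C\<^esub> lloose \<theta> u)"
    using l unfolding modifications_def ttrans_id_def diag_tight_def by auto
  moreover have "?cells \<Longrightarrow> u \<in> Arr I \<Longrightarrow> (lloose \<theta>' u \<cdot>\<^bsub>span_double C\<^esub>
        (idcell (span_double C) (companion C (far D u)) \<star>\<^bsub>span_double C\<^esub> \<mu> (Cod I u)) =
      (\<mu> (Dom I u) \<star>\<^bsub>span_double C\<^esub> unitcell (span_double C) f) \<cdot>\<^bsub>span_double C\<^esub> lloose \<theta> u) \<longleftrightarrow>
     e' u \<bullet>\<^bsub>C\<^esub> capx (\<mu> (Dom I u)) = capx (\<mu> (Cod I u)) \<bullet>\<^bsub>C\<^esub> e u" for u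
    by (rule modification_naturality_iff[OF T T' f]) simp_all
  ultimately show ?thesis by (simp cong: conj_cong)
qed

end

section \<open>The loose cocone of a span out of the vertex\<close>

locale spans_under_cocone = cocone_setup C I D c \<eta>
  for C :: "('o, 'a) cat" and I :: "('i, 'j) cat" and D :: "('i, 'j, 'o, 'a) ftor"
    and c :: 'o and \<eta> :: "'i \<Rightarrow> 'a"
begin

declare unit_sq [simp del]

abbreviation "whisker \<equiv> cocone_map (loose_double I) (span_double C) X E"
abbreviation "whisker_cell \<equiv> cocone_map_cell (loose_double I) (span_double C) E"

text \<open>The arrow \<open>D i \<times>\<^sub>c x \<rightarrow> D j \<times>\<^sub>c x\<close> induced by \<open>D u\<close>, where \<open>x\<close> lies over \<open>c\<close> by the left leg of \<open>m\<close>.\<close>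

definition induced :: "'a span \<Rightarrow> 'j \<Rightarrow> 'a" where
  "induced m u = pbmed C (\<eta> (Cod I u)) (lleg m)
     (far D u \<bullet>\<^bsub>C\<^esub> pb1 C (\<eta> (Dom I u)) (lleg m)) (pb2 C (\<eta> (Dom I u)) (lleg m))"

lemma induced_simps [simp]:
  assumes "m \<in> spans C" "Cod C (lleg m) = c" "u \<in> Arr I"
  shows "induced m u \<in> Arr C" "Dom C (induced m u) = Dom C (pb1 C (\<eta> (Dom I u)) (lleg m))"
    "Cod C (induced m u) = Dom C (pb1 C (\<eta> (Cod I u)) (lleg m))"
    "pb1 C (\<eta> (Cod I u)) (lleg m) \<bullet>\<^bsub>C\<^esub> induced m u = far D u \<bullet>\<^bsub>C\<^esub> pb1 C (\<eta> (Dom I u)) (lleg m)"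
    "pb2 C (\<eta> (Cod I u)) (lleg m) \<bullet>\<^bsub>C\<^esub> induced m u = pb2 C (\<eta> (Dom I u)) (lleg m)"
proof -
  have "\<eta> (Cod I u) \<bullet>\<^bsub>C\<^esub> far D u \<bullet>\<^bsub>C\<^esub> pb1 C (\<eta> (Dom I u)) (lleg m) =
      lleg m \<bullet>\<^bsub>C\<^esub> pb2 C (\<eta> (Dom I u)) (lleg m)"
    using assms by (simp add: eta_reassoc pb_square)
  then show "induced m u \<in> Arr C" "Dom C (induced m u) = Dom C (pb1 C (\<eta> (Dom I u)) (lleg m))"
    "Cod C (induced m u) = Dom C (pb1 C (\<eta> (Cod I u)) (lleg m))"
    "pb1 C (\<eta> (Cod I u)) (lleg m) \<bullet>\<^bsub>C\<^esub> induced m u = far D u \<bullet>\<^bsub>C\<^esub> pb1 C (\<eta> (Dom I u)) (lleg m)"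
    "pb2 C (\<eta> (Cod I u)) (lleg m) \<bullet>\<^bsub>C\<^esub> induced m u = pb2 C (\<eta> (Dom I u)) (lleg m)"
    using assms by (simp_all add: induced_def)
qed

lemma induced_pullback:
  assumes m: "m \<in> spans C" "Cod C (lleg m) = c" and u: "u \<in> Arr I"
  shows "is_pullback C (far D u) (pb1 C (\<eta> (Cod I u)) (lleg m)) (pb1 C (\<eta> (Dom I u)) (lleg m)) (induced m u)"
proof (rule is_pullback_left_cancel)
  show "is_pullback C (\<eta> (Cod I u)) (lleg m) (pb1 C (\<eta> (Cod I u)) (lleg m)) (pb2 C (\<eta> (Cod I u)) (lleg m))"
    by (rule is_pullback_pb) (use m u in simp_all)
  have "is_pullback C (\<eta> (Dom I u)) (lleg m) (pb1 C (\<eta> (Dom I u)) (lleg m)) (pb2 C (\<eta> (Dom I u)) (lleg m))"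
    by (rule is_pullback_pb) (use m u in simp_all)
  then show "is_pullback C (\<eta> (Cod I u) \<bullet>\<^bsub>C\<^esub> far D u) (lleg m)
      (pb1 C (\<eta> (Dom I u)) (lleg m)) (pb2 C (\<eta> (Dom I u)) (lleg m))"
    using u by simp
qed (use m u in simp_all)

lemma whisker_lob: "lob (whisker m) i = span_comp C (companion C (\<eta> i)) m"
  and whisker_ltight: "ltight (whisker m) i =
    idcell (span_double C) (companion C (\<eta> i)) \<star>\<^bsub>span_double C\<^esub> idcell (span_double C) m"
  and whisker_lloose: "lloose (whisker m) u =
     inverse_arr (span_cellcat C) (assoc (span_double C) (companion C (\<eta> (Dom I u))) m (span_unit C (Cod C (rleg m))))
     \<cdot>\<^bsub>span_double C\<^esub> (idcell (span_double C) (companion C (\<eta> (Dom I u))) \<star>\<^bsub>span_double C\<^esub>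
        (inverse_arr (span_cellcat C) (runit (span_double C) m) \<cdot>\<^bsub>span_double C\<^esub> lunit (span_double C) m))
     \<cdot>\<^bsub>span_double C\<^esub> assoc (span_double C) (companion C (\<eta> (Dom I u))) (span_unit C (Cod C (lleg m))) m
     \<cdot>\<^bsub>span_double C\<^esub> (lloose E u \<star>\<^bsub>span_double C\<^esub> idcell (span_double C) m)
     \<cdot>\<^bsub>span_double C\<^esub> inverse_arr (span_cellcat C)
         (assoc (span_double C) (companion C (far D u)) (companion C (\<eta> (Cod I u))) m)"
  by (simp_all add: cocone_map_def ltrans_comp_def diag_def diag_loose_def Let_def
      del: lunit_simps span_cellcat_simps(10))

text \<open>The cell at \<open>u\<close> of the whiskered cocone is a composite of five cells.  Its comparison is the arrow
\<open>D i \<times>\<^bsub>D j\<^esub> (D j \<times>\<^sub>c x) \<rightarrow> D i \<times>\<^sub>c x\<close> that forgets the middle component: the projection to \<open>D i\<close> is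
dictated by the boundary, and the projection to \<open>x\<close> is followed through the five cells.\<close>

lemma whisker_presented:
  assumes m: "m \<in> spans C" "Cod C (lleg m) = c"
  shows "presented_family C I D (Cod C (rleg m)) (whisker m) (induced m)"
proof -
  interpret S: pseudo_double_category "span_double C" by (rule span_double_category)
  let ?d = "Cod C (rleg m)"
  have cell: "lloose (whisker m) u \<in> span_cells C"
      "csrc (lloose (whisker m) u) = span_comp C (companion C (far D u)) (lob (whisker m) (Cod I u))"
      "ctgt (lloose (whisker m) u) = span_comp C (lob (whisker m) (Dom I u)) (span_unit C ?d)"
      "clft (lloose (whisker m) u) = Idt C (fob D (Dom I u))"
      "crgt (lloose (whisker m) u) = Idt C ?d"
      "pb2 C (\<eta> (Dom I u)) (lleg m) \<bullet>\<^bsub>C\<^esub> pb1 C (rleg (lob (whisker m) (Dom I u))) (Idt C ?d) \<bullet>\<^bsub>C\<^esub>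
        capx (lloose (whisker m) u) =
       pb2 C (\<eta> (Cod I u)) (lleg m) \<bullet>\<^bsub>C\<^esub> pb2 C (far D u) (pb1 C (\<eta> (Cod I u)) (lleg m))"
    if u: "u \<in> Arr I" for u
  proof -
    let ?i = "companion C (\<eta> (Dom I u))" and ?j = "companion C (\<eta> (Cod I u))" and ?u = "companion C (far D u)"
      and ?c = "span_unit C c" and ?U = "span_unit C ?d"
    have sp: "?i \<in> spans C" "?j \<in> spans C" "?u \<in> spans C" "?c \<in> spans C" "?U \<in> spans C"
      using u m by simp_all
    have c: "Cod C (rleg ?i) = Cod C (lleg m)" "Cod C (rleg m) = Cod C (lleg ?U)"
      "Cod C (rleg ?i) = Cod C (lleg ?c)" "Cod C (rleg ?c) = Cod C (lleg m)"
      "Cod C (rleg ?u) = Cod C (lleg ?j)" "Cod C (rleg ?j) = Cod C (lleg m)"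
      using u m by simp_all
    note a1 = inverse_assoc_capx[OF sp(1) m(1) sp(5) c(1,2)] inverse_assoc_boundary[OF sp(1) m(1) sp(5) c(1,2)]
    note a2 = assoc_capx[OF sp(1,4) m(1) c(3,4)]
    note a3 = inverse_assoc_capx[OF sp(3,2) m(1) c(5,6)] inverse_assoc_boundary[OF sp(3,2) m(1) c(5,6)]
    note r = inverse_runit_boundary[OF m(1)] inverse_runit_capx[OF m(1)]
    note E = lloose_E(1-5)[OF u]
    \<comment> \<open>named in order to keep the simplifier from unfolding the unitors inside the whiskered cell\<close>
    define R where "R = inverse_arr (span_cellcat C) (runit (span_double C) m) \<cdot>\<^bsub>span_double C\<^esub> lunit (span_double C) m"
    have R: "R \<in> span_cells C" "csrc R = span_comp C ?c m" "ctgt R = span_comp C m ?U"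
      "clft R = Idt C c" "crgt R = Idt C ?d"
      unfolding R_def using m r by (simp_all add: lunit_boundary del: lunit_simps)
    have Rc: "pb1 C (rleg m) (Idt C ?d) \<bullet>\<^bsub>C\<^esub> capx R = pb2 C (Idt C c) (lleg m)"
      unfolding R_def using m r by simp
    have Rc': "pb1 C (rleg m) (Idt C ?d) \<bullet>\<^bsub>C\<^esub> capx R \<bullet>\<^bsub>C\<^esub> z = pb2 C (Idt C c) (lleg m) \<bullet>\<^bsub>C\<^esub> z"
      if "z \<in> Arr C" "Cod C z = Dom C (pb1 C (Idt C c) (lleg m))" for z
      by (rule reassoc1[OF Rc]) (use R m that in simp_all)
    have h: "idcell (span_double C) ?i \<star>\<^bsub>span_double C\<^esub> R \<in> span_cells C"
      "lloose E u \<star>\<^bsub>span_double C\<^esub> idcell (span_double C) m \<in> span_cells C"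
      using u m R E by (auto intro!: hcomp_in)
    note w = whisker_lloose[of m u, folded R_def, unfolded m(2)]
    show "lloose (whisker m) u \<in> span_cells C"
      "csrc (lloose (whisker m) u) = span_comp C ?u (lob (whisker m) (Cod I u))"
      "ctgt (lloose (whisker m) u) = span_comp C (lob (whisker m) (Dom I u)) ?U"
      "clft (lloose (whisker m) u) = Idt C (fob D (Dom I u))"
      "crgt (lloose (whisker m) u) = Idt C ?d"
      unfolding w whisker_lob using h u m R E a1(10-14) a2(10-14) a3(10-14) by simp_all
    show "pb2 C (\<eta> (Dom I u)) (lleg m) \<bullet>\<^bsub>C\<^esub> pb1 C (rleg (lob (whisker m) (Dom I u))) (Idt C ?d) \<bullet>\<^bsub>C\<^esub>
        capx (lloose (whisker m) u) =
       pb2 C (\<eta> (Cod I u)) (lleg m) \<bullet>\<^bsub>C\<^esub> pb2 C (far D u) (pb1 C (\<eta> (Cod I u)) (lleg m))"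
      unfolding w whisker_lob using h u m R Rc' E a1 a2 a3 by (simp add: hcomp_facts)
  qed
  interpret F: loose_family C I D ?d "whisker m"
  proof unfold_locales
    fix i assume i: "i \<in> Obj I"
    show "ltight (whisker m) i = idcell (span_double C) (lob (whisker m) i)"
      unfolding whisker_ltight whisker_lob
      using S.hcomp_idcell[of "companion C (\<eta> i)" "fob D i" c m ?d] i m by simp
    show "lob (whisker m) i \<in> spans C" "Cod C (lleg (lob (whisker m) i)) = fob D i"
      "Cod C (rleg (lob (whisker m) i)) = ?d"
      unfolding whisker_lob using i m by simp_all
  qed (use m cell in simp_all)
  show ?thesis
  proof unfold_locales
    fix u assume u: "u \<in> Arr I"
    have l: "lleg (lob (whisker m) i) = pb1 C (\<eta> i) (lleg m)" if "i \<in> Obj I" for i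
      unfolding whisker_lob using that m by simp
    have ll: "lleg (lob (whisker m) (Cod I u)) = pb1 C (\<eta> (Cod I u)) (lleg m)"
      "lleg (lob (whisker m) (Dom I u)) = pb1 C (\<eta> (Dom I u)) (lleg m)"
      using l u by simp_all
    show "is_pullback C (far D u) (lleg (lob (whisker m) (Cod I u))) (lleg (lob (whisker m) (Dom I u))) (induced m u)"
      unfolding ll by (rule induced_pullback[OF m u])
    note cmp = F.comparison_simps(1-4)[OF u, unfolded ll]
    have 2: "pb2 C (\<eta> (Dom I u)) (lleg m) \<bullet>\<^bsub>C\<^esub> F.comparison u =
       pb2 C (\<eta> (Cod I u)) (lleg m) \<bullet>\<^bsub>C\<^esub> pb2 C (far D u) (pb1 C (\<eta> (Cod I u)) (lleg m))"
      using cell(6)[OF u] by (simp add: F.comparison_def del: F.comparison_simps')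
    show "induced m u \<bullet>\<^bsub>C\<^esub> F.comparison u = pb2 C (far D u) (lleg (lob (whisker m) (Cod I u)))"
      unfolding ll
    proof (rule pb_joint_monic[of "\<eta> (Cod I u)" "lleg m"])
      have "pb1 C (\<eta> (Cod I u)) (lleg m) \<bullet>\<^bsub>C\<^esub> induced m u \<bullet>\<^bsub>C\<^esub> F.comparison u =
          far D u \<bullet>\<^bsub>C\<^esub> pb1 C (\<eta> (Dom I u)) (lleg m) \<bullet>\<^bsub>C\<^esub> F.comparison u"
        by (rule reassoc[OF induced_simps(4)[OF m u]]) (use m u cmp in simp_all)
      then show "pb1 C (\<eta> (Cod I u)) (lleg m) \<bullet>\<^bsub>C\<^esub> induced m u \<bullet>\<^bsub>C\<^esub> F.comparison u =
          pb1 C (\<eta> (Cod I u)) (lleg m) \<bullet>\<^bsub>C\<^esub> pb2 C (far D u) (pb1 C (\<eta> (Cod I u)) (lleg m))"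
        unfolding cmp(4) using pb_square[of "far D u" "pb1 C (\<eta> (Cod I u)) (lleg m)"] u m by simp
      have "pb2 C (\<eta> (Cod I u)) (lleg m) \<bullet>\<^bsub>C\<^esub> induced m u \<bullet>\<^bsub>C\<^esub> F.comparison u =
          pb2 C (\<eta> (Dom I u)) (lleg m) \<bullet>\<^bsub>C\<^esub> F.comparison u"
        by (rule reassoc1[OF induced_simps(5)[OF m u]]) (use m u cmp in simp_all)
      then show "pb2 C (\<eta> (Cod I u)) (lleg m) \<bullet>\<^bsub>C\<^esub> induced m u \<bullet>\<^bsub>C\<^esub> F.comparison u =
          pb2 C (\<eta> (Cod I u)) (lleg m) \<bullet>\<^bsub>C\<^esub> pb2 C (far D u) (pb1 C (\<eta> (Cod I u)) (lleg m))"
        unfolding 2 .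
    qed (use m u cmp in simp_all)
  qed
qed

end

text \<open>Hence globular modifications are the special case \<open>f = 1\<close> of \<open>modifications_iff\<close>.\<close>

lemma (in companion_setup) ttrans_id_diag:
  assumes "d \<in> Obj C"
  shows "ttrans_id (span_double C) (diag (span_double C) d) = diag_tight (span_double C) (Idt C d)"
proof -
  have "idcell (span_double C) (span_unit C d) = unitcell (span_double C) (Idt C d)"
    by (rule span_cell_eqI) (use assms in simp_all)
  then show ?thesis by (simp add: ttrans_id_def diag_tight_def diag_def)
qed

text \<open>An isomorphism of diagrams over \<open>D\<close> that respects the cocones is an invertible globular modification.
The inverse family is automatically natural and compatible with the legs.\<close>

lemma (in companion_setup) ltrans_isomorphicI:
  assumes T: "presented_family C I D d \<theta> e" and T': "presented_family C I D d \<theta>' e'"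
    and k: "\<And>i. i \<in> Obj I \<Longrightarrow> inverse_arrows C (k i) (k' i)"
      "\<And>i. i \<in> Obj I \<Longrightarrow> Dom C (k i) = Dom C (lleg (lob \<theta> i))"
      "\<And>i. i \<in> Obj I \<Longrightarrow> Cod C (k i) = Dom C (lleg (lob \<theta>' i))"
      "\<And>i. i \<in> Obj I \<Longrightarrow> lleg (lob \<theta>' i) \<bullet>\<^bsub>C\<^esub> k i = lleg (lob \<theta> i)"
      "\<And>i. i \<in> Obj I \<Longrightarrow> rleg (lob \<theta>' i) \<bullet>\<^bsub>C\<^esub> k i = rleg (lob \<theta> i)"
      "\<And>u. u \<in> Arr I \<Longrightarrow> e' u \<bullet>\<^bsub>C\<^esub> k (Dom I u) = k (Cod I u) \<bullet>\<^bsub>C\<^esub> e u"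
  shows "ltrans_isomorphic (loose_double I) (span_double C) X (diag (span_double C) d) \<theta> \<theta>'"
proof -
  interpret T: presented_family C I D d \<theta> e by (rule T)
  interpret T': presented_family C I D d \<theta>' e' by (rule T')
  let ?S = "span_double C"
  have id: "Idt C d \<in> hom C d d" by (rule Idt_hom) simp
  have ks [simp]: "k i \<in> Arr C" "k' i \<in> Arr C" "Dom C (k i) = Dom C (lleg (lob \<theta> i))"
    "Cod C (k i) = Dom C (lleg (lob \<theta>' i))" "Dom C (k' i) = Dom C (lleg (lob \<theta>' i))"
    "Cod C (k' i) = Dom C (lleg (lob \<theta> i))" "k' i \<bullet>\<^bsub>C\<^esub> k i = Idt C (Dom C (lleg (lob \<theta> i)))"
    "k i \<bullet>\<^bsub>C\<^esub> k' i = Idt C (Dom C (lleg (lob \<theta>' i)))" if "i \<in> Obj I" for i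
    using k(1-3)[OF that] by (auto simp: inverse_arrows_def hom_def)
  have k'l: "lleg (lob \<theta> i) \<bullet>\<^bsub>C\<^esub> k' i = lleg (lob \<theta>' i)" "rleg (lob \<theta> i) \<bullet>\<^bsub>C\<^esub> k' i = rleg (lob \<theta>' i)"
    if i: "i \<in> Obj I" for i
  proof -
    have "lleg (lob \<theta>' i) \<bullet>\<^bsub>C\<^esub> k i \<bullet>\<^bsub>C\<^esub> k' i = lleg (lob \<theta> i) \<bullet>\<^bsub>C\<^esub> k' i"
      by (rule reassoc1[OF k(4)[OF i]]) (use i in simp_all)
    then show "lleg (lob \<theta> i) \<bullet>\<^bsub>C\<^esub> k' i = lleg (lob \<theta>' i)" using i by simp
    have "rleg (lob \<theta>' i) \<bullet>\<^bsub>C\<^esub> k i \<bullet>\<^bsub>C\<^esub> k' i = rleg (lob \<theta> i) \<bullet>\<^bsub>C\<^esub> k' i"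
      by (rule reassoc1[OF k(5)[OF i]]) (use i in simp_all)
    then show "rleg (lob \<theta> i) \<bullet>\<^bsub>C\<^esub> k' i = rleg (lob \<theta>' i)" using i by simp
  qed
  have k'n: "e u \<bullet>\<^bsub>C\<^esub> k' (Dom I u) = k' (Cod I u) \<bullet>\<^bsub>C\<^esub> e' u" if u: "u \<in> Arr I" for u
  proof -
    have "k' (Cod I u) \<bullet>\<^bsub>C\<^esub> e' u = k' (Cod I u) \<bullet>\<^bsub>C\<^esub> (e' u \<bullet>\<^bsub>C\<^esub> k (Dom I u)) \<bullet>\<^bsub>C\<^esub> k' (Dom I u)"
      using u by simp
    also have "\<dots> = (k' (Cod I u) \<bullet>\<^bsub>C\<^esub> k (Cod I u)) \<bullet>\<^bsub>C\<^esub> e u \<bullet>\<^bsub>C\<^esub> k' (Dom I u)"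
      unfolding k(6)[OF u] using u by (simp del: ks(7))
    also have "\<dots> = e u \<bullet>\<^bsub>C\<^esub> k' (Dom I u)" using u by simp
    finally show ?thesis by simp
  qed
  define \<mu> where "\<mu> = (\<lambda>i\<in>Obj I. globular_span_cell C (lob \<theta> i) (lob \<theta>' i) (k i))"
  define \<nu> where "\<nu> = (\<lambda>i\<in>Obj I. globular_span_cell C (lob \<theta>' i) (lob \<theta> i) (k' i))"
  have \<mu>: "\<mu> i = globular_span_cell C (lob \<theta> i) (lob \<theta>' i) (k i)"
    and \<nu>: "\<nu> i = globular_span_cell C (lob \<theta>' i) (lob \<theta> i) (k' i)" if "i \<in> Obj I" for i
    using that by (simp_all add: \<mu>_def \<nu>_def)
  have "\<mu> \<in> modifications (loose_double I) ?S \<theta> \<theta>' (ttrans_id ?S X) (diag_tight ?S (Idt C d))"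
    unfolding modifications_iff[OF T T' id]
    using k(4-6) by (simp add: \<mu>) (simp add: \<mu>_def)
  moreover have "\<nu> \<in> modifications (loose_double I) ?S \<theta>' \<theta> (ttrans_id ?S X) (diag_tight ?S (Idt C d))"
    unfolding modifications_iff[OF T' T id]
    using k'l k'n by (simp add: \<nu>) (simp add: \<nu>_def)
  moreover have "\<nu> i \<cdot>\<^bsub>?S\<^esub> \<mu> i = idcell ?S (lob \<theta> i)" "\<mu> i \<cdot>\<^bsub>?S\<^esub> \<nu> i = idcell ?S (lob \<theta>' i)"
    if "i \<in> Obj I" for i
    using that by (auto simp: \<mu> \<nu> intro!: span_cell_eqI)
  ultimately show ?thesis
    unfolding ltrans_isomorphic_def ttrans_id_diag[OF T.vertex] by auto
qed

context spans_under_cocone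
begin

sublocale base_cocone C I D c \<eta>
  by unfold_locales (rule cocone)

abbreviation "p1 m i \<equiv> pb1 C (\<eta> i) (lleg m)"
abbreviation "p2 m i \<equiv> pb2 C (\<eta> i) (lleg m)"

lemma whisker_legs [simp]:
  assumes "m \<in> spans C" "Cod C (lleg m) = c" "i \<in> Obj I"
  shows "lleg (lob (whisker m) i) = p1 m i" "rleg (lob (whisker m) i) = rleg m \<bullet>\<^bsub>C\<^esub> p2 m i"
    "lob (whisker m) i \<in> spans C"
  unfolding whisker_lob using assms by simp_all

lemma p_square:
  assumes "m \<in> spans C" "Cod C (lleg m) = c" "i \<in> Obj I"
  shows "is_pullback C (lleg m) (\<eta> i) (p2 m i) (p1 m i)" "is_pullback C (\<eta> i) (lleg m) (p1 m i) (p2 m i)"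
proof -
  show "is_pullback C (\<eta> i) (lleg m) (p1 m i) (p2 m i)"
    by (rule is_pullback_pb) (use assms in simp_all)
  then show "is_pullback C (lleg m) (\<eta> i) (p2 m i) (p1 m i)" by (rule is_pullback_sym)
qed

definition pulled_back_diagram :: "'a span \<Rightarrow> ('i, 'j, 'o, 'a) ftor" where
  "pulled_back_diagram m = \<lparr>fob = (\<lambda>i. Dom C (p1 m i)), far = induced m\<rparr>"

lemma pulled_back_cocone:
  assumes m: "m \<in> spans C" "Cod C (lleg m) = c"
  shows "pullback_cocone I C D c \<eta> (pulled_back_diagram m) (p1 m) (Dom C (lleg m)) (p2 m) (lleg m)"
  unfolding pullback_cocone_def
proof (intro conjI ballI)
  have "induced m (Idt I i) = Idt C (Dom C (p1 m i))" if i: "i \<in> Obj I" for i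
    by (rule pb_joint_monic[of "\<eta> i" "lleg m"])
       (use m i induced_simps[OF m, of "Idt I i"] in simp_all)
  moreover have "induced m (v \<bullet>\<^bsub>I\<^esub> u) = induced m v \<bullet>\<^bsub>C\<^esub> induced m u"
    if uv: "u \<in> Arr I" "v \<in> Arr I" "Cod I u = Dom I v" for u v
  proof (rule pb_joint_monic[of "\<eta> (Cod I v)" "lleg m"])
    have vu: "v \<bullet>\<^bsub>I\<^esub> u \<in> Arr I" "Dom I (v \<bullet>\<^bsub>I\<^esub> u) = Dom I u" "Cod I (v \<bullet>\<^bsub>I\<^esub> u) = Cod I v"
      using uv by simp_all
    note s = induced_simps[OF m vu(1), unfolded vu(2,3)]
    have "p1 m (Cod I v) \<bullet>\<^bsub>C\<^esub> induced m v \<bullet>\<^bsub>C\<^esub> induced m u = far D v \<bullet>\<^bsub>C\<^esub> p1 m (Dom I v) \<bullet>\<^bsub>C\<^esub> induced m u"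
      by (rule reassoc[OF induced_simps(4)[OF m uv(2)]]) (use m uv induced_simps[OF m uv(1)] in simp_all)
    also have "\<dots> = far D v \<bullet>\<^bsub>C\<^esub> far D u \<bullet>\<^bsub>C\<^esub> p1 m (Dom I u)"
      using induced_simps(4)[OF m uv(1)] uv(3) by simp
    finally show "p1 m (Cod I v) \<bullet>\<^bsub>C\<^esub> induced m (v \<bullet>\<^bsub>I\<^esub> u) = p1 m (Cod I v) \<bullet>\<^bsub>C\<^esub> induced m v \<bullet>\<^bsub>C\<^esub> induced m u"
      unfolding s(4) using m uv by simp
    have "p2 m (Cod I v) \<bullet>\<^bsub>C\<^esub> induced m v \<bullet>\<^bsub>C\<^esub> induced m u = p2 m (Dom I v) \<bullet>\<^bsub>C\<^esub> induced m u"
      by (rule reassoc1[OF induced_simps(5)[OF m uv(2)]]) (use m uv induced_simps[OF m uv(1)] in simp_all)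
    then show "p2 m (Cod I v) \<bullet>\<^bsub>C\<^esub> induced m (v \<bullet>\<^bsub>I\<^esub> u) = p2 m (Cod I v) \<bullet>\<^bsub>C\<^esub> induced m v \<bullet>\<^bsub>C\<^esub> induced m u"
      unfolding s(5) using induced_simps(5)[OF m uv(1)] uv(3) by simp
  qed (use m uv induced_simps[OF m uv(1)] induced_simps[OF m, of "v \<bullet>\<^bsub>I\<^esub> u"] in simp_all)
  ultimately show "is_functor I C (pulled_back_diagram m)"
    using m by (simp add: is_functor_def pulled_back_diagram_def hom_def)
  show "cartesian_transformation I C (pulled_back_diagram m) D (p1 m)"
    using m induced_pullback[OF m]
    by (simp add: cartesian_transformation_def pulled_back_diagram_def hom_def)
  show "is_cocone I C (pulled_back_diagram m) (Dom C (lleg m)) (p2 m)"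
    using m by (simp add: is_cocone_def pulled_back_diagram_def hom_def)
  show "lleg m \<in> hom C (Dom C (lleg m)) c" using m by (simp add: hom_def)
  show "is_pullback C (lleg m) (\<eta> i) (p2 m i) (p1 m i)" if "i \<in> Obj I" for i
    using p_square[OF m that] by simp
qed

section \<open>Loose colimits of companion diagrams\<close>

definition represents_loose_cocones :: bool where
  "represents_loose_cocones \<longleftrightarrow> (\<forall>d\<in>Obj C. \<forall>\<theta>.
     pseudo_loose_transformation (loose_double I) (span_double C) X (diag (span_double C) d) \<theta> \<longrightarrow>
       (\<exists>m\<in>lhom (span_double C) c d.
          ltrans_isomorphic (loose_double I) (span_double C) X (diag (span_double C) d) \<theta> (whisker m)))"

definition represents_modifications :: bool where
  "represents_modifications \<longleftrightarrow> (\<forall>d d' f m m'.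
     f \<in> hom C d d' \<and> m \<in> lhom (span_double C) c d \<and> m' \<in> lhom (span_double C) c d' \<longrightarrow>
        bij_betw (cocone_map_cell (loose_double I) (span_double C) E)
          (cells (span_double C) m m' (Idt C c) f)
          (modifications (loose_double I) (span_double C) (whisker m) (whisker m')
             (ttrans_id (span_double C) X) (diag_tight (span_double C) f)))"

lemma loose_colimit_cocone_iff:
  "loose_colimit_cocone (loose_double I) (span_double C) X c E \<longleftrightarrow>
     represents_loose_cocones \<and> represents_modifications"
  using companion_loose_cocone
  by (simp add: loose_colimit_cocone_def loose_cocone_def represents_loose_cocones_def
      represents_modifications_def del: lhom_span cells_span)

text \<open>The span has the legs \<open>h\<close> and \<open>g\<close> of the pullback cocone through which the cocone of \<open>\<theta>\<close> factors.  The
isomorphism compares the two pullbacks of \<open>h\<close> along \<open>\<eta> i\<close>.\<close>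

lemma factor_imp_represents:
  assumes fac: "cocones_factor_through_pullbacks I C D c \<eta>"
  shows represents_loose_cocones
  unfolding represents_loose_cocones_def
proof (intro ballI allI impI)
  fix d \<theta>
  assume d: "d \<in> Obj C"
    and \<theta>: "pseudo_loose_transformation (loose_double I) (span_double C) X (diag (span_double C) d) \<theta>"
  obtain e where T: "presented_family C I D d \<theta> e"
    and Fe: "is_functor I C \<lparr>fob = (\<lambda>i. Dom C (lleg (lob \<theta> i))), far = e\<rparr>"
    by (rule loose_transformation_presented[OF \<theta> d])
  interpret T: presented_family C I D d \<theta> e by (rule T)
  obtain x l h g where pc: "pullback_cocone I C D c \<eta> T.E (\<lambda>i. lleg (lob \<theta> i)) x l h"
    and g: "g \<in> hom C x d" "\<forall>i\<in>Obj I. g \<bullet>\<^bsub>C\<^esub> l i = rleg (lob \<theta> i)"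
    using fac Fe T.E_cartesian T.E_cocone unfolding cocones_factor_through_pullbacks_def by blast
  note pcd = pullback_coconeD[OF pc]
  define m where "m = \<lparr>lleg = h, rleg = g\<rparr>"
  have m: "m \<in> spans C" "lleg m = h" "rleg m = g" "Cod C (lleg m) = c" "Cod C (rleg m) = d"
    using pcd(4) g(1) by (auto simp: m_def hom_def intro: in_spansI)
  note m' = m(1,4)
  have T': "presented_family C I D d (whisker m) (induced m)"
    using whisker_presented[OF m'] m(5) by simp
  have "\<exists>b b'. inverse_arrows C b b' \<and> Dom C b = Dom C (lleg (lob \<theta> i)) \<and> Cod C b = Dom C (p1 m i) \<and>
      p1 m i \<bullet>\<^bsub>C\<^esub> b = lleg (lob \<theta> i) \<and> p2 m i \<bullet>\<^bsub>C\<^esub> b = l i" if i: "i \<in> Obj I" for i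
  proof -
    have pb: "is_pullback C (\<eta> i) (lleg m) (lleg (lob \<theta> i)) (l i)"
      using is_pullback_sym[OF pcd(5)[OF i]] m(2) by simp
    show ?thesis
      by (rule pullback_comparison_iso[OF p_square(2)[OF m' i] pb]) blast
  qed
  then obtain k k' where k: "\<And>i. i \<in> Obj I \<Longrightarrow> inverse_arrows C (k i) (k' i) \<and>
      Dom C (k i) = Dom C (lleg (lob \<theta> i)) \<and> Cod C (k i) = Dom C (p1 m i) \<and>
      p1 m i \<bullet>\<^bsub>C\<^esub> k i = lleg (lob \<theta> i) \<and> p2 m i \<bullet>\<^bsub>C\<^esub> k i = l i"
    by metis
  have kA: "k i \<in> Arr C" if "i \<in> Obj I" for i
    using k[OF that] by (simp add: inverse_arrows_def)
  have nat: "induced m u \<bullet>\<^bsub>C\<^esub> k (Dom I u) = k (Cod I u) \<bullet>\<^bsub>C\<^esub> e u" if u: "u \<in> Arr I" for u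
  proof (rule pb_joint_monic[of "\<eta> (Cod I u)" "lleg m"])
    note s = induced_simps[OF m' u]
    have ij: "Dom I u \<in> Obj I" "Cod I u \<in> Obj I" using u by simp_all
    note ki = k[OF ij(1)] kA[OF ij(1)] and kj = k[OF ij(2)] kA[OF ij(2)]
    have 1: "p1 m (Cod I u) \<bullet>\<^bsub>C\<^esub> induced m u \<bullet>\<^bsub>C\<^esub> k (Dom I u) = far D u \<bullet>\<^bsub>C\<^esub> p1 m (Dom I u) \<bullet>\<^bsub>C\<^esub> k (Dom I u)"
      by (rule reassoc[OF s(4)]) (use m' u s ki in simp_all)
    have 2: "p1 m (Cod I u) \<bullet>\<^bsub>C\<^esub> k (Cod I u) \<bullet>\<^bsub>C\<^esub> e u = lleg (lob \<theta> (Cod I u)) \<bullet>\<^bsub>C\<^esub> e u"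
      by (rule reassoc1) (use m' u kj in simp_all)
    show "p1 m (Cod I u) \<bullet>\<^bsub>C\<^esub> induced m u \<bullet>\<^bsub>C\<^esub> k (Dom I u) = p1 m (Cod I u) \<bullet>\<^bsub>C\<^esub> k (Cod I u) \<bullet>\<^bsub>C\<^esub> e u"
      unfolding 1 2 using ki u by simp
    have 3: "p2 m (Cod I u) \<bullet>\<^bsub>C\<^esub> induced m u \<bullet>\<^bsub>C\<^esub> k (Dom I u) = p2 m (Dom I u) \<bullet>\<^bsub>C\<^esub> k (Dom I u)"
      by (rule reassoc1[OF s(5)]) (use m' u s ki in simp_all)
    have 4: "p2 m (Cod I u) \<bullet>\<^bsub>C\<^esub> k (Cod I u) \<bullet>\<^bsub>C\<^esub> e u = l (Cod I u) \<bullet>\<^bsub>C\<^esub> e u"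
      by (rule reassoc1) (use m' u kj in simp_all)
    have "l (Cod I u) \<bullet>\<^bsub>C\<^esub> e u = l (Dom I u)"
      using pcd(3) u by (simp add: is_cocone_def)
    then show "p2 m (Cod I u) \<bullet>\<^bsub>C\<^esub> induced m u \<bullet>\<^bsub>C\<^esub> k (Dom I u) = p2 m (Cod I u) \<bullet>\<^bsub>C\<^esub> k (Cod I u) \<bullet>\<^bsub>C\<^esub> e u"
      unfolding 3 4 using ki by simp
    show "Cod C (induced m u \<bullet>\<^bsub>C\<^esub> k (Dom I u)) = Dom C (pb1 C (\<eta> (Cod I u)) (lleg m))"
      "induced m u \<bullet>\<^bsub>C\<^esub> k (Dom I u) \<in> Arr C" "k (Cod I u) \<bullet>\<^bsub>C\<^esub> e u \<in> Arr C"
      "Dom C (induced m u \<bullet>\<^bsub>C\<^esub> k (Dom I u)) = Dom C (k (Cod I u) \<bullet>\<^bsub>C\<^esub> e u)"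
      "Cod C (k (Cod I u) \<bullet>\<^bsub>C\<^esub> e u) = Dom C (pb1 C (\<eta> (Cod I u)) (lleg m))"
      using u s ki kj by simp_all
  qed (use m' u in simp_all)
  have gl: "rleg m \<bullet>\<^bsub>C\<^esub> p2 m i \<bullet>\<^bsub>C\<^esub> k i = rleg (lob \<theta> i)" if i: "i \<in> Obj I" for i
    using k[OF i] g(2) m(3) i by simp
  have "ltrans_isomorphic (loose_double I) (span_double C) X (diag (span_double C) d) \<theta> (whisker m)"
    by (rule ltrans_isomorphicI[OF T T', of k k']) (use m' k kA gl nat in simp_all)
  then show "\<exists>m\<in>lhom (span_double C) c d.
      ltrans_isomorphic (loose_double I) (span_double C) X (diag (span_double C) d) \<theta> (whisker m)"
    using m by (intro bexI[of _ m]) simp_all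
qed

text \<open>An invertible modification from the loose cocone of \<open>(E', \<alpha>, \<beta>)\<close> to the whiskering with \<open>m\<close> makes
\<open>E' i\<close> a pullback of the left leg of \<open>m\<close> along \<open>\<eta> i\<close>; the pullback cocone \<open>l\<close> is this isomorphism followed by
the second projection.\<close>

lemma represents_imp_factor:
  assumes rep: represents_loose_cocones
  shows "cocones_factor_through_pullbacks I C D c \<eta>"
  unfolding cocones_factor_through_pullbacks_def
proof (intro allI impI, elim conjE)
  fix E' \<alpha> d \<beta>
  assume E': "is_functor I C E'" and \<alpha>: "cartesian_transformation I C E' D \<alpha>"
    and \<beta>: "is_cocone I C E' d \<beta>"
  have d: "d \<in> Obj C" using \<beta> by (simp add: is_cocone_def)
  obtain \<theta> where lob: "\<And>i. lob \<theta> i = \<lparr>lleg = \<alpha> i, rleg = \<beta> i\<rparr>" and T: "presented_family C I D d \<theta> (far E')"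
    and \<theta>: "pseudo_loose_transformation (loose_double I) (span_double C) X (diag (span_double C) d) \<theta>"
    using presented_loose_transformation_exists[OF E' \<alpha> \<beta>] by blast
  interpret T: presented_family C I D d \<theta> "far E'" by (rule T)
  obtain m where "m \<in> lhom (span_double C) c d" and
    iso: "ltrans_isomorphic (loose_double I) (span_double C) X (diag (span_double C) d) \<theta> (whisker m)"
    using rep d \<theta> unfolding represents_loose_cocones_def by blast
  then have m: "m \<in> spans C" "Cod C (lleg m) = c" "Cod C (rleg m) = d" by simp_all
  have T': "presented_family C I D d (whisker m) (induced m)"
    using whisker_presented[OF m(1,2)] m(3) by simp
  have id: "Idt C d \<in> hom C d d" by (rule Idt_hom[OF d])
  obtain \<mu> \<nu> where "\<mu> \<in> modifications (loose_double I) (span_double C) \<theta> (whisker m)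
      (ttrans_id (span_double C) X) (diag_tight (span_double C) (Idt C d))"
    and "\<nu> \<in> modifications (loose_double I) (span_double C) (whisker m) \<theta>
      (ttrans_id (span_double C) X) (diag_tight (span_double C) (Idt C d))"
    and inv: "\<And>i. i \<in> Obj I \<Longrightarrow> \<nu> i \<cdot>\<^bsub>span_double C\<^esub> \<mu> i = idcell (span_double C) (lob \<theta> i) \<and>
       \<mu> i \<cdot>\<^bsub>span_double C\<^esub> \<nu> i = idcell (span_double C) (lob (whisker m) i)"
    using iso unfolding ltrans_isomorphic_def ttrans_id_diag[OF d] by auto
  note \<mu> = this(1)[unfolded modifications_iff[OF T T' id]] and \<nu> = this(2)[unfolded modifications_iff[OF T' T id]]
  define k where "k i = capx (\<mu> i)" for i
  define l where "l i = p2 m i \<bullet>\<^bsub>C\<^esub> k i" for i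
  have \<alpha>s: "Dom C (\<alpha> i) = fob E' i" if "i \<in> Obj I" for i
    using \<alpha> that by (simp add: cartesian_transformation_def hom_def)
  have k: "k i \<in> Arr C" "Dom C (k i) = fob E' i" "Cod C (k i) = Dom C (p1 m i)"
     "p1 m i \<bullet>\<^bsub>C\<^esub> k i = \<alpha> i" "rleg m \<bullet>\<^bsub>C\<^esub> l i = \<beta> i" "inverse_arrows C (k i) (capx (\<nu> i))"
    if i: "i \<in> Obj I" for i
  proof -
    have \<mu>i: "\<mu> i \<in> span_cells C" "csrc (\<mu> i) = lob \<theta> i" "ctgt (\<mu> i) = lob (whisker m) i"
      "clft (\<mu> i) = Idt C (fob D i)" "crgt (\<mu> i) = Idt C d"
      using \<mu> i by simp_all
    have \<nu>i: "\<nu> i \<in> span_cells C" "csrc (\<nu> i) = lob (whisker m) i" "ctgt (\<nu> i) = lob \<theta> i"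
      using \<nu> i by simp_all
    have lt: "lob \<theta> i \<in> spans C" "Cod C (\<alpha> i) = fob D i" "Cod C (\<beta> i) = d"
      "\<alpha> i \<in> Arr C" "\<beta> i \<in> Arr C"
      using T.lob_simps[OF i] spans_simps(1,2)[OF T.lob_simps(1)[OF i]] by (simp_all add: lob)
    note c = span_cells_simps(3-5,12,13)[OF \<mu>i(1), unfolded \<mu>i]
    show kk: "k i \<in> Arr C" "Dom C (k i) = fob E' i" "Cod C (k i) = Dom C (p1 m i)"
      "p1 m i \<bullet>\<^bsub>C\<^esub> k i = \<alpha> i"
      using c i m \<alpha>s lt by (simp_all add: k_def lob)
    show "rleg m \<bullet>\<^bsub>C\<^esub> l i = \<beta> i"
      using c(5) kk(1-3) i m lt by (simp add: l_def lob k_def)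
    note c' = span_cells_simps(3-5)[OF \<nu>i(1), unfolded \<nu>i]
    show "inverse_arrows C (k i) (capx (\<nu> i))"
      using kk c' arg_cong[OF inv[OF i, THEN conjunct1], of capx] arg_cong[OF inv[OF i, THEN conjunct2], of capx]
        i m lt \<alpha>s T.lob_simps[OF i]
      by (auto simp: inverse_arrows_def hom_def k_def lob)
  qed
  have nat: "induced m u \<bullet>\<^bsub>C\<^esub> k (Dom I u) = k (Cod I u) \<bullet>\<^bsub>C\<^esub> far E' u" if "u \<in> Arr I" for u
    using \<mu> that by (simp add: k_def)
  have "l (Cod I u) \<bullet>\<^bsub>C\<^esub> far E' u = l (Dom I u)" if u: "u \<in> Arr I" for u
  proof -
    have eu: "far E' u \<in> Arr C" "Dom C (far E' u) = fob E' (Dom I u)" "Cod C (far E' u) = fob E' (Cod I u)"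
      using E' u by (auto simp: is_functor_def hom_def)
    have "l (Cod I u) \<bullet>\<^bsub>C\<^esub> far E' u = p2 m (Cod I u) \<bullet>\<^bsub>C\<^esub> induced m u \<bullet>\<^bsub>C\<^esub> k (Dom I u)"
      unfolding l_def nat[OF u] by (rule assoc_simp) (use u m k eu in simp_all)
    also have "\<dots> = l (Dom I u)"
      unfolding l_def by (rule reassoc1[OF induced_simps(5)[OF m(1,2) u]]) (use u m k induced_simps[OF m(1,2) u] in simp_all)
    finally show ?thesis .
  qed
  then have lc: "is_cocone I C E' (Dom C (lleg m)) l"
    using m k by (simp add: is_cocone_def hom_def l_def)
  have "is_pullback C (lleg m) (\<eta> i) (l i) (\<alpha> i)" if i: "i \<in> Obj I" for i
    using is_pullback_precomp_iso[OF p_square(1)[OF m(1,2) i] k(6)[OF i]] k(3,4)[OF i] m i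
    by (simp add: l_def)
  then have "pullback_cocone I C D c \<eta> E' \<alpha> (Dom C (lleg m)) l (lleg m)"
    using E' \<alpha> lc m by (simp add: pullback_cocone_def hom_def)
  moreover have "rleg m \<in> hom C (Dom C (lleg m)) d" using m by (simp add: hom_def)
  ultimately show "\<exists>x l h g. pullback_cocone I C D c \<eta> E' \<alpha> x l h \<and> g \<in> hom C x d \<and>
      (\<forall>i\<in>Obj I. g \<bullet>\<^bsub>C\<^esub> l i = \<beta> i)"
    using k(5) by blast
qed

end

lemma bij_betw_iff_unique_preimage:
  "bij_betw f A B \<longleftrightarrow> f ` A \<subseteq> B \<and> (\<forall>y\<in>B. \<exists>!x. x \<in> A \<and> f x = y)"
  unfolding bij_betw_def inj_on_def by (auto 0 4)

text \<open>The boundary of a cell \<open>m \<rightarrow> m'\<close> between spans out of \<open>c\<close>, with identity left boundary.\<close>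

locale span_pair = spans_under_cocone C I D c \<eta>
  for C :: "('o, 'a) cat" and I :: "('i, 'j) cat" and D :: "('i, 'j, 'o, 'a) ftor"
    and c :: 'o and \<eta> :: "'i \<Rightarrow> 'a" +
  fixes m m' :: "'a span" and d d' :: 'o and f :: 'a
  assumes m: "m \<in> lhom (span_double C) c d" and m': "m' \<in> lhom (span_double C) c d'"
    and f: "f \<in> hom C d d'"
begin

abbreviation "W \<equiv> modifications (loose_double I) (span_double C) (whisker m) (whisker m')
             (ttrans_id (span_double C) X) (diag_tight (span_double C) f)"

lemma m_simps [simp]: "m \<in> spans C" "Cod C (lleg m) = c" "Cod C (rleg m) = d"
  "m' \<in> spans C" "Cod C (lleg m') = c" "Cod C (rleg m') = d'"
  "f \<in> Arr C" "Dom C f = d" "Cod C f = d'"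
  using m m' f by (simp_all add: hom_def)

lemma W_iff:
  "\<mu> \<in> W \<longleftrightarrow> \<mu> \<in> extensional (Obj I) \<and>
    (\<forall>i\<in>Obj I. \<mu> i \<in> cells (span_double C) (lob (whisker m) i) (lob (whisker m') i) (Idt C (fob D i)) f) \<and>
    (\<forall>u\<in>Arr I. induced m' u \<bullet>\<^bsub>C\<^esub> capx (\<mu> (Dom I u)) = capx (\<mu> (Cod I u)) \<bullet>\<^bsub>C\<^esub> induced m u)"
  using modifications_iff[of d "whisker m" "induced m" d' "whisker m'" "induced m'" f \<mu>]
    whisker_presented[of m] whisker_presented[of m'] f by simp

lemma W_capx:
  assumes "\<mu> \<in> W" "i \<in> Obj I"
  shows "capx (\<mu> i) \<in> Arr C" "Dom C (capx (\<mu> i)) = Dom C (p1 m i)" "Cod C (capx (\<mu> i)) = Dom C (p1 m' i)"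
    "p1 m' i \<bullet>\<^bsub>C\<^esub> capx (\<mu> i) = p1 m i"
    "rleg m' \<bullet>\<^bsub>C\<^esub> p2 m' i \<bullet>\<^bsub>C\<^esub> capx (\<mu> i) = f \<bullet>\<^bsub>C\<^esub> rleg m \<bullet>\<^bsub>C\<^esub> p2 m i"
proof -
  have s: "\<mu> i \<in> span_cells C" "csrc (\<mu> i) = lob (whisker m) i" "ctgt (\<mu> i) = lob (whisker m') i"
    "clft (\<mu> i) = Idt C (fob D i)" "crgt (\<mu> i) = f"
    using assms unfolding W_iff by simp_all
  note c = span_cells_simps(3-5,12,13)[OF s(1), unfolded s]
  show a: "capx (\<mu> i) \<in> Arr C" "Dom C (capx (\<mu> i)) = Dom C (p1 m i)" "Cod C (capx (\<mu> i)) = Dom C (p1 m' i)"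
    "p1 m' i \<bullet>\<^bsub>C\<^esub> capx (\<mu> i) = p1 m i"
    using c assms(2) by simp_all
  show "rleg m' \<bullet>\<^bsub>C\<^esub> p2 m' i \<bullet>\<^bsub>C\<^esub> capx (\<mu> i) = f \<bullet>\<^bsub>C\<^esub> rleg m \<bullet>\<^bsub>C\<^esub> p2 m i"
    using c(5) a(1-3) assms(2) by simp
qed

lemma whisker_cell_facts:
  assumes s: "s \<in> cells (span_double C) m m' (Idt C c) f" and i: "i \<in> Obj I"
  shows "whisker_cell s i \<in> cells (span_double C) (lob (whisker m) i) (lob (whisker m') i) (Idt C (fob D i)) f"
    "p1 m' i \<bullet>\<^bsub>C\<^esub> capx (whisker_cell s i) = p1 m i"
    "p2 m' i \<bullet>\<^bsub>C\<^esub> capx (whisker_cell s i) = capx s \<bullet>\<^bsub>C\<^esub> p2 m i"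
proof -
  have w: "whisker_cell s i = idcell (span_double C) (companion C (\<eta> i)) \<star>\<^bsub>span_double C\<^esub> s"
    using i by (simp add: cocone_map_cell_def)
  have s': "s \<in> span_cells C" "csrc s = m" "ctgt s = m'" "clft s = Idt C c" "crgt s = f"
    using s by simp_all
  show "whisker_cell s i \<in> cells (span_double C) (lob (whisker m) i) (lob (whisker m') i) (Idt C (fob D i)) f"
    "p1 m' i \<bullet>\<^bsub>C\<^esub> capx (whisker_cell s i) = p1 m i"
    "p2 m' i \<bullet>\<^bsub>C\<^esub> capx (whisker_cell s i) = capx s \<bullet>\<^bsub>C\<^esub> p2 m i"
    unfolding w whisker_lob using s' i by (simp_all add: hcomp_facts)
qed

lemma whisker_cell_in_W:
  assumes s: "s \<in> cells (span_double C) m m' (Idt C c) f"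
  shows "whisker_cell s \<in> W"
  unfolding W_iff
proof (intro conjI ballI)
  show "whisker_cell s \<in> extensional (Obj I)" by (simp add: cocone_map_cell_def)
  show "whisker_cell s i \<in> cells (span_double C) (lob (whisker m) i) (lob (whisker m') i) (Idt C (fob D i)) f"
    if "i \<in> Obj I" for i by (rule whisker_cell_facts(1)[OF s that])
  fix u assume u: "u \<in> Arr I"
  let ?i = "Dom I u" and ?j = "Cod I u"
  have ij: "?i \<in> Obj I" "?j \<in> Obj I" using u by simp_all
  have w: "capx (whisker_cell s i) \<in> Arr C" "Dom C (capx (whisker_cell s i)) = Dom C (p1 m i)"
    "Cod C (capx (whisker_cell s i)) = Dom C (p1 m' i)" if i: "i \<in> Obj I" for i
  proof -
    have c: "whisker_cell s i \<in> span_cells C" "csrc (whisker_cell s i) = lob (whisker m) i"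
      "ctgt (whisker_cell s i) = lob (whisker m') i"
      using whisker_cell_facts(1)[OF s i] by simp_all
    show "capx (whisker_cell s i) \<in> Arr C" "Dom C (capx (whisker_cell s i)) = Dom C (p1 m i)"
    "Cod C (capx (whisker_cell s i)) = Dom C (p1 m' i)"
      using span_cells_simps(3-5)[OF c(1), unfolded c] i by simp_all
  qed
  have s': "capx s \<in> Arr C" "Dom C (capx s) = Dom C (lleg m)" "Cod C (capx s) = Dom C (lleg m')"
    using s by auto
  note wi = w[OF ij(1)] whisker_cell_facts(2,3)[OF s ij(1)] and wj = w[OF ij(2)] whisker_cell_facts(2,3)[OF s ij(2)]
  note n = induced_simps[OF m_simps(1,2) u] and n' = induced_simps[OF m_simps(4,5) u]
  show "induced m' u \<bullet>\<^bsub>C\<^esub> capx (whisker_cell s ?i) = capx (whisker_cell s ?j) \<bullet>\<^bsub>C\<^esub> induced m u"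
  proof (rule pb_joint_monic[of "\<eta> ?j" "lleg m'"])
    have "p1 m' ?j \<bullet>\<^bsub>C\<^esub> induced m' u \<bullet>\<^bsub>C\<^esub> capx (whisker_cell s ?i) = far D u \<bullet>\<^bsub>C\<^esub> p1 m' ?i \<bullet>\<^bsub>C\<^esub> capx (whisker_cell s ?i)"
      by (rule reassoc[OF n'(4)]) (use u n' wi(1-3) in simp_all)
    also have "\<dots> = p1 m ?j \<bullet>\<^bsub>C\<^esub> induced m u" unfolding wi(4) n(4) ..
    also have "\<dots> = p1 m' ?j \<bullet>\<^bsub>C\<^esub> capx (whisker_cell s ?j) \<bullet>\<^bsub>C\<^esub> induced m u"
      by (rule reassoc1[OF wj(4), symmetric]) (use u n wj(1-3) in simp_all)
    finally show "p1 m' ?j \<bullet>\<^bsub>C\<^esub> induced m' u \<bullet>\<^bsub>C\<^esub> capx (whisker_cell s ?i) =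
      p1 m' ?j \<bullet>\<^bsub>C\<^esub> capx (whisker_cell s ?j) \<bullet>\<^bsub>C\<^esub> induced m u" .
    have "p2 m' ?j \<bullet>\<^bsub>C\<^esub> induced m' u \<bullet>\<^bsub>C\<^esub> capx (whisker_cell s ?i) = p2 m' ?i \<bullet>\<^bsub>C\<^esub> capx (whisker_cell s ?i)"
      by (rule reassoc1[OF n'(5)]) (use u n' wi(1-3) in simp_all)
    also have "\<dots> = capx s \<bullet>\<^bsub>C\<^esub> p2 m ?j \<bullet>\<^bsub>C\<^esub> induced m u" unfolding wi(5) n(5) ..
    also have "\<dots> = p2 m' ?j \<bullet>\<^bsub>C\<^esub> capx (whisker_cell s ?j) \<bullet>\<^bsub>C\<^esub> induced m u"
      by (rule reassoc[OF wj(5), symmetric]) (use u n wj(1-3) s' in simp_all)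
    finally show "p2 m' ?j \<bullet>\<^bsub>C\<^esub> induced m' u \<bullet>\<^bsub>C\<^esub> capx (whisker_cell s ?i) =
      p2 m' ?j \<bullet>\<^bsub>C\<^esub> capx (whisker_cell s ?j) \<bullet>\<^bsub>C\<^esub> induced m u" .
  qed (use u n n' wi(1-3) wj(1-3) in simp_all)
qed

text \<open>The first projections of both sides are prescribed by the left boundary, so the second projections decide.\<close>

lemma whisker_cell_eq_iff:
  assumes s: "s \<in> cells (span_double C) m m' (Idt C c) f" and \<mu>: "\<mu> \<in> W"
  shows "whisker_cell s = \<mu> \<longleftrightarrow> (\<forall>i\<in>Obj I. capx s \<bullet>\<^bsub>C\<^esub> p2 m i = p2 m' i \<bullet>\<^bsub>C\<^esub> capx (\<mu> i))"
proof
  assume "whisker_cell s = \<mu>"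
  then show "\<forall>i\<in>Obj I. capx s \<bullet>\<^bsub>C\<^esub> p2 m i = p2 m' i \<bullet>\<^bsub>C\<^esub> capx (\<mu> i)"
    using whisker_cell_facts(3)[OF s] by auto
next
  assume eq: "\<forall>i\<in>Obj I. capx s \<bullet>\<^bsub>C\<^esub> p2 m i = p2 m' i \<bullet>\<^bsub>C\<^esub> capx (\<mu> i)"
  note w = whisker_cell_in_W[OF s]
  show "whisker_cell s = \<mu>"
  proof (rule extensionalityI[of _ "Obj I"])
    show "whisker_cell s \<in> extensional (Obj I)" "\<mu> \<in> extensional (Obj I)"
      using w \<mu> unfolding W_iff by simp_all
    fix i assume i: "i \<in> Obj I"
    have "capx (whisker_cell s i) = capx (\<mu> i)"
      by (rule pb_joint_monic[of "\<eta> i" "lleg m'"])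
         (use i W_capx[OF w i] W_capx[OF \<mu> i] whisker_cell_facts(3)[OF s i] eq in simp_all)
    then show "whisker_cell s i = \<mu> i"
      using w \<mu> i unfolding W_iff by (intro span_cell_eqI) simp_all
  qed
qed

text \<open>A cell with the given boundary is an arrow between the apices that is compatible with the legs.\<close>

lemma bij_whisker_cell_iff:
  "bij_betw whisker_cell (cells (span_double C) m m' (Idt C c) f) W \<longleftrightarrow>
   (\<forall>\<mu>\<in>W. \<exists>!k. k \<in> hom C (Dom C (lleg m)) (Dom C (lleg m')) \<and> lleg m' \<bullet>\<^bsub>C\<^esub> k = lleg m \<and>
      rleg m' \<bullet>\<^bsub>C\<^esub> k = f \<bullet>\<^bsub>C\<^esub> rleg m \<and> (\<forall>i\<in>Obj I. k \<bullet>\<^bsub>C\<^esub> p2 m i = p2 m' i \<bullet>\<^bsub>C\<^esub> capx (\<mu> i)))"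
proof -
  let ?cells = "cells (span_double C) m m' (Idt C c) f"
  let ?K = "\<lambda>\<mu> k. k \<in> hom C (Dom C (lleg m)) (Dom C (lleg m')) \<and> lleg m' \<bullet>\<^bsub>C\<^esub> k = lleg m \<and>
      rleg m' \<bullet>\<^bsub>C\<^esub> k = f \<bullet>\<^bsub>C\<^esub> rleg m \<and> (\<forall>i\<in>Obj I. k \<bullet>\<^bsub>C\<^esub> p2 m i = p2 m' i \<bullet>\<^bsub>C\<^esub> capx (\<mu> i))"
  define mk where "mk k = \<lparr>csrc = m, ctgt = m', capx = k, clft = Idt C c, crgt = f\<rparr>" for k
  have to_arrow: "?K \<mu> (capx s)" if "s \<in> ?cells" "whisker_cell s = \<mu>" "\<mu> \<in> W" for s \<mu>
  proof -
    have s: "s \<in> span_cells C" "csrc s = m" "ctgt s = m'" "clft s = Idt C c" "crgt s = f"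
      using that(1) by simp_all
    show ?thesis
      using span_cells_simps(3-5,12,13)[OF s(1), unfolded s] whisker_cell_eq_iff[OF that(1,3)] that(2)
      by (simp add: hom_def)
  qed
  have from_arrow: "mk k \<in> ?cells \<and> whisker_cell (mk k) = \<mu>" if "?K \<mu> k" "\<mu> \<in> W" for k \<mu>
  proof -
    have "mk k \<in> ?cells"
      using that(1) by (auto simp: mk_def hom_def intro!: in_span_cellsI)
    moreover then have "whisker_cell (mk k) = \<mu>"
      using whisker_cell_eq_iff[OF _ that(2), of "mk k"] that(1) by (simp add: mk_def)
    ultimately show ?thesis by blast
  qed
  have mk: "mk (capx s) = s" if "s \<in> ?cells" for s
    using that by (intro span_cell_eqI) (auto simp: mk_def)
  have capx_mk: "capx (mk k) = k" for k by (simp add: mk_def)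
  have key: "(\<exists>!s. s \<in> ?cells \<and> whisker_cell s = \<mu>) \<longleftrightarrow> (\<exists>!k. ?K \<mu> k)" if \<mu>: "\<mu> \<in> W" for \<mu>
  proof
    assume "\<exists>!s. s \<in> ?cells \<and> whisker_cell s = \<mu>"
    then obtain s where s: "s \<in> ?cells" "whisker_cell s = \<mu>"
      and un: "\<And>t. t \<in> ?cells \<Longrightarrow> whisker_cell t = \<mu> \<Longrightarrow> t = s" by blast
    show "\<exists>!k. ?K \<mu> k"
    proof (rule ex1I[of _ "capx s"])
      show "?K \<mu> (capx s)" by (rule to_arrow[OF s \<mu>])
      show "k = capx s" if "?K \<mu> k" for k
        using un[of "mk k"] from_arrow[OF that \<mu>] capx_mk[of k] by simp
    qed
  next
    assume "\<exists>!k. ?K \<mu> k"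
    then obtain k where k: "?K \<mu> k" and un: "\<And>k'. ?K \<mu> k' \<Longrightarrow> k' = k" by blast
    show "\<exists>!s. s \<in> ?cells \<and> whisker_cell s = \<mu>"
    proof (rule ex1I[of _ "mk k"])
      show "mk k \<in> ?cells \<and> whisker_cell (mk k) = \<mu>" by (rule from_arrow[OF k \<mu>])
      show "s = mk k" if "s \<in> ?cells \<and> whisker_cell s = \<mu>" for s
        using un[of "capx s"] to_arrow[of s \<mu>] mk[of s] that \<mu> by metis
    qed
  qed
  have "whisker_cell ` ?cells \<subseteq> W"
    by (rule image_subsetI) (rule whisker_cell_in_W)
  moreover have "(\<forall>\<mu>\<in>W. \<exists>!s. s \<in> ?cells \<and> whisker_cell s = \<mu>) \<longleftrightarrow> (\<forall>\<mu>\<in>W. \<exists>!k. ?K \<mu> k)"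
    by (rule ball_cong[OF refl key])
  ultimately show ?thesis
    unfolding bij_betw_iff_unique_preimage by (simp only: simp_thms)
qed

end

context spans_under_cocone
begin

text \<open>A modification gives the cocone \<open>l'\<close> of its second projections on the pulled-back diagram of \<open>m\<close>, which
is a pullback cocone.\<close>

lemma fully_faithful_imp_represents:
  assumes ff: "pullback_cocones_fully_faithful I C D c \<eta>"
  shows represents_modifications
  unfolding represents_modifications_def
proof (intro allI impI, elim conjE)
  fix d d' f m m'
  assume f: "f \<in> hom C d d'" and m: "m \<in> lhom (span_double C) c d" and m': "m' \<in> lhom (span_double C) c d'"
  interpret P: span_pair C I D c \<eta> m m' d d' f
    using f m m' by unfold_locales
  show "bij_betw whisker_cell (cells (span_double C) m m' (Idt C c) f) P.W"
    unfolding P.bij_whisker_cell_iff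
  proof
    fix \<mu> assume \<mu>: "\<mu> \<in> P.W"
    note w = P.W_capx[OF \<mu>]
    define l' where "l' i = p2 m' i \<bullet>\<^bsub>C\<^esub> capx (\<mu> i)" for i
    have l's: "l' i \<in> Arr C" "Dom C (l' i) = Dom C (p1 m i)" "Cod C (l' i) = Dom C (lleg m')"
      if "i \<in> Obj I" for i using w(1-3)[OF that] that by (simp_all add: l'_def)
    have "l' (Cod I u) \<bullet>\<^bsub>C\<^esub> induced m u = l' (Dom I u)" if u: "u \<in> Arr I" for u
    proof -
      have ij: "Dom I u \<in> Obj I" "Cod I u \<in> Obj I" using u by simp_all
      have "l' (Cod I u) \<bullet>\<^bsub>C\<^esub> induced m u = p2 m' (Cod I u) \<bullet>\<^bsub>C\<^esub> capx (\<mu> (Cod I u)) \<bullet>\<^bsub>C\<^esub> induced m u"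
        unfolding l'_def by (rule assoc_simp) (use u w(1-3)[OF ij(2)] in simp_all)
      also have "\<dots> = p2 m' (Cod I u) \<bullet>\<^bsub>C\<^esub> induced m' u \<bullet>\<^bsub>C\<^esub> capx (\<mu> (Dom I u))"
        using \<mu> u unfolding P.W_iff by simp
      also have "\<dots> = l' (Dom I u)"
        unfolding l'_def by (rule reassoc1[OF induced_simps(5)]) (use u w(1-3)[OF ij(1)] in simp_all)
      finally show ?thesis .
    qed
    then have coc: "is_cocone I C (pulled_back_diagram m) (Dom C (lleg m')) l'"
      using l's by (simp add: is_cocone_def pulled_back_diagram_def hom_def)
    have h': "\<forall>i\<in>Obj I. lleg m' \<bullet>\<^bsub>C\<^esub> l' i = \<eta> i \<bullet>\<^bsub>C\<^esub> p1 m i"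
    proof
      fix i assume i: "i \<in> Obj I"
      have "lleg m' \<bullet>\<^bsub>C\<^esub> l' i = \<eta> i \<bullet>\<^bsub>C\<^esub> p1 m' i \<bullet>\<^bsub>C\<^esub> capx (\<mu> i)"
        unfolding l'_def by (rule pb_square') (use i w(1-3)[OF i] in simp_all)
      then show "lleg m' \<bullet>\<^bsub>C\<^esub> l' i = \<eta> i \<bullet>\<^bsub>C\<^esub> p1 m i" using w(4)[OF i] by simp
    qed
    have g': "\<forall>i\<in>Obj I. rleg m' \<bullet>\<^bsub>C\<^esub> l' i = f \<bullet>\<^bsub>C\<^esub> rleg m \<bullet>\<^bsub>C\<^esub> p2 m i"
      using w(5) by (simp add: l'_def)
    have homs: "lleg m' \<in> hom C (Dom C (lleg m')) c" "rleg m \<in> hom C (Dom C (lleg m)) d"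
      "rleg m' \<in> hom C (Dom C (lleg m')) d'" by (simp_all add: hom_def)
    have "\<exists>!k. k \<in> hom C (Dom C (lleg m)) (Dom C (lleg m')) \<and> lleg m' \<bullet>\<^bsub>C\<^esub> k = lleg m \<and>
      rleg m' \<bullet>\<^bsub>C\<^esub> k = f \<bullet>\<^bsub>C\<^esub> rleg m \<and> (\<forall>i\<in>Obj I. k \<bullet>\<^bsub>C\<^esub> p2 m i = l' i)"
      using ff pulled_back_cocone[OF P.m_simps(1,2)] coc homs f h' g'
      unfolding pullback_cocones_fully_faithful_def by blast
    then show "\<exists>!k. k \<in> hom C (Dom C (lleg m)) (Dom C (lleg m')) \<and> lleg m' \<bullet>\<^bsub>C\<^esub> k = lleg m \<and>
      rleg m' \<bullet>\<^bsub>C\<^esub> k = f \<bullet>\<^bsub>C\<^esub> rleg m \<and> (\<forall>i\<in>Obj I. k \<bullet>\<^bsub>C\<^esub> p2 m i = p2 m' i \<bullet>\<^bsub>C\<^esub> capx (\<mu> i))"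
      unfolding l'_def .
  qed
qed

text \<open>Bijectivity on cells speaks about the chosen pullbacks of \<open>h\<close> along \<open>\<eta> i\<close>.  The isomorphism \<open>b\<close> from these
to the given diagram \<open>E'\<close> is natural, and turns the cocone \<open>l'\<close> on \<open>E'\<close> into a natural family \<open>\<kappa>\<close> between chosen
pullbacks, that is, into a modification.\<close>

lemma represents_imp_fully_faithful:
  assumes rep: represents_modifications
  shows "pullback_cocones_fully_faithful I C D c \<eta>"
  unfolding pullback_cocones_fully_faithful_def
proof (intro allI impI, elim conjE)
  fix E' \<alpha> x l h x' l' h' d d' g g' f
  assume pc: "pullback_cocone I C D c \<eta> E' \<alpha> x l h" and l': "is_cocone I C E' x' l'"
    and h': "h' \<in> hom C x' c" "\<forall>i\<in>Obj I. h' \<bullet>\<^bsub>C\<^esub> l' i = \<eta> i \<bullet>\<^bsub>C\<^esub> \<alpha> i"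
    and g: "g \<in> hom C x d" "g' \<in> hom C x' d'" and f: "f \<in> hom C d d'"
    and gl: "\<forall>i\<in>Obj I. g' \<bullet>\<^bsub>C\<^esub> l' i = f \<bullet>\<^bsub>C\<^esub> g \<bullet>\<^bsub>C\<^esub> l i"
  note p = pullback_coconeD[OF pc]
  define m where "m = \<lparr>lleg = h, rleg = g\<rparr>"
  define m' where "m' = \<lparr>lleg = h', rleg = g'\<rparr>"
  have legs: "lleg m = h" "rleg m = g" "lleg m' = h'" "rleg m' = g'" by (simp_all add: m_def m'_def)
  have m: "m \<in> lhom (span_double C) c d" and m': "m' \<in> lhom (span_double C) c d'"
    using p(4) h'(1) g by (auto simp: m_def m'_def hom_def intro!: in_spansI)
  interpret P: span_pair C I D c \<eta> m m' d d' f
    using f m m' by unfold_locales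
  have dom: "Dom C (lleg m) = x" "Dom C (lleg m') = x'"
    using p(4) h'(1) by (auto simp: legs hom_def)
  have ls: "l i \<in> Arr C" "Dom C (l i) = fob E' i" "Cod C (l i) = x"
    "l' i \<in> Arr C" "Dom C (l' i) = fob E' i" "Cod C (l' i) = x'"
    "\<alpha> i \<in> Arr C" "Dom C (\<alpha> i) = fob E' i" "Cod C (\<alpha> i) = fob D i" if "i \<in> Obj I" for i
    using p(2,3) l' that by (auto simp: is_cocone_def cartesian_transformation_def hom_def)
  have "\<exists>b b'. inverse_arrows C b b' \<and> Dom C b = Dom C (p1 m i) \<and> Cod C b = fob E' i \<and>
      l i \<bullet>\<^bsub>C\<^esub> b = p2 m i \<and> \<alpha> i \<bullet>\<^bsub>C\<^esub> b = p1 m i \<and> p2 m i \<bullet>\<^bsub>C\<^esub> b' = l i" if i: "i \<in> Obj I" for i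
  proof -
    have pb: "is_pullback C h (\<eta> i) (p2 m i) (p1 m i)"
      using p_square(1)[OF P.m_simps(1,2) i] by (simp only: legs)
    have eq: "Dom C (p2 m i) = Dom C (p1 m i)" "Dom C (l i) = fob E' i" using i ls[OF i] by simp_all
    show ?thesis
      by (rule pullback_comparison_iso[OF p(5)[OF i] pb], unfold eq) blast
  qed
  then obtain b b' where b: "\<And>i. i \<in> Obj I \<Longrightarrow> inverse_arrows C (b i) (b' i) \<and> Dom C (b i) = Dom C (p1 m i) \<and>
      Cod C (b i) = fob E' i \<and> l i \<bullet>\<^bsub>C\<^esub> b i = p2 m i \<and> \<alpha> i \<bullet>\<^bsub>C\<^esub> b i = p1 m i \<and> p2 m i \<bullet>\<^bsub>C\<^esub> b' i = l i"
    by metis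
  have bs: "b i \<in> Arr C" "Dom C (b i) = Dom C (p1 m i)" "Cod C (b i) = fob E' i"
    "l i \<bullet>\<^bsub>C\<^esub> b i = p2 m i" "\<alpha> i \<bullet>\<^bsub>C\<^esub> b i = p1 m i" "p2 m i \<bullet>\<^bsub>C\<^esub> b' i = l i"
    "b' i \<in> Arr C" "Dom C (b' i) = fob E' i" "Cod C (b' i) = Dom C (p1 m i)"
    "b i \<bullet>\<^bsub>C\<^esub> b' i = Idt C (fob E' i)" if "i \<in> Obj I" for i
    using b[OF that] by (auto simp: inverse_arrows_def hom_def)
  have lbs: "h' \<bullet>\<^bsub>C\<^esub> l' i \<bullet>\<^bsub>C\<^esub> b i = \<eta> i \<bullet>\<^bsub>C\<^esub> p1 m i" if i: "i \<in> Obj I" for i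
  proof -
    have "h' \<bullet>\<^bsub>C\<^esub> l' i \<bullet>\<^bsub>C\<^esub> b i = \<eta> i \<bullet>\<^bsub>C\<^esub> \<alpha> i \<bullet>\<^bsub>C\<^esub> b i"
      by (rule reassoc) (use h' i bs(1-3)[OF i] ls[OF i] in \<open>simp_all add: hom_def\<close>)
    then show ?thesis using bs(5)[OF i] by simp
  qed
  define \<kappa> where "\<kappa> i = pbmed C (\<eta> i) h' (p1 m i) (l' i \<bullet>\<^bsub>C\<^esub> b i)" for i
  have \<kappa>: "\<kappa> i \<in> Arr C" "Dom C (\<kappa> i) = Dom C (p1 m i)" "Cod C (\<kappa> i) = Dom C (p1 m' i)"
    "p1 m' i \<bullet>\<^bsub>C\<^esub> \<kappa> i = p1 m i" "p2 m' i \<bullet>\<^bsub>C\<^esub> \<kappa> i = l' i \<bullet>\<^bsub>C\<^esub> b i" if i: "i \<in> Obj I" for i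
    using pbmed_simps[of "\<eta> i" h' "p1 m i" "l' i \<bullet>\<^bsub>C\<^esub> b i"] lbs[OF i] bs(1-3)[OF i] ls[OF i] i h'(1)
    unfolding \<kappa>_def legs by (auto simp: hom_def simp flip: legs)
  define \<mu> where "\<mu> = (\<lambda>i\<in>Obj I. \<lparr>csrc = lob (whisker m) i, ctgt = lob (whisker m') i, capx = \<kappa> i,
      clft = Idt C (fob D i), crgt = f\<rparr>)"
  have bnat: "b (Cod I u) \<bullet>\<^bsub>C\<^esub> induced m u = far E' u \<bullet>\<^bsub>C\<^esub> b (Dom I u)" if u: "u \<in> Arr I" for u
  proof -
    let ?i = "Dom I u" and ?j = "Cod I u"
    have ij: "?i \<in> Obj I" "?j \<in> Obj I" using u by simp_all
    have Eu: "far E' u \<in> Arr C" "Dom C (far E' u) = fob E' ?i" "Cod C (far E' u) = fob E' ?j"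
      using p(1) u by (auto simp: is_functor_def hom_def)
    have lE: "l ?j \<bullet>\<^bsub>C\<^esub> far E' u = l ?i" using p(3) u by (simp add: is_cocone_def)
    have "is_pullback C (far D u) (\<alpha> ?j) (\<alpha> ?i) (far E' u)"
      using p(2) u by (simp add: cartesian_transformation_def)
    from is_pullback_simps(9)[OF this]
    have \<alpha>E: "\<alpha> ?j \<bullet>\<^bsub>C\<^esub> far E' u = far D u \<bullet>\<^bsub>C\<^esub> \<alpha> ?i" by (rule sym)
    note n = induced_simps[OF P.m_simps(1,2) u]
    note bi = bs[OF ij(1)] and bj = bs[OF ij(2)] and li = ls[OF ij(1)] and lj = ls[OF ij(2)]
    show ?thesis
    proof (rule pullback_jointly_monic[OF p(5)[OF ij(2)]])
      have "l ?j \<bullet>\<^bsub>C\<^esub> b ?j \<bullet>\<^bsub>C\<^esub> induced m u = p2 m ?j \<bullet>\<^bsub>C\<^esub> induced m u"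
        by (rule reassoc1[OF bj(4)]) (use bj(1-3) lj n(1-3) in simp_all)
      moreover have "l ?j \<bullet>\<^bsub>C\<^esub> far E' u \<bullet>\<^bsub>C\<^esub> b ?i = l ?i \<bullet>\<^bsub>C\<^esub> b ?i"
        by (rule reassoc1[OF lE]) (use bi(1-3) lj Eu in simp_all)
      ultimately show "l ?j \<bullet>\<^bsub>C\<^esub> b ?j \<bullet>\<^bsub>C\<^esub> induced m u = l ?j \<bullet>\<^bsub>C\<^esub> far E' u \<bullet>\<^bsub>C\<^esub> b ?i"
        using n(5) bi(4) by simp
      have "\<alpha> ?j \<bullet>\<^bsub>C\<^esub> b ?j \<bullet>\<^bsub>C\<^esub> induced m u = p1 m ?j \<bullet>\<^bsub>C\<^esub> induced m u"
        by (rule reassoc1[OF bj(5)]) (use bj(1-3) lj n(1-3) in simp_all)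
      moreover have "\<alpha> ?j \<bullet>\<^bsub>C\<^esub> far E' u \<bullet>\<^bsub>C\<^esub> b ?i = far D u \<bullet>\<^bsub>C\<^esub> \<alpha> ?i \<bullet>\<^bsub>C\<^esub> b ?i"
        by (rule reassoc[OF \<alpha>E]) (use bi(1-3) li lj Eu u in simp_all)
      ultimately show "\<alpha> ?j \<bullet>\<^bsub>C\<^esub> b ?j \<bullet>\<^bsub>C\<^esub> induced m u = \<alpha> ?j \<bullet>\<^bsub>C\<^esub> far E' u \<bullet>\<^bsub>C\<^esub> b ?i"
        using n(4) bi(5) by simp
    qed (use bi(1-3) bj(1-3) n(1-3) Eu lj in simp_all)
  qed
  have \<mu>W: "\<mu> \<in> P.W"
    unfolding P.W_iff
  proof (intro conjI ballI)
    show "\<mu> \<in> extensional (Obj I)" by (simp add: \<mu>_def)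
    fix i assume i: "i \<in> Obj I"
    have \<mu>i: "\<mu> i = \<lparr>csrc = lob (whisker m) i, ctgt = lob (whisker m') i, capx = \<kappa> i,
      clft = Idt C (fob D i), crgt = f\<rparr>" using i by (simp add: \<mu>_def)
    have "g' \<bullet>\<^bsub>C\<^esub> l' i \<bullet>\<^bsub>C\<^esub> b i = (f \<bullet>\<^bsub>C\<^esub> g) \<bullet>\<^bsub>C\<^esub> l i \<bullet>\<^bsub>C\<^esub> b i"
      by (rule reassoc) (use gl g f i bs(1-3)[OF i] ls[OF i] in \<open>simp_all add: hom_def\<close>)
    then have "rleg m' \<bullet>\<^bsub>C\<^esub> p2 m' i \<bullet>\<^bsub>C\<^esub> \<kappa> i = f \<bullet>\<^bsub>C\<^esub> rleg m \<bullet>\<^bsub>C\<^esub> p2 m i"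
      unfolding \<kappa>(5)[OF i] bs(4)[OF i] legs(2)[symmetric] legs(4)[symmetric] using i by simp
    then have "\<mu> i \<in> span_cells C"
      using \<kappa>(1-4)[OF i] i unfolding \<mu>i by (intro in_span_cellsI) simp_all
    then show "\<mu> i \<in> cells (span_double C) (lob (whisker m) i) (lob (whisker m') i) (Idt C (fob D i)) f"
      by (simp add: \<mu>i)
  next
    fix u assume u: "u \<in> Arr I"
    let ?i = "Dom I u" and ?j = "Cod I u"
    have ij: "?i \<in> Obj I" "?j \<in> Obj I" using u by simp_all
    have Eu: "far E' u \<in> Arr C" "Dom C (far E' u) = fob E' ?i" "Cod C (far E' u) = fob E' ?j"
      using p(1) u by (auto simp: is_functor_def hom_def)
    have lE: "l' ?j \<bullet>\<^bsub>C\<^esub> far E' u = l' ?i" using l' u by (simp add: is_cocone_def)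
    note n = induced_simps[OF P.m_simps(1,2) u] and n' = induced_simps[OF P.m_simps(4,5) u]
    note bi = bs[OF ij(1)] and bj = bs[OF ij(2)] and li = ls[OF ij(1)] and lj = ls[OF ij(2)]
    note \<kappa>i = \<kappa>[OF ij(1)] and \<kappa>j = \<kappa>[OF ij(2)]
    have "induced m' u \<bullet>\<^bsub>C\<^esub> \<kappa> ?i = \<kappa> ?j \<bullet>\<^bsub>C\<^esub> induced m u"
    proof (rule pb_joint_monic[of "\<eta> ?j" "lleg m'"])
      have "p1 m' ?j \<bullet>\<^bsub>C\<^esub> induced m' u \<bullet>\<^bsub>C\<^esub> \<kappa> ?i = far D u \<bullet>\<^bsub>C\<^esub> p1 m' ?i \<bullet>\<^bsub>C\<^esub> \<kappa> ?i"
        by (rule reassoc[OF n'(4)]) (use u n'(1-3) \<kappa>i(1-3) in simp_all)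
      also have "\<dots> = p1 m ?j \<bullet>\<^bsub>C\<^esub> induced m u" unfolding \<kappa>i(4) n(4) ..
      also have "\<dots> = p1 m' ?j \<bullet>\<^bsub>C\<^esub> \<kappa> ?j \<bullet>\<^bsub>C\<^esub> induced m u"
        by (rule reassoc1[OF \<kappa>j(4), symmetric]) (use u n(1-3) \<kappa>j(1-3) in simp_all)
      finally show "p1 m' ?j \<bullet>\<^bsub>C\<^esub> induced m' u \<bullet>\<^bsub>C\<^esub> \<kappa> ?i = p1 m' ?j \<bullet>\<^bsub>C\<^esub> \<kappa> ?j \<bullet>\<^bsub>C\<^esub> induced m u" .
      have "p2 m' ?j \<bullet>\<^bsub>C\<^esub> induced m' u \<bullet>\<^bsub>C\<^esub> \<kappa> ?i = p2 m' ?i \<bullet>\<^bsub>C\<^esub> \<kappa> ?i"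
        by (rule reassoc1[OF n'(5)]) (use u n'(1-3) \<kappa>i(1-3) in simp_all)
      also have "\<dots> = l' ?j \<bullet>\<^bsub>C\<^esub> far E' u \<bullet>\<^bsub>C\<^esub> b ?i"
        unfolding \<kappa>i(5) by (rule reassoc1[OF lE, symmetric]) (use bi(1-3) lj Eu in simp_all)
      also have "\<dots> = (l' ?j \<bullet>\<^bsub>C\<^esub> b ?j) \<bullet>\<^bsub>C\<^esub> induced m u"
        unfolding bnat[OF u, symmetric] by (rule assoc_simp[symmetric]) (use bj(1-3) lj n(1-3) in simp_all)
      also have "\<dots> = p2 m' ?j \<bullet>\<^bsub>C\<^esub> \<kappa> ?j \<bullet>\<^bsub>C\<^esub> induced m u"
        unfolding \<kappa>j(5)[symmetric] by (rule assoc_simp) (use u n(1-3) \<kappa>j(1-3) in simp_all)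
      finally show "p2 m' ?j \<bullet>\<^bsub>C\<^esub> induced m' u \<bullet>\<^bsub>C\<^esub> \<kappa> ?i = p2 m' ?j \<bullet>\<^bsub>C\<^esub> \<kappa> ?j \<bullet>\<^bsub>C\<^esub> induced m u" .
    qed (use u n(1-3) n'(1-3) \<kappa>i(1-3) \<kappa>j(1-3) in simp_all)
    then show "induced m' u \<bullet>\<^bsub>C\<^esub> capx (\<mu> ?i) = capx (\<mu> ?j) \<bullet>\<^bsub>C\<^esub> induced m u"
      using ij by (simp add: \<mu>_def)
  qed
  have "bij_betw whisker_cell (cells (span_double C) m m' (Idt C c) f) P.W"
    using rep f m m' unfolding represents_modifications_def by blast
  then have ex: "\<exists>!k. k \<in> hom C x x' \<and> h' \<bullet>\<^bsub>C\<^esub> k = h \<and> g' \<bullet>\<^bsub>C\<^esub> k = f \<bullet>\<^bsub>C\<^esub> g \<and>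
      (\<forall>i\<in>Obj I. k \<bullet>\<^bsub>C\<^esub> p2 m i = p2 m' i \<bullet>\<^bsub>C\<^esub> capx (\<mu> i))"
    unfolding P.bij_whisker_cell_iff dom legs(2,4) using \<mu>W by (simp only: legs)
  have eq: "(k \<bullet>\<^bsub>C\<^esub> p2 m i = p2 m' i \<bullet>\<^bsub>C\<^esub> capx (\<mu> i)) \<longleftrightarrow> k \<bullet>\<^bsub>C\<^esub> l i = l' i"
    if k: "k \<in> hom C x x'" and i: "i \<in> Obj I" for k i
  proof -
    have kA: "k \<in> Arr C" "Dom C k = x" "Cod C k = x'" using k by (auto simp: hom_def)
    have "p2 m' i \<bullet>\<^bsub>C\<^esub> capx (\<mu> i) = l' i \<bullet>\<^bsub>C\<^esub> b i" using \<kappa>(5)[OF i] i by (simp add: \<mu>_def)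
    moreover have "k \<bullet>\<^bsub>C\<^esub> p2 m i = (k \<bullet>\<^bsub>C\<^esub> l i) \<bullet>\<^bsub>C\<^esub> b i"
      unfolding bs(4)[OF i, symmetric] by (rule assoc_simp[symmetric]) (use kA bs(1-3)[OF i] ls[OF i] in simp_all)
    moreover have "k \<bullet>\<^bsub>C\<^esub> l i = l' i" if e: "(k \<bullet>\<^bsub>C\<^esub> l i) \<bullet>\<^bsub>C\<^esub> b i = l' i \<bullet>\<^bsub>C\<^esub> b i"
    proof -
      have "(k \<bullet>\<^bsub>C\<^esub> l i) \<bullet>\<^bsub>C\<^esub> b i \<bullet>\<^bsub>C\<^esub> b' i = l' i \<bullet>\<^bsub>C\<^esub> b i \<bullet>\<^bsub>C\<^esub> b' i"
        by (rule reassoc[OF e]) (use kA bs(1-3,7-9)[OF i] ls[OF i] in simp_all)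
      then show ?thesis unfolding bs(10)[OF i] using kA ls[OF i] by simp
    qed
    ultimately show ?thesis by auto
  qed
  show "\<exists>!k. k \<in> hom C x x' \<and> h' \<bullet>\<^bsub>C\<^esub> k = h \<and> g' \<bullet>\<^bsub>C\<^esub> k = f \<bullet>\<^bsub>C\<^esub> g \<and>
      (\<forall>i\<in>Obj I. k \<bullet>\<^bsub>C\<^esub> l i = l' i)"
    using ex eq by (metis (no_types, lifting))
qed

end

theorem proposition5p9:
  fixes C :: "('o, 'a) cat" and I :: "('i, 'j) cat" and D :: "('i, 'j, 'o, 'a) ftor"
    and c :: 'o and \<eta> :: "'i \<Rightarrow> 'a"
  assumes "category C" and "has_pullbacks C" and "category I"
    and "is_functor I C D" and "colimit_cocone I C D c \<eta>"
  shows "van_kampen I C D c \<eta> \<and> cartesian_colimits I C D \<longleftrightarrow>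
    loose_colimit_cocone (loose_double I) (span_double C)
      (companion_diagram I C D) c (companion_cocone I C D c \<eta>)"
proof -
  interpret C: category C by fact
  interpret I: category I by fact
  interpret spans_under_cocone C I D c \<eta>
    by unfold_locales (use assms in \<open>auto simp: colimit_cocone_def\<close>)
  show ?thesis
    unfolding van_kampen_iff_spans_represent_cocones loose_colimit_cocone_iff
    using factor_imp_represents represents_imp_factor
      fully_faithful_imp_represents represents_imp_fully_faithful by blast
qed

end
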